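(* Let $k,d$ be integers with $k\ge 1$ and $d-k\ge 1$, and let $f=f_{(k,d-k)}\in S=\mathbb{C}[x_0,x_1,x_2,x_3]$ be a general bihomogeneous polynomial of bidegree $(k,d-k)$, i.e. of degree $k$ in $x_0,x_1$ and of degree $d-k$ in $x_2,x_3$. Let $D=V(f)$ be the corresponding surface of degree $d$ in $\mathbb{P}^3$. Then $D$ is reduced, and if $d-k$ is odd, then $M(f)$ has a minimal first syzygy of bidegree $$(2k,0)+\frac{d-k-1}{2}\,(3k-2,3).$$ Hence, if $d-k$ is odd, in the $\mathbb{Z}$-grading $$\operatorname{reg} M(f_{(k,d-k)})\ \ge\ \frac{3k+1}{2}\,d-\frac{3k^2+5}{2},$$ and taking $k=\frac{d-1}{3}$ (when this is a positive integer) yields $$\operatorname{reg} M\big(f_{(\frac{d-1}{3},\frac{2d+1}{3})}\big)\ \ge\ \frac13\,(d^2+d-8).$$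
   Context: $S=\mathbb{C}[x_0,x_1,x_2,x_3]$ is bigraded with $\deg x_0=\deg x_1=(1,0)$ and $\deg x_2=\deg x_3=(0,1)$; the $\mathbb{Z}$-grading is the standard (total) grading. "General" means: for all $f$ in some nonempty Zariski-open subset of the vector space $S_{(k,d-k)}$. $J_f=(f_0,f_1,f_2,f_3)$ is the ideal of partial derivatives $f_i=\partial f/\partial x_i$, and $M(f)=S/J_f$. Here $f_0,f_1$ have bidegree $(k-1,d-k)$ and $f_2,f_3$ have bidegree $(k,d-k-1)$. First syzygies are elements of the kernel $\mathrm{Syz}$ of the bigraded map $S(-k+1,-d+k)^2\oplus S(-k,-d+k+1)^2\to S$ given by $(f_0,f_1,f_2,f_3)$, with the induced bigrading: a syzygy $(a_0,a_1,a_2,a_3)$, $\sum a_if_i=0$, has bidegree $(u,v)$ if each nonzero $a_i$ is bihomogeneous with $\deg a_i+\deg f_i=(u,v)$. A minimal first syzygy is an element of a minimal bihomogeneous generating set of $\mathrm{Syz}$. $\operatorname{reg}$ denotes Castelnuovo–Mumford regularity over $S$ with the standard $\mathbb{Z}$-grading: for a minimal graded free resolution $F_\bullet$ of $M$ with $F_i=\bigoplus_j S(-a_{i,j})$, $\operatorname{reg}M=\max_{i,j}\{a_{i,j}-i\}$. *)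

theory Defs
  imports "HOL-Analysis.Finite_Cartesian_Product" "HOL-Analysis.Cartesian_Space"
    "HOL-Library.Poly_Mapping" "HOL-Library.Extended_Real"
begin

section \<open>The ring $S = C[x_0,x_1,x_2,x_3]$\<close>

text \<open>
  A monomial is its exponent vector and a polynomial the finitely supported map of its
  coefficients. The four variables are indexed by the elements 0, 1, 2, 3 of the type \<open>4\<close>.
\<close>

type_synonym monom4 = "4 \<Rightarrow>\<^sub>0 nat"
type_synonym S = "monom4 \<Rightarrow>\<^sub>0 complex"

definition X :: "4 \<Rightarrow> S" where
  "X i = Poly_Mapping.single (Poly_Mapping.single i 1) 1"

text \<open>The subtraction of exponents truncates only when \<open>lookup m i = 0\<close>, where the
  coefficient vanishes.\<close>

definition partial :: "4 \<Rightarrow> S \<Rightarrow> S" where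
  "partial i f = (\<Sum>m\<in>Poly_Mapping.keys f.
     Poly_Mapping.single (m - Poly_Mapping.single i 1)
       (of_nat (Poly_Mapping.lookup m i) * Poly_Mapping.lookup f m))"

text \<open>
  The graded pieces $S_e$ and $S_{(u,v)}$. Degrees are integers, so that pieces of negative
  degree are \<open>{0}\<close>; the zero polynomial lies in every piece.
\<close>

definition hom_part :: "int \<Rightarrow> S set" where
  "hom_part e = {p. \<forall>m\<in>Poly_Mapping.keys p. (\<Sum>i\<in>UNIV. int (Poly_Mapping.lookup m i)) = e}"

definition bihom_part :: "int \<times> int \<Rightarrow> S set" where
  "bihom_part uv = {p. \<forall>m\<in>Poly_Mapping.keys p.
     (int (Poly_Mapping.lookup m 0 + Poly_Mapping.lookup m 1),
      int (Poly_Mapping.lookup m 2 + Poly_Mapping.lookup m 3)) = uv}"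


section \<open>General elements of a space of polynomials\<close>

definition eval_poly :: "('v \<Rightarrow> complex) \<Rightarrow> (('v \<Rightarrow>\<^sub>0 nat) \<Rightarrow>\<^sub>0 complex) \<Rightarrow> complex" where
  "eval_poly c P = (\<Sum>m\<in>Poly_Mapping.keys P.
     Poly_Mapping.lookup P m * (\<Prod>v\<in>Poly_Mapping.keys m. c v ^ Poly_Mapping.lookup m v))"

text \<open>
  The coordinates of \<open>f\<close> in the vector space \<open>V\<close> are its coefficients, so polynomial functions on
  \<open>V\<close> are polynomials in indeterminates indexed by the monomials of \<open>S\<close>. An open set is the
  complement in \<open>V\<close> of the common zero locus of a set \<open>\<P>\<close> of such functions.
\<close>

definition zariski_open_in :: "S set \<Rightarrow> S set \<Rightarrow> bool" where
  "zariski_open_in V U \<longleftrightarrow>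
     (\<exists>\<P> :: ((monom4 \<Rightarrow>\<^sub>0 nat) \<Rightarrow>\<^sub>0 complex) set.
        U = {f \<in> V. \<exists>P\<in>\<P>. eval_poly (Poly_Mapping.lookup f) P \<noteq> 0})"

definition general_in :: "S set \<Rightarrow> (S \<Rightarrow> bool) \<Rightarrow> bool" where
  "general_in V Q \<longleftrightarrow> (\<exists>U. zariski_open_in V U \<and> U \<noteq> {} \<and> (\<forall>f\<in>U. Q f))"


section \<open>Reducedness of the scheme $V(f)$ in projective 3-space\<close>

text \<open>
  The scheme $V(f) = \mathrm{Proj}\, S/(f)$ is reduced iff the coordinate rings of its four standard
  affine charts have no nonzero nilpotent elements. The ring of the \<open>i\<close>-th chart is the degree-0
  part of the localization of $S/(f)$ at $x_i$. Its elements are the fractions $g / x_i^e$ with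
  \<open>g\<close> homogeneous of degree \<open>e\<close>; such a fraction is zero iff $x_i^q g \in (f)$ for some \<open>q\<close>,
  and its \<open>n\<close>-th power is zero iff $x_i^p g^n \in (f)$ for some \<open>p\<close>.
\<close>

definition reduced_scheme :: "S \<Rightarrow> bool" where
  "reduced_scheme f \<longleftrightarrow>
     (\<forall>i e n. \<forall>g \<in> hom_part (int e).
        (\<exists>p. f dvd X i ^ p * g ^ n) \<longrightarrow> (\<exists>q. f dvd X i ^ q * g))"


section \<open>Jacobian ideal and first syzygies\<close>

definition jacobian_ideal :: "S \<Rightarrow> S set" where
  "jacobian_ideal f = range (\<lambda>a :: S ^ 4. \<Sum>i\<in>UNIV. a $ i * partial i f)"

definition Syz :: "S \<Rightarrow> (S ^ 4) set" where
  "Syz f = {a. (\<Sum>i\<in>UNIV. a $ i * partial i f) = 0}"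

interpretation S4: module "(*s) :: S \<Rightarrow> S ^ 4 \<Rightarrow> S ^ 4"
  by unfold_locales (simp_all add: vec_eq_iff distrib_left distrib_right mult.assoc)

definition partial_bidegree :: "int \<times> int \<Rightarrow> 4 \<Rightarrow> int \<times> int" where
  "partial_bidegree kl i = (if i \<in> {0, 1} then kl - (1, 0) else kl - (0, 1))"

text \<open>
  Bidegrees of syzygies of an \<open>f\<close> of bidegree \<open>kl\<close>:
  each nonzero $a_i$ satisfies $\deg a_i + \deg f_i = uv$.
\<close>

definition bihom_syz :: "int \<times> int \<Rightarrow> int \<times> int \<Rightarrow> (S ^ 4) set" where
  "bihom_syz kl uv = {a. \<forall>i. a $ i \<in> bihom_part (uv - partial_bidegree kl i)}"

definition minimal_bihom_generators :: "int \<times> int \<Rightarrow> S \<Rightarrow> (S ^ 4) set \<Rightarrow> bool" where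
  "minimal_bihom_generators kl f G \<longleftrightarrow>
     (\<forall>g\<in>G. \<exists>uv. g \<in> bihom_syz kl uv) \<and>
     S4.span G = Syz f \<and> (\<forall>H. H \<subset> G \<longrightarrow> S4.span H \<noteq> Syz f)"

definition has_minimal_first_syzygy :: "int \<times> int \<Rightarrow> S \<Rightarrow> int \<times> int \<Rightarrow> bool" where
  "has_minimal_first_syzygy kl f uv \<longleftrightarrow>
     (\<exists>G. minimal_bihom_generators kl f G \<and> (\<exists>g\<in>G. g \<in> bihom_syz kl uv))"


section \<open>Minimal graded free resolutions and Castelnuovo-Mumford regularity\<close>

text \<open>
  A minimal graded free resolution
  $\cdots \to F_2 \to F_1 \to F_0 \to S/I \to 0$ with $F_i = \bigoplus_{j < r_i} S(-a_{i,j})$.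
  The map $F_{i+1} \to F_i$ has the matrix \<open>\<phi> i\<close> (row index first), whose \<open>(j,l)\<close> entry is
  homogeneous of degree $a_{i+1,l} - a_{i,j}$; the map $F_0 \to S/I$ sends the \<open>j\<close>-th basis
  vector to the class of \<open>\<epsilon> j\<close>. Elements of $F_i$ are functions \<open>nat \<Rightarrow> S\<close>, of which only the
  values at arguments below \<open>r i\<close> matter. The conditions are, in this order: homogeneity of
  \<open>\<epsilon>\<close> and \<open>\<phi>\<close>, exactness at $S/I$, at $F_0$ and at $F_{i+1}$, and minimality (all matrix
  entries have constant term zero).
\<close>

definition minimal_graded_free_resolution ::
  "S set \<Rightarrow> (nat \<Rightarrow> nat) \<Rightarrow> (nat \<Rightarrow> nat \<Rightarrow> int) \<Rightarrow> (nat \<Rightarrow> S) \<Rightarrow> (nat \<Rightarrow> nat \<Rightarrow> nat \<Rightarrow> S) \<Rightarrow> bool"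
where
  "minimal_graded_free_resolution I r a \<epsilon> \<phi> \<longleftrightarrow>
     (\<forall>j<r 0. \<epsilon> j \<in> hom_part (a 0 j)) \<and>
     (\<forall>i. \<forall>j<r i. \<forall>l<r (Suc i). \<phi> i j l \<in> hom_part (a (Suc i) l - a i j)) \<and>
     (\<forall>s. \<exists>v. s - (\<Sum>j<r 0. \<epsilon> j * v j) \<in> I) \<and>
     (\<forall>v. (\<Sum>j<r 0. \<epsilon> j * v j) \<in> I \<longleftrightarrow>
        (\<exists>w. \<forall>j<r 0. v j = (\<Sum>l<r 1. \<phi> 0 j l * w l))) \<and>
     (\<forall>i v. (\<forall>j<r i. (\<Sum>l<r (Suc i). \<phi> i j l * v l) = 0) \<longleftrightarrow>
        (\<exists>w. \<forall>l<r (Suc i). v l = (\<Sum>p<r (Suc (Suc i)). \<phi> (Suc i) l p * w p))) \<and>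
     (\<forall>i. \<forall>j<r i. \<forall>l<r (Suc i). Poly_Mapping.lookup (\<phi> i j l) 0 = 0)"

text \<open>
  The regularity of the graded \<open>S\<close>-module $S/I$, for a homogeneous ideal \<open>I\<close>: the maximum of
  all $a_{i,j} - i$. Minimal resolutions are unique up to isomorphism, so all of them contribute
  the same numbers. The maximum, which exists for $I \neq S$ since minimal resolutions are finite,
  is written as a supremum in the extended reals; this is $-\infty$ if $I = S$.
\<close>

definition reg_quotient :: "S set \<Rightarrow> ereal" where
  "reg_quotient I = Sup {ereal (of_int (a i j - int i)) | r a \<epsilon> \<phi> i j.
     minimal_graded_free_resolution I r a \<epsilon> \<phi> \<and> j < r i}"

end

theory Submission
  imports
    Defs
    "HOL-Analysis.Analysis"
    "HOL-Computational_Algebra.Fundamental_Theorem_Algebra"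
    "HOL-Computational_Algebra.Field_as_Ring"
    "HOL-Computational_Algebra.Polynomial_Factorial"
    "HOL-Computational_Algebra.Squarefree"
    "HOL-Library.Function_Algebras"
begin

text \<open>
  Let $d - k = l = 2h+1$ and $u_0 = 2k + h(3k-2)$. In bidegree $(u,3h)$ the quadruples
  $(a_0,\dots,a_3)$ form a space whose dimension exceeds that of $S_{(u,3h)}$ plus that of the
  multiples of the Euler relation
  $l\,(x_0 f_0 + x_1 f_1) = k\,(x_2 f_2 + x_3 f_3)$ by $u - u_0 + 1$. So every \<open>f\<close>
  has in bidegree $(u_0,3h)$ a syzygy that is not a multiple of the Euler relation. If
  $S_{(u,3h)} \subseteq J_f$ for a single $u \ge u_0$, then the syzygies modulo the Euler relation
  have dimension exactly $u-u_0+1$ in bidegree $(u,3h)$; as this quotient is torsion free, all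
  syzygies of bidegree $\le (u_0,3h)$ other than $(u_0,3h)$ are multiples of the Euler relation.
  Therefore every set of bihomogeneous generators has an element of bidegree $(u_0,3h)$, and it
  contributes $u_0+3h-2$ to the regularity.

  Containment of a piece $S_{(u,v)}$ in $J_f$ is an open condition on \<open>f\<close>. It also gives
  reducedness: a repeated factor of \<open>f\<close> divides all $f_i$, hence the coprime monomials
  $x_0^u x_2^v$ and $x_1^u x_3^v$. It remains to find one such \<open>f\<close>, for $v = 3h$ if \<open>l\<close> is odd.
  Start from a pencil of binary forms in $x_2,x_3$, pulled back by the map
  $(x_0 : x_1) \mapsto (x_0^k : x_1^k)$, and add $\epsilon$ times a form that repairs the two
  ramification points. For small $\epsilon$ the forms $f_i(w)$ generate all forms of degree $3h$ in
  $x_2,x_3$ at each point $w$ of the projective line: otherwise there are functionals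
  vanishing on them for $\epsilon \to 0$, and an elementary estimate excludes a limit of these. Consequently
  every linear form in $x_0,x_1$ acts surjectively on the part of $S/J_f$ of degree $3h$ in
  $x_2,x_3$, in large degrees, while a product of such forms acts as zero, so that this part
  vanishes in large degrees.
\<close>

section \<open>Monomials, bidegrees and partial derivatives\<close>

text \<open>Why degree 3h: in degree v in x_2, x_3 (v \<ge> 2h) the excess of the quadruples over
  the forms and the Euler multiples has slope 2v - 6h + 1 in u. This is negative for v < 3h and
  equal to 1 for v = 3h, so there the syzygies modulo the Euler relation should have rank one over
  C[x_0,x_1], and u_0 is the degree in which one is first forced. The obstacle is to exclude
  unexpected syzygies in all smaller bidegrees, for every k and h. A pulled-back pencil reduces this
  to linear algebra at the points of the line, except where x_1 = 0 or x_0 = 0 and k \<ge> 2: there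
  f_1 or f_0 vanishes, and a first-order perturbation must supply the lost conditions. Only the
  limiting direction of the perturbed relation is under control, hence an estimate that is uniform
  in this direction. Regularity is a supremum over minimal resolutions, so a lower bound needs one
  to exist. It is constructed here, with finite rank in each step but no bound on its
  length.\<close>

abbreviation lk where "lk \<equiv> Poly_Mapping.lookup"
abbreviation keys where "keys \<equiv> Poly_Mapping.keys"
abbreviation single where "single \<equiv> Poly_Mapping.single"
abbreviation mon :: "'a \<Rightarrow> 'a \<Rightarrow>\<^sub>0 complex" where "mon m \<equiv> single m 1"
abbreviation cst :: "complex \<Rightarrow> 'a::zero \<Rightarrow>\<^sub>0 complex" where "cst c \<equiv> single 0 c"

lemma poly_mapping_sum_single:
  fixes p :: "'a \<Rightarrow>\<^sub>0 'b::comm_monoid_add"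
  shows "p = (\<Sum>m\<in>keys p. single m (lk p m))"
proof (rule poly_mapping_eqI)
  fix n
  show "lk p n = lk (\<Sum>m\<in>keys p. single m (lk p m)) n"
    by (simp add: lookup_sum lookup_single when_def in_keys_iff)
qed

text \<open>For statements additive in \<open>p\<close>, which are thereby checked on single terms
  only; the Leibniz and Euler rules are obtained in this way.\<close>

lemma poly_mapping_single_induct [case_names zero single add]:
  fixes p :: "'a \<Rightarrow>\<^sub>0 'b::comm_monoid_add"
  assumes "P 0" "\<And>m c. P (single m c)" "\<And>p q. P p \<Longrightarrow> P q \<Longrightarrow> P (p + q)"
  shows "P p"
proof -
  have "P (\<Sum>m\<in>A. single m (lk p m))" if "finite A" for A
    using that by (induction A rule: finite_induct) (auto intro: assms)
  then show ?thesis
    by (subst poly_mapping_sum_single) simp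
qed

text \<open>Arithmetic in the type is modulo 4; \<open>UNIV_4\<close> lists the indices as 1, 2, 3,
  4, and this turns the list into 0, 1, 2, 3.\<close>

lemma four_eq_zero: "(4::4) = 0" by simp

lemma UNIV_4_from_0: "(UNIV :: 4 set) = {0,1,2,3}"
  using UNIV_4 unfolding four_eq_zero by auto

lemma sum_4_from_0: "(\<Sum>i\<in>UNIV. F (i::4)) = F 0 + F 1 + F 2 + F 3"
  unfolding UNIV_4_from_0 by (simp add: algebra_simps)

lemma all_4: "(\<forall>i::4. P i) \<longleftrightarrow> P 0 \<and> P 1 \<and> P 2 \<and> P 3"
  by (metis UNIV_4_from_0 UNIV_I insertE singletonD)

lemma lookup_single_mult:
  fixes p :: "'a::cancel_comm_monoid_add \<Rightarrow>\<^sub>0 'b::comm_semiring_0"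
  shows "lk (single m c * p) (m + n) = c * lk p n"
proof (induction p rule: poly_mapping_single_induct)
  case (single n' c')
  then show ?case by (simp add: mult_single lookup_single when_def)
qed (simp_all add: lookup_add distrib_left)

lemma lookup_single_mult_eq_0:
  fixes p :: "'a::cancel_comm_monoid_add \<Rightarrow>\<^sub>0 'b::comm_semiring_0"
  assumes "\<And>n'. n \<noteq> m + n'"
  shows "lk (single m c * p) n = 0"
proof (induction p rule: poly_mapping_single_induct)
  case (single n' c')
  show ?case using assms[of n'] by (auto simp add: mult_single lookup_single when_def)
qed (simp_all add: lookup_add distrib_left)

lemma lookup_cst_mult [simp]: "lk (cst c * p) (m :: 'a::cancel_comm_monoid_add) = c * lk p m"
  using lookup_single_mult[of 0 c p m] by simp

lemma cst_mult_eq_iff [simp]: "cst c * cst d = (cst (c * d) :: 'a::cancel_comm_monoid_add \<Rightarrow>\<^sub>0 complex)"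
  by (simp add: mult_single)

lemma mult_eq_sum_single:
  fixes p q :: "'a::cancel_comm_monoid_add \<Rightarrow>\<^sub>0 complex"
  shows "p * q = (\<Sum>m\<in>keys p. single m (lk p m) * q)"
  by (subst (1) poly_mapping_sum_single[of p]) (simp add: sum_distrib_right)

lemma monom_add_diff:
  fixes m n :: "'v \<Rightarrow>\<^sub>0 nat"
  assumes "\<And>i. lk m i \<le> lk n i"
  shows "m + (n - m) = n"
  by (rule poly_mapping_eqI) (simp add: lookup_add lookup_minus assms)

definition mk :: "nat \<Rightarrow> nat \<Rightarrow> nat \<Rightarrow> nat \<Rightarrow> monom4" where
  "mk a b c e = single 0 a + single 1 b
     + single 2 c + single 3 e"

lemma lookup_mk [simp]:
  "lk (mk a b c e) 0 = a" "lk (mk a b c e) 1 = b" "lk (mk a b c e) 2 = c" "lk (mk a b c e) 3 = e"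
  by (simp_all add: mk_def lookup_add lookup_single when_def)

lemma monom4_eq_iff:
  "(m :: monom4) = n \<longleftrightarrow> lk m 0 = lk n 0 \<and> lk m 1 = lk n 1 \<and> lk m 2 = lk n 2 \<and> lk m 3 = lk n 3"
  by (simp add: poly_mapping_eq_iff fun_eq_iff all_4)

lemma mk_collapse [simp]: "mk (lk m 0) (lk m 1) (lk m 2) (lk m 3) = m"
  by (simp add: monom4_eq_iff)

lemma mk_add: "mk a b c e + mk a' b' c' e' = mk (a + a') (b + b') (c + c') (e + e')"
  by (simp add: monom4_eq_iff lookup_add)

lemma mk_eq_iff [simp]: "mk a b c e = mk a' b' c' e' \<longleftrightarrow> a = a' \<and> b = b' \<and> c = c' \<and> e = e'"
  by (simp add: monom4_eq_iff)

abbreviation xm :: "nat \<Rightarrow> nat \<Rightarrow> nat \<Rightarrow> nat \<Rightarrow> S" where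
  "xm a b c e \<equiv> mon (mk a b c e)"

lemma xm_mult: "xm a b c e * xm a' b' c' e' = xm (a + a') (b + b') (c + c') (e + e')"
  by (simp add: mult_single mk_add)

lemma X_eq_xm: "X 0 = xm 1 0 0 0" "X 1 = xm 0 1 0 0" "X 2 = xm 0 0 1 0" "X 3 = xm 0 0 0 1"
  by (simp_all add: X_def mk_def)

lemma X_power: "X i ^ n = mon (single i n)"
proof (induction n)
  case (Suc n)
  have "single i 1 + single i n = single i (Suc n)"
    by (simp only: single_add[symmetric] plus_1_eq_Suc)
  then show ?case
    unfolding power_Suc Suc.IH by (simp only: X_def mult_single mult_1_left)
qed (simp only: power_0 single_zero single_one)

lemma mon_dvd_iff:
  fixes p :: S
  shows "mon m dvd p \<longleftrightarrow> (\<forall>n\<in>keys p. \<forall>i. lk m i \<le> lk n i)"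
proof safe
  fix n i assume "n \<in> keys p" "mon m dvd p"
  then obtain q where "p = mon m * q" "lk (mon m * q) n \<noteq> 0"
    by (auto simp: in_keys_iff)
  then obtain n' where "n = m + n'"
    using lookup_single_mult_eq_0 by blast
  then show "lk m i \<le> lk n i" by (simp add: lookup_add)
next
  assume *: "\<forall>n\<in>keys p. \<forall>i. lk m i \<le> lk n i"
  have "mon m dvd single n (lk p n)" if "n \<in> keys p" for n
  proof
    have "m + (n - m) = n"
      using bspec[OF * that] by (intro monom_add_diff) simp
    then show "single n (lk p n) = mon m * single (n - m) (lk p n)"
      by (simp only: mult_single mult_1_left)
  qed
  then show "mon m dvd p"
    by (subst poly_mapping_sum_single) (rule dvd_sum)
qed

lemma xm_dvd_iff:
  "xm a b c e dvd p \<longleftrightarrow>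
     (\<forall>n\<in>keys p. a \<le> lk n 0 \<and> b \<le> lk n 1 \<and> c \<le> lk n 2 \<and> e \<le> lk n 3)"
  by (simp add: mon_dvd_iff all_4)

lemma mon_coprime_dvd:
  fixes p :: S
  assumes "mon m dvd mon m' * p" "\<And>i. lk m i = 0 \<or> lk m' i = 0"
  shows "mon m dvd p"
  unfolding mon_dvd_iff
proof safe
  fix n i assume n: "n \<in> keys p"
  then have "m' + n \<in> keys (mon m' * p)"
    by (simp add: in_keys_iff lookup_single_mult)
  then have "lk m i \<le> lk (m' + n) i"
    using assms(1) unfolding mon_dvd_iff by blast
  then show "lk m i \<le> lk n i"
    using assms(2)[of i] by (auto simp: lookup_add)
qed

text \<open>With cofactors \<open>c\<close>, \<open>c'\<close> of the two monomials,
  \<open>mon m' * c = mon m * c'\<close>, so \<open>mon m\<close> divides \<open>c\<close> by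
  coprimality, and cancelling it leaves an inverse of \<open>b\<close>. No unique factorisation in
  \<open>S\<close> is involved.\<close>

lemma unit_of_dvd_coprime_mons:
  fixes b :: S
  assumes "b dvd mon m" "b dvd mon m'" "\<And>i. lk m i = 0 \<or> lk m' i = 0"
  shows "b dvd 1"
proof -
  obtain c c' where c: "mon m = b * c" "mon m' = b * c'"
    using assms(1,2) by (auto elim!: dvdE)
  have nz: "mon m \<noteq> (0::S)"
    by (metis lookup_single_eq lookup_zero one_neq_zero)
  have "mon m' * c = mon m * c'"
    using c by (simp add: algebra_simps)
  then have "mon m dvd mon m' * c" by simp
  then obtain e where "c = mon m * e"
    using mon_coprime_dvd[OF _ assms(3), of c] unfolding dvd_def by blast
  then have "mon m * (b * e) = mon m * 1"
    using c by (simp add: algebra_simps)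
  then have "b * e = 1" using mult_left_cancel[OF nz] by blast
  then show ?thesis by (metis dvdI)
qed

section \<open>Bidegrees and bihomogeneous components\<close>

definition bideg :: "monom4 \<Rightarrow> int \<times> int" where
  "bideg m = (int (lk m 0 + lk m 1), int (lk m 2 + lk m 3))"

lemma bideg_add: "bideg (m + n) = bideg m + bideg n"
  by (simp add: bideg_def lookup_add)

lemma bideg_0 [simp]: "bideg 0 = 0"
  by (simp add: bideg_def zero_prod_def)

lemma bideg_mk [simp]: "bideg (mk a b c e) = (int (a + b), int (c + e))"
  by (simp add: bideg_def)

lemma bihom_part_iff: "p \<in> bihom_part \<gamma> \<longleftrightarrow> (\<forall>m\<in>keys p. bideg m = \<gamma>)"
  by (simp add: bihom_part_def bideg_def)

lemma bihom_partD: "p \<in> bihom_part \<gamma> \<Longrightarrow> lk p m \<noteq> 0 \<Longrightarrow> bideg m = \<gamma>"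
  by (simp add: bihom_part_iff in_keys_iff)

lemma bihom_part_0 [simp, intro]: "0 \<in> bihom_part \<gamma>"
  by (simp add: bihom_part_iff)

lemma bihom_part_add [intro]: "p \<in> bihom_part \<gamma> \<Longrightarrow> q \<in> bihom_part \<gamma> \<Longrightarrow> p + q \<in> bihom_part \<gamma>"
  using keys_add[of p q] by (auto simp: bihom_part_iff)

lemma bihom_part_uminus [intro]: "p \<in> bihom_part \<gamma> \<Longrightarrow> - p \<in> bihom_part \<gamma>"
  by (auto simp: bihom_part_iff)

lemma bihom_part_diff [intro]: "p \<in> bihom_part \<gamma> \<Longrightarrow> q \<in> bihom_part \<gamma> \<Longrightarrow> p - q \<in> bihom_part \<gamma>"
  using bihom_part_add[of p \<gamma> "- q"] by auto

lemma bihom_part_sum [intro]: "(\<And>i. i \<in> A \<Longrightarrow> F i \<in> bihom_part \<gamma>) \<Longrightarrow> sum F A \<in> bihom_part \<gamma>"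
  by (induction A rule: infinite_finite_induct) auto

lemma bihom_part_single: "bideg m = \<gamma> \<Longrightarrow> single m c \<in> bihom_part \<gamma>"
  by (auto simp: bihom_part_iff)

lemma bihom_part_mult: "p \<in> bihom_part \<gamma> \<Longrightarrow> q \<in> bihom_part \<delta> \<Longrightarrow> p * q \<in> bihom_part (\<gamma> + \<delta>)"
  using keys_mult[of p q] by (fastforce simp: bihom_part_iff bideg_add)

lemma bihom_part_mult_eq:
  "p \<in> bihom_part \<gamma> \<Longrightarrow> q \<in> bihom_part \<delta> \<Longrightarrow> \<epsilon> = \<gamma> + \<delta> \<Longrightarrow> p * q \<in> bihom_part \<epsilon>"
  using bihom_part_mult by simp

lemma bihom_part_cst_mult: "p \<in> bihom_part \<gamma> \<Longrightarrow> cst c * p \<in> bihom_part \<gamma>"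
  by (rule bihom_part_mult_eq[of _ 0]) (auto intro: bihom_part_single)

lemma bihom_part_disjoint: "p \<in> bihom_part \<gamma> \<Longrightarrow> p \<in> bihom_part \<delta> \<Longrightarrow> \<gamma> \<noteq> \<delta> \<Longrightarrow> p = 0"
  by (rule poly_mapping_eqI) (metis bihom_partD lookup_zero)

lemma bihom_part_neg: "fst \<gamma> < 0 \<or> snd \<gamma> < 0 \<Longrightarrow> p \<in> bihom_part \<gamma> \<Longrightarrow> p = 0"
  by (rule poly_mapping_eqI) (metis bihom_partD lookup_zero bideg_def fst_conv snd_conv not_less of_nat_0_le_iff)

definition bicomp :: "int \<times> int \<Rightarrow> S \<Rightarrow> S" where
  "bicomp \<gamma> p = Poly_Mapping.mapp (\<lambda>m c. if bideg m = \<gamma> then c else 0) p"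

lemma lookup_bicomp: "lk (bicomp \<gamma> p) m = (if bideg m = \<gamma> then lk p m else 0)"
  by (auto simp: bicomp_def lookup_mapp when_def in_keys_iff)

lemma bicomp_in: "bicomp \<gamma> p \<in> bihom_part \<gamma>"
  by (auto simp: bihom_part_iff in_keys_iff lookup_bicomp split: if_splits)

lemma bicomp_add: "bicomp \<gamma> (p + q) = bicomp \<gamma> p + bicomp \<gamma> q"
  by (rule poly_mapping_eqI) (simp add: lookup_bicomp lookup_add)

lemma bicomp_0 [simp]: "bicomp \<gamma> 0 = 0"
  by (rule poly_mapping_eqI) (simp add: lookup_bicomp)

lemma bicomp_diff: "bicomp \<gamma> (p - q) = bicomp \<gamma> p - bicomp \<gamma> q"
  by (rule poly_mapping_eqI) (simp add: lookup_bicomp lookup_minus)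

lemma bicomp_sum: "bicomp \<gamma> (sum F A) = (\<Sum>i\<in>A. bicomp \<gamma> (F i))"
  by (induction A rule: infinite_finite_induct) (simp_all add: bicomp_add)

lemma bicomp_id: "p \<in> bihom_part \<gamma> \<Longrightarrow> bicomp \<gamma> p = p"
  by (rule poly_mapping_eqI) (auto simp: lookup_bicomp dest: bihom_partD)

lemma bicomp_other: "p \<in> bihom_part \<delta> \<Longrightarrow> \<gamma> \<noteq> \<delta> \<Longrightarrow> bicomp \<gamma> p = 0"
  by (rule poly_mapping_eqI) (auto simp: lookup_bicomp dest: bihom_partD)

lemma sum_bicomp:
  assumes "finite D" "bideg ` keys p \<subseteq> D"
  shows "(\<Sum>\<gamma>\<in>D. bicomp \<gamma> p) = p"
proof (rule poly_mapping_eqI)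
  fix m
  show "lk (\<Sum>\<gamma>\<in>D. bicomp \<gamma> p) m = lk p m"
    using assms by (auto simp: lookup_sum lookup_bicomp in_keys_iff image_subset_iff)
qed

text \<open>Of the components of \<open>p\<close> only the one of bidegree \<gamma> - \<delta>
  contributes. This makes the Jacobian ideal and all kernels below bigraded.\<close>

lemma bicomp_mult:
  assumes "g \<in> bihom_part \<delta>"
  shows "bicomp \<gamma> (p * g) = bicomp (\<gamma> - \<delta>) p * g"
proof -
  let ?D = "bideg ` keys p \<union> {\<gamma> - \<delta>}"
  have p: "p = (\<Sum>\<epsilon>\<in>?D. bicomp \<epsilon> p)" by (rule sum_bicomp[symmetric]) auto
  have "bicomp \<gamma> (p * g) = (\<Sum>\<epsilon>\<in>?D. bicomp \<gamma> (bicomp \<epsilon> p * g))"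
    by (subst p) (simp only: sum_distrib_right bicomp_sum)
  also have "\<dots> = (\<Sum>\<epsilon>\<in>?D. if \<epsilon> = \<gamma> - \<delta> then bicomp \<epsilon> p * g else 0)"
  proof (rule sum.cong[OF refl])
    fix \<epsilon>
    have "bicomp \<epsilon> p * g \<in> bihom_part (\<epsilon> + \<delta>)"
      by (rule bihom_part_mult[OF bicomp_in assms])
    then show "bicomp \<gamma> (bicomp \<epsilon> p * g) = (if \<epsilon> = \<gamma> - \<delta> then bicomp \<epsilon> p * g else 0)"
      using bicomp_id[of "bicomp \<epsilon> p * g" "\<epsilon> + \<delta>"] bicomp_other[of "bicomp \<epsilon> p * g" "\<epsilon> + \<delta>" \<gamma>]
      by (cases "\<epsilon> = \<gamma> - \<delta>") (auto simp: eq_diff_eq)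
  qed
  also have "\<dots> = bicomp (\<gamma> - \<delta>) p * g" by simp
  finally show ?thesis .
qed

lemma bihom_part_imp_hom_part: "p \<in> bihom_part \<gamma> \<Longrightarrow> p \<in> hom_part (fst \<gamma> + snd \<gamma>)"
  by (auto simp: bihom_part_iff hom_part_def bideg_def sum_4_from_0)

section \<open>Partial derivatives and the two Euler formulas\<close>

lemma partial_alt:
  assumes "finite A" "keys f \<subseteq> A"
  shows "partial i f = (\<Sum>m\<in>A. single (m - single i 1)
       (of_nat (lk m i) * lk f m))"
  unfolding partial_def using assms
  by (intro sum.mono_neutral_left) (auto simp: in_keys_iff)

lemma partial_0 [simp]: "partial i 0 = 0"
  by (simp add: partial_def)

lemma partial_add: "partial i (f + g) = partial i f + partial i g"
proof -
  let ?A = "keys f \<union> keys g"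
  have "keys (f + g) \<subseteq> ?A" by (rule keys_add)
  then show ?thesis
    by (simp add: partial_alt[of ?A] lookup_add distrib_left single_add sum.distrib)
qed

lemma partial_diff: "partial i (f - g) = partial i f - partial i g"
  using partial_add[of i "f - g" g] by simp

lemma partial_single:
  "partial i (single m c) = single (m - single i 1) (of_nat (lk m i) * c)"
  by (subst partial_alt[of "{m}"]) auto

text \<open>A form free of truncated subtraction, which also shows that the coefficients of a
  derivative depend linearly on those of \<open>f\<close>.\<close>

lemma lookup_partial: "lk (partial i f) m = of_nat (lk m i + 1) * lk f (m + single i 1)"
proof (induction f rule: poly_mapping_single_induct)
  case (single n c)
  show ?case
  proof (cases "lk n i = 0")
    case True
    then have "n \<noteq> m + single i 1" by (auto simp: lookup_add)
    with True show ?thesis by (simp add: partial_single lookup_single_not_eq)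
  next
    case False
    have "single i 1 + (n - single i 1) = n"
      by (rule monom_add_diff) (use False in \<open>auto simp: lookup_single when_def\<close>)
    then have "n - single i 1 + single i 1 = n"
      by (metis add.commute)
    then have "n - single i 1 = m \<longleftrightarrow> n = m + single i 1"
      by auto
    with False show ?thesis by (auto simp: partial_single lookup_single when_def lookup_add)
  qed
qed (simp_all add: partial_add lookup_add distrib_left)

lemma partial_mult_single:
  "partial i (single m c * single n e) =
     partial i (single m c) * single n e
     + single m c * partial i (single n e)"
proof -
  let ?s = "single i (1::nat)"
  \<comment> \<open>Truncated subtraction commutes with addition only if x_i occurs in
    \<open>m\<close>; otherwise the coefficient in front is 0, which is how \<open>2\<close> and
    \<open>3\<close> are closed.\<close>
  have 1: "m - ?s + n = m + n - ?s" if "lk m i \<noteq> 0" for m n :: monom4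
    by (rule poly_mapping_eqI) (use that in \<open>auto simp: lookup_add lookup_minus lookup_single when_def\<close>)
  have 2: "single (m - ?s + n) (of_nat (lk m i) * c * e)
    = single (m + n - ?s) (of_nat (lk m i) * c * e)"
    using 1[of m n] by (cases "lk m i = 0") (simp_all only: of_nat_0 mult_zero_left single_zero not_False_eq_True)
  have 3: "single (m + (n - ?s)) (c * (of_nat (lk n i) * e))
    = single (m + n - ?s) (c * (of_nat (lk n i) * e))"
    using 1[of n m] by (cases "lk n i = 0")
      (simp_all only: add.commute of_nat_0 mult_zero_left mult_zero_right single_zero not_False_eq_True)
  show ?thesis
    by (simp only: mult_single partial_single 2 3 single_add[symmetric])
      (simp add: lookup_add algebra_simps)
qed

lemma partial_mult: "partial i (f * g) = partial i f * g + f * partial i g"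
proof (induction f rule: poly_mapping_single_induct)
  case (single m c)
  show ?case
    by (induction g rule: poly_mapping_single_induct)
      (simp_all add: partial_mult_single partial_add distrib_left)
qed (simp_all add: partial_add algebra_simps)

lemma partial_cst [simp]: "partial i (cst c) = 0"
  by (simp add: partial_single)

lemma partial_cst_mult: "partial i (cst c * f) = cst c * partial i f"
  by (simp add: partial_mult)

lemma partial_bihom:
  assumes "f \<in> bihom_part kl"
  shows "partial i f \<in> bihom_part (partial_bidegree kl i)"
proof -
  have "bideg m = partial_bidegree kl i" if "lk (partial i f) m \<noteq> 0" for m
  proof -
    have "bideg (m + single i 1) = kl"
      using assms that by (intro bihom_partD[of f]) (auto simp: lookup_partial)
    moreover have "i \<in> {0,1,2,3}" using UNIV_4_from_0 by blast
    ultimately show ?thesis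
      by (auto simp: bideg_def partial_bidegree_def lookup_add lookup_single when_def)
  qed
  then show ?thesis by (simp add: bihom_part_iff in_keys_iff)
qed

lemma euler_single:
  assumes "p = single m c"
  shows "X i * partial i p = cst (of_nat (lk m i)) * p"
proof (cases "lk m i = 0")
  case False
  have "single i 1 + (m - single i 1) = m"
    by (rule poly_mapping_eqI) (use False in \<open>auto simp: lookup_add lookup_minus lookup_single when_def\<close>)
  then show ?thesis unfolding assms partial_single X_def mult_single
    by (simp only: mult_1_left add_0_left)
qed (simp add: assms partial_single)

lemma lookup_euler: "lk (X i * partial i f) m = of_nat (lk m i) * lk f m"
proof (induction f rule: poly_mapping_single_induct)
  case (single n c)
  show ?case
    by (simp only: euler_single[OF refl] lookup_cst_mult) (auto simp: lookup_single when_def)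
qed (simp_all add: partial_add distrib_left lookup_add)

lemma euler1:
  assumes "f \<in> bihom_part (k, l)"
  shows "X 0 * partial 0 f + X 1 * partial 1 f = cst (of_int k) * f"
proof (rule poly_mapping_eqI)
  fix m
  have "of_nat (lk m 0 + lk m 1) = (of_int k :: complex)" if "lk f m \<noteq> 0"
  proof -
    have "int (lk m 0 + lk m 1) = k" using bihom_partD[OF assms that] by (simp add: bideg_def)
    then show ?thesis by (metis of_int_of_nat_eq)
  qed
  then show "lk (X 0 * partial 0 f + X 1 * partial 1 f) m = lk (cst (of_int k) * f) m"
    by (cases "lk f m = 0") (auto simp add: lookup_add lookup_euler distrib_right[symmetric] simp del: single_of_int)
qed

lemma euler2:
  assumes "f \<in> bihom_part (k, l)"
  shows "X 2 * partial 2 f + X 3 * partial 3 f = cst (of_int l) * f"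
proof (rule poly_mapping_eqI)
  fix m
  have "of_nat (lk m 2 + lk m 3) = (of_int l :: complex)" if "lk f m \<noteq> 0"
  proof -
    have "int (lk m 2 + lk m 3) = l" using bihom_partD[OF assms that] by (simp add: bideg_def)
    then show ?thesis by (metis of_int_of_nat_eq)
  qed
  then show "lk (X 2 * partial 2 f + X 3 * partial 3 f) m = lk (cst (of_int l) * f) m"
    by (cases "lk f m = 0") (auto simp add: lookup_add lookup_euler distrib_right[symmetric] simp del: single_of_int)
qed

section \<open>Monomial bases of the bigraded pieces\<close>

definition Mon :: "int \<Rightarrow> int \<Rightarrow> monom4 set" where
  "Mon u v = {m. bideg m = (u, v)}"

text \<open>The count holds from -1 on, where both sides vanish. For h = 0 the pieces of degree h -
  1 in x_2, x_3 occur in the dimension count.\<close>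

lemma finite_Mon [simp, intro]: "finite (Mon u v)"
  and card_Mon: "u \<ge> -1 \<Longrightarrow> v \<ge> -1 \<Longrightarrow> int (card (Mon u v)) = (u + 1) * (v + 1)"
proof -
  let ?g = "\<lambda>(a, c). mk a (nat u - a) c (nat v - c)"
  have eq: "Mon u v = (if u < 0 \<or> v < 0 then {} else ?g ` ({..nat u} \<times> {..nat v}))"
  proof -
    have "m \<in> ?g ` ({..nat u} \<times> {..nat v})" if "bideg m = (u, v)" for m
      by (rule image_eqI[where x="(lk m 0, lk m 2)"])
         (use that in \<open>auto simp: bideg_def monom4_eq_iff\<close>)
    then show ?thesis by (auto simp: Mon_def bideg_def)
  qed
  show "finite (Mon u v)" by (simp add: eq)
  have inj: "inj_on ?g ({..nat u} \<times> {..nat v})"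
    by (auto simp: inj_on_def)
  show "int (card (Mon u v)) = (u + 1) * (v + 1)" if "u \<ge> -1" "v \<ge> -1"
  proof (cases "u < 0 \<or> v < 0")
    case True
    then have "u = -1 \<or> v = -1" using that by auto
    then show ?thesis using True by (auto simp: eq)
  next
    case False
    then show ?thesis by (simp add: eq card_image[OF inj] algebra_simps)
  qed
qed

lemma keys_bihom_subset: "p \<in> bihom_part (u, v) \<Longrightarrow> keys p \<subseteq> Mon u v"
  by (auto simp: bihom_part_iff Mon_def)

lemma bihom_expand:
  assumes "p \<in> bihom_part (u, v)"
  shows "p = (\<Sum>m\<in>Mon u v. single m (lk p m))"
  by (subst poly_mapping_sum_single[of p], rule sum.mono_neutral_left)
     (use keys_bihom_subset[OF assms] in \<open>auto simp: in_keys_iff\<close>)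

lemma sum_single_in_bihom: "(\<Sum>m\<in>Mon u v. single m (c m)) \<in> bihom_part (u, v)"
  by (intro bihom_part_sum bihom_part_single) (simp add: Mon_def)

lemma lookup_sum_single:
  "finite A \<Longrightarrow> lk (\<Sum>m\<in>A. single m (c m)) n = (if n \<in> A then c n else 0)"
  by (simp add: lookup_sum lookup_single when_def)

section \<open>Linear algebra and openness\<close>

lemma underdetermined:
  fixes a :: "'j \<Rightarrow> 'i \<Rightarrow> 'k::field"
  assumes "finite J" "finite I" "card J < card I"
  shows "\<exists>x. (\<exists>i\<in>I. x i \<noteq> 0) \<and> (\<forall>j\<in>J. (\<Sum>i\<in>I. a j i * x i) = 0)"
  using assms
proof (induction J arbitrary: I a rule: finite_induct)
  case empty
  then have "I \<noteq> {}" by auto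
  then show ?case by (intro exI[of _ "\<lambda>_. 1"]) auto
next
  case (insert j J)
  show ?case
  proof (cases "\<forall>i\<in>I. a j i = 0")
    case True
    obtain x where x: "\<exists>i\<in>I. x i \<noteq> 0" "\<forall>j\<in>J. (\<Sum>i\<in>I. a j i * x i) = 0"
      using insert.IH[of I a] insert.prems insert.hyps by (metis card_insert_disjoint Suc_lessD)
    show ?thesis
      by (rule exI[of _ x]) (use x True in auto)
  next
    case False
    then obtain i0 where i0: "i0 \<in> I" "a j i0 \<noteq> 0" by auto
    let ?I = "I - {i0}" and ?a = "\<lambda>j' i. a j' i - a j' i0 * a j i / a j i0"
    have "card J < card ?I"
      using insert.prems insert.hyps i0 by simp
    then obtain x where x: "\<exists>i\<in>?I. x i \<noteq> 0" "\<forall>j\<in>J. (\<Sum>i\<in>?I. ?a j i * x i) = 0"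
      using insert.IH[of ?I ?a] insert.prems(1) by auto
    \<comment> \<open>The entry at the pivot index \<open>i0\<close> is chosen to satisfy equation
      \<open>j\<close>.\<close>
    define y where "y = (\<lambda>i. if i = i0 then - (\<Sum>i\<in>?I. a j i * x i) / a j i0 else x i)"
    have sum_y: "(\<Sum>i\<in>I. b i * y i) = (\<Sum>i\<in>?I. b i * x i) - b i0 * (\<Sum>i\<in>?I. a j i * x i) / a j i0" for b
    proof -
      have "(\<Sum>i\<in>I. b i * y i) = b i0 * y i0 + (\<Sum>i\<in>?I. b i * y i)"
        using insert.prems(1) i0(1) by (rule sum.remove)
      moreover have "(\<Sum>i\<in>?I. b i * y i) = (\<Sum>i\<in>?I. b i * x i)"
        by (rule sum.cong) (auto simp: y_def)
      ultimately show ?thesis by (simp add: y_def)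
    qed
    have 1: "(\<Sum>i\<in>I. a j i * y i) = 0"
      unfolding sum_y using i0 by simp
    have 2: "(\<Sum>i\<in>I. a j' i * y i) = 0" if "j' \<in> J" for j'
    proof -
      have "(\<Sum>i\<in>?I. ?a j' i * x i)
        = (\<Sum>i\<in>?I. a j' i * x i) - a j' i0 * (\<Sum>i\<in>?I. a j i * x i) / a j i0"
        by (simp add: left_diff_distrib sum_subtractf sum_distrib_left sum_divide_distrib algebra_simps)
      then show ?thesis using x(2) that unfolding sum_y by simp
    qed
    have 3: "\<exists>i\<in>I. y i \<noteq> 0" using x(1) by (auto simp: y_def)
    show ?thesis by (rule exI[of _ y]) (use 1 2 3 in auto)
  qed
qed

definition csubspace :: "S set \<Rightarrow> bool" where
  "csubspace W \<longleftrightarrow> 0 \<in> W \<and> (\<forall>p\<in>W. \<forall>q\<in>W. p + q \<in> W) \<and> (\<forall>c. \<forall>p\<in>W. cst c * p \<in> W)"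

lemma csubspace_scale: "csubspace W \<Longrightarrow> p \<in> W \<Longrightarrow> cst c * p \<in> W"
  by (simp add: csubspace_def)

lemma csubspace_sum: "csubspace W \<Longrightarrow> (\<And>a. a \<in> A \<Longrightarrow> F a \<in> W) \<Longrightarrow> sum F A \<in> W"
  by (induction A rule: infinite_finite_induct) (simp_all add: csubspace_def)

text \<open>The tool for membership in a subspace: a basis of \<open>W\<close> stays independent
  when \<open>s\<close> is added, so values on it can be prescribed. It turns spanning statements
  into the vanishing of functionals.\<close>

lemma separating_functional:
  assumes W: "csubspace W" and s: "s \<notin> W"
  obtains \<phi> :: "S \<Rightarrow> complex" where
    "\<And>p q. \<phi> (p + q) = \<phi> p + \<phi> q" "\<And>c p. \<phi> (cst c * p) = c * \<phi> p" "\<phi> 0 = 0"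
    "\<And>p. p \<in> W \<Longrightarrow> \<phi> p = 0" "\<phi> s = 1"
proof -
  interpret SV: vector_space "\<lambda>c (p :: S). cst c * p"
    by unfold_locales (simp_all add: distrib_left single_add distrib_right mult.assoc[symmetric] mult_single)
  interpret SVC: vector_space_pair "\<lambda>c (p :: S). cst c * p" "(*) :: complex \<Rightarrow> complex \<Rightarrow> complex"
    by unfold_locales (simp_all add: algebra_simps)
  have W': "SV.subspace W" using W by (simp add: csubspace_def SV.subspace_def)
  obtain B where B: "B \<subseteq> W" "SV.independent B" "W \<subseteq> SV.span B"
    by (rule SV.maximal_independent_subset[of W])
  have "SV.span B = W" using B SV.span_minimal[OF B(1) W'] by blast
  then have "s \<notin> SV.span B" using s by simp
  then have ind: "SV.independent (insert s B)"
    using B(2) SV.independent_insert by auto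
  have "s \<notin> B" using s B(1) by auto
  obtain \<phi> where \<phi>: "Vector_Spaces.linear (\<lambda>c (p :: S). cst c * p) (*) \<phi>"
    "\<forall>x\<in>insert s B. \<phi> x = (if x = s then 1 else 0 :: complex)"
    using SVC.linear_independent_extend[OF ind, of "\<lambda>x. if x = s then 1 else 0"] by blast
  interpret L: Vector_Spaces.linear "\<lambda>c (p :: S). cst c * p" "(*) :: complex \<Rightarrow> complex \<Rightarrow> complex" \<phi>
    by (rule \<phi>(1))
  have "\<phi> p = 0" if "p \<in> W" for p
    by (rule L.eq_0_on_span[of B]) (use \<phi>(2) \<open>s \<notin> B\<close> that B(3) in auto)
  then show ?thesis using that[of \<phi>] \<phi>(2) L.add L.scale L.zero by auto
qed

section \<open>Substitution into polynomials and polynomial functions of the coefficients\<close>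

definition mon_eval :: "('v \<Rightarrow> 'b::comm_monoid_mult) \<Rightarrow> ('v \<Rightarrow>\<^sub>0 nat) \<Rightarrow> 'b" where
  "mon_eval c m = (\<Prod>v\<in>keys m. c v ^ lk m v)"

lemma mon_eval_superset:
  "finite A \<Longrightarrow> keys m \<subseteq> A \<Longrightarrow> mon_eval c m = (\<Prod>v\<in>A. c v ^ lk m v)"
  unfolding mon_eval_def by (rule prod.mono_neutral_left) (auto simp: in_keys_iff)

lemma mon_eval_0 [simp]: "mon_eval c 0 = 1"
  by (simp add: mon_eval_def)

lemma mon_eval_add: "mon_eval c (m + n) = mon_eval c m * mon_eval c n"
proof -
  let ?A = "keys m \<union> keys n"
  have "keys (m + n) \<subseteq> ?A" by (rule keys_add)
  then show ?thesis
    by (simp add: mon_eval_superset[of ?A] lookup_add power_add prod.distrib)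
qed

lemma mon_eval_single [simp]: "mon_eval c (single v n) = c v ^ n"
  by (subst mon_eval_superset[of "{v}"]) auto

text \<open>Two instances occur: the identity, for polynomial functions on the space of
  coefficients, and the embedding of constants into iterated univariate polynomials, for unique
  factorisation.\<close>

locale coeff_hom =
  fixes \<kappa> :: "complex \<Rightarrow> 'b::comm_ring_1"
  assumes \<kappa>_add: "\<kappa> (x + y) = \<kappa> x + \<kappa> y"
    and \<kappa>_mult: "\<kappa> (x * y) = \<kappa> x * \<kappa> y"
    and \<kappa>_1: "\<kappa> 1 = 1"
begin

lemma \<kappa>_0: "\<kappa> 0 = 0"
  using \<kappa>_add[of 0 0] by simp

definition ins :: "('v \<Rightarrow> 'b) \<Rightarrow> (('v \<Rightarrow>\<^sub>0 nat) \<Rightarrow>\<^sub>0 complex) \<Rightarrow> 'b" where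
  "ins c P = (\<Sum>m\<in>keys P. \<kappa> (lk P m) * mon_eval c m)"

lemma ins_superset:
  "finite A \<Longrightarrow> keys P \<subseteq> A \<Longrightarrow> ins c P = (\<Sum>m\<in>A. \<kappa> (lk P m) * mon_eval c m)"
  unfolding ins_def by (rule sum.mono_neutral_left) (auto simp: in_keys_iff \<kappa>_0)

lemma ins_0 [simp]: "ins c 0 = 0"
  by (simp add: ins_def)

lemma ins_add: "ins c (P + Q) = ins c P + ins c Q"
proof -
  let ?A = "keys P \<union> keys Q"
  have "keys (P + Q) \<subseteq> ?A" by (rule keys_add)
  then show ?thesis
    by (simp add: ins_superset[of ?A] lookup_add \<kappa>_add distrib_right sum.distrib)
qed

lemma ins_single [simp]: "ins c (single m x) = \<kappa> x * mon_eval c m"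
  by (subst ins_superset[of "{m}"]) (auto simp: \<kappa>_0)

lemma ins_1 [simp]: "ins c 1 = 1"
  by (simp add: single_one[symmetric] \<kappa>_1 del: single_one)

lemma ins_mult: "ins c (P * Q) = ins c P * ins c Q"
proof (induction P rule: poly_mapping_single_induct)
  case (single m x)
  show ?case
    by (induction Q rule: poly_mapping_single_induct)
      (simp_all add: mult_single mon_eval_add \<kappa>_mult distrib_left ins_add)
qed (simp_all add: ins_add distrib_right)

lemma ins_power: "ins c (P ^ n) = ins c P ^ n"
  by (induction n) (simp_all add: ins_mult)

lemma ins_uminus: "ins c (- P) = - ins c P"
  using ins_add[of c "- P" P] by (simp add: add_eq_0_iff2)

lemma ins_diff: "ins c (P - Q) = ins c P - ins c Q"
  using ins_add[of c P "- Q"] by (simp add: ins_uminus)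

end

interpretation ev: coeff_hom "\<lambda>x :: complex. x"
  by unfold_locales auto

lemma eval_poly_eq: "eval_poly c P = ev.ins c P"
  by (simp add: eval_poly_def ev.ins_def mon_eval_def)

definition polyfun :: "(S \<Rightarrow> complex) \<Rightarrow> bool" where
  "polyfun F \<longleftrightarrow> (\<exists>P. \<forall>f. eval_poly (lk f) P = F f)"

lemma polyfun_const: "polyfun (\<lambda>_. c)"
  unfolding polyfun_def eval_poly_eq
  by (rule exI[of _ "cst c"]) simp

lemma polyfun_coeff: "polyfun (\<lambda>f. lk f m)"
  unfolding polyfun_def eval_poly_eq
  by (rule exI[of _ "mon (single m 1)"]) simp

lemma polyfun_add: "polyfun F \<Longrightarrow> polyfun G \<Longrightarrow> polyfun (\<lambda>f. F f + G f)"
  unfolding polyfun_def eval_poly_eq by (metis ev.ins_add)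

lemma polyfun_mult: "polyfun F \<Longrightarrow> polyfun G \<Longrightarrow> polyfun (\<lambda>f. F f * G f)"
  unfolding polyfun_def eval_poly_eq by (metis ev.ins_mult)

lemma polyfun_diff: "polyfun F \<Longrightarrow> polyfun G \<Longrightarrow> polyfun (\<lambda>f. F f - G f)"
  unfolding polyfun_def eval_poly_eq by (metis ev.ins_diff)

lemma polyfun_sum: "(\<And>a. a \<in> A \<Longrightarrow> polyfun (F a)) \<Longrightarrow> polyfun (\<lambda>f. \<Sum>a\<in>A. F a f)"
proof (induction A rule: infinite_finite_induct)
  case (insert a A)
  then have "polyfun (\<lambda>f. F a f + (\<Sum>a\<in>A. F a f))"
    by (intro polyfun_add) simp_all
  with insert.hyps show ?case by (simp only: sum.insert not_False_eq_True)
qed (simp_all only: sum.infinite sum.empty polyfun_const not_False_eq_True)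

lemma polyfun_coeff_partial: "polyfun (\<lambda>f. lk (partial i f) m)"
  unfolding lookup_partial by (intro polyfun_mult polyfun_const polyfun_coeff)

lemma polyfun_coeff_mult_partial: "polyfun (\<lambda>f. lk (b * partial i f) n)"
proof -
  have "polyfun (\<lambda>f. lk (single m c * partial i f) n)" for m c
  proof (cases "\<exists>n'. n = m + n'")
    case True
    then obtain n' where "n = m + n'" by auto
    then show ?thesis
      by (simp only: lookup_single_mult) (intro polyfun_mult polyfun_const polyfun_coeff_partial)
  next
    case False
    then have "lk (single m c * partial i f) n = 0" for f
      by (intro lookup_single_mult_eq_0) auto
    then show ?thesis by (simp only: polyfun_const)
  qed
  then show ?thesis
    by (subst mult_eq_sum_single) (simp add: lookup_sum polyfun_sum)
qed

definition nonsing :: "'i set \<Rightarrow> 'j set \<Rightarrow> ('i \<Rightarrow> 'j \<Rightarrow> complex) \<Rightarrow> bool" where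
  "nonsing I J M \<longleftrightarrow> (\<forall>x. (\<forall>i\<in>I. (\<Sum>j\<in>J. M i j * x j) = 0) \<longrightarrow> (\<forall>j\<in>J. x j = 0))"

text \<open>Gaussian elimination without division: the product of the pivots and of their Schur
  complements plays the role of the determinant.\<close>

lemma nonsing_open:
  fixes M :: "'i \<Rightarrow> 'j \<Rightarrow> S \<Rightarrow> complex"
  assumes "finite I" "finite J" "card I = card J"
    and "\<And>i j. i \<in> I \<Longrightarrow> j \<in> J \<Longrightarrow> polyfun (M i j)"
    and "nonsing I J (\<lambda>i j. M i j f0)"
  shows "\<exists>D. polyfun D \<and> D f0 \<noteq> 0 \<and> (\<forall>f. D f \<noteq> 0 \<longrightarrow> nonsing I J (\<lambda>i j. M i j f))"
  using assms
proof (induction I arbitrary: J M rule: finite_induct)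
  case empty
  then have "J = {}" by (metis card_0_eq card.empty)
  then have "nonsing {} J N" for N :: "'i \<Rightarrow> 'j \<Rightarrow> complex"
    by (simp add: nonsing_def)
  then show ?case by (intro exI[of _ "\<lambda>_. 1"] conjI polyfun_const allI impI) simp_all
next
  case (insert i0 I)
  have "\<exists>j\<in>J. M i0 j f0 \<noteq> 0"
  proof (rule ccontr)
    assume *: "\<not> ?thesis"
    have "card I < card J" using insert.hyps insert.prems(2) by simp
    then obtain x where "\<exists>j\<in>J. x j \<noteq> 0" "\<forall>i\<in>I. (\<Sum>j\<in>J. M i j f0 * x j) = 0"
      using underdetermined[OF insert.hyps(1) insert.prems(1), of "\<lambda>i j. M i j f0"] by blast
    moreover from this * have "\<forall>i\<in>insert i0 I. (\<Sum>j\<in>J. M i j f0 * x j) = 0"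
      by simp
    ultimately show False using insert.prems(4) unfolding nonsing_def by blast
  qed
  then obtain j0 where j0: "j0 \<in> J" "M i0 j0 f0 \<noteq> 0" by blast
  let ?J = "J - {j0}"
  define M' where "M' = (\<lambda>i j f. M i0 j0 f * M i j f - M i j0 f * M i0 j f)"
  have split: "(\<Sum>j\<in>J. F j) = F j0 + sum F ?J" for F :: "'j \<Rightarrow> complex"
    using insert.prems(1) j0(1) by (rule sum.remove)
  have M'_sum: "(\<Sum>j\<in>?J. M' i j f * x j)
    = M i0 j0 f * (\<Sum>j\<in>?J. M i j f * x j) - M i j0 f * (\<Sum>j\<in>?J. M i0 j f * x j)" for i f x
    by (simp add: M'_def left_diff_distrib sum_subtractf sum_distrib_left mult.assoc)
  have "nonsing I ?J (\<lambda>i j. M' i j f0)"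
    unfolding nonsing_def
  proof (intro allI impI ballI)
    fix x j assume x: "\<forall>i\<in>I. (\<Sum>j\<in>?J. M' i j f0 * x j) = 0" and j: "j \<in> ?J"
    define y where "y = x(j0 := - (\<Sum>j\<in>?J. M i0 j f0 * x j) / M i0 j0 f0)"
    have y: "(\<Sum>j\<in>J. b j * y j) = (\<Sum>j\<in>?J. b j * x j) - b j0 * (\<Sum>j\<in>?J. M i0 j f0 * x j) / M i0 j0 f0" for b
    proof -
      have "(\<Sum>j\<in>?J. b j * y j) = (\<Sum>j\<in>?J. b j * x j)"
        by (rule sum.cong) (auto simp: y_def)
      then show ?thesis unfolding split by (simp add: y_def)
    qed
    have "(\<Sum>j\<in>J. M i j f0 * y j) = 0" if "i \<in> insert i0 I" for i
    proof (cases "i = i0")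
      case True
      then show ?thesis using j0 by (simp add: y)
    next
      case False
      then have "(\<Sum>j\<in>?J. M' i j f0 * x j) = 0" using x that by auto
      then show ?thesis using j0 unfolding M'_sum y by (simp add: field_simps)
    qed
    then have "\<forall>j\<in>J. y j = 0" using insert.prems(4) unfolding nonsing_def by blast
    then show "x j = 0" using j by (auto simp: y_def split: if_splits)
  qed
  moreover have "polyfun (M' i j)" if "i \<in> I" "j \<in> ?J" for i j
    unfolding M'_def using insert.prems(3) that j0
    by (intro polyfun_diff polyfun_mult) auto
  moreover have "card I = card ?J" using insert.hyps insert.prems(1,2) j0(1) by simp
  ultimately obtain D where D: "polyfun D" "D f0 \<noteq> 0" "\<And>f. D f \<noteq> 0 \<Longrightarrow> nonsing I ?J (\<lambda>i j. M' i j f)"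
    using insert.IH[of ?J M'] insert.prems(1) by blast
  have "nonsing (insert i0 I) J (\<lambda>i j. M i j f)" if nz: "M i0 j0 f * D f \<noteq> 0" for f
    unfolding nonsing_def
  proof (intro allI impI)
    fix x assume x: "\<forall>i\<in>insert i0 I. (\<Sum>j\<in>J. M i j f * x j) = 0"
    have e: "(\<Sum>j\<in>?J. M i j f * x j) = - (M i j0 f * x j0)" if "i \<in> insert i0 I" for i
    proof -
      have "(\<Sum>j\<in>J. M i j f * x j) = 0" using x that by blast
      then show ?thesis
        using split[of "\<lambda>j. M i j f * x j"] by (simp add: eq_neg_iff_add_eq_0 add.commute)
    qed
    have "(\<Sum>j\<in>?J. M' i j f * x j) = 0" if "i \<in> I" for i
      unfolding M'_sum using e[of i] e[of i0] that by simp
    then have z: "\<forall>j\<in>?J. x j = 0"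
      using D(3)[of f] nz unfolding nonsing_def by auto
    then have "M i0 j0 f * x j0 = 0" using e[of i0] by simp
    then show "\<forall>j\<in>J. x j = 0" using z nz by auto
  qed
  then show ?case
    using D(1,2) j0 insert.prems(3)
    by (intro exI[of _ "\<lambda>f. M i0 j0 f * D f"] conjI polyfun_mult allI impI) simp_all
qed

section \<open>The Jacobian ideal as a bigraded subspace\<close>

lemma jacobian_ideal_iff: "s \<in> jacobian_ideal f \<longleftrightarrow> (\<exists>b. s = (\<Sum>i\<in>UNIV. b i * partial i f))"
proof
  assume "s \<in> jacobian_ideal f"
  then show "\<exists>b. s = (\<Sum>i\<in>UNIV. b i * partial i f)"
    unfolding jacobian_ideal_def by blast
next
  assume "\<exists>b. s = (\<Sum>i\<in>UNIV. b i * partial i f)"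
  then obtain b where b: "s = (\<Sum>i\<in>UNIV. b i * partial i f)" by auto
  show "s \<in> jacobian_ideal f" unfolding jacobian_ideal_def
    by (rule image_eqI[where x = "\<chi> i. b i"]) (simp_all add: b)
qed

lemma jacobian_ideal_add: "s \<in> jacobian_ideal f \<Longrightarrow> t \<in> jacobian_ideal f \<Longrightarrow> s + t \<in> jacobian_ideal f"
  unfolding jacobian_ideal_iff
proof safe
  fix b c show "\<exists>e. (\<Sum>i\<in>UNIV. b i * partial i f) + (\<Sum>i\<in>UNIV. c i * partial i f) = (\<Sum>i\<in>UNIV. e i * partial i f)"
    by (rule exI[of _ "\<lambda>i. b i + c i"]) (simp add: distrib_right sum.distrib)
qed

lemma jacobian_ideal_mult: "s \<in> jacobian_ideal f \<Longrightarrow> t * s \<in> jacobian_ideal f"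
  unfolding jacobian_ideal_iff
proof safe
  fix b show "\<exists>e. t * (\<Sum>i\<in>UNIV. b i * partial i f) = (\<Sum>i\<in>UNIV. e i * partial i f)"
    by (rule exI[of _ "\<lambda>i. t * b i"]) (simp add: sum_distrib_left mult.assoc)
qed

lemma jacobian_ideal_0 [simp]: "0 \<in> jacobian_ideal f"
  unfolding jacobian_ideal_iff by (rule exI[of _ "\<lambda>_. 0"]) simp

lemma jacobian_ideal_partial: "b * partial i f \<in> jacobian_ideal f"
  unfolding jacobian_ideal_iff
proof (rule exI)
  have "(\<Sum>j\<in>UNIV. (if j = i then b else 0) * partial j f) = (\<Sum>j\<in>UNIV. if j = i then b * partial i f else 0)"
    by (rule sum.cong) auto
  then show "b * partial i f = (\<Sum>j\<in>UNIV. (if j = i then b else 0) * partial j f)" by simp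
qed

lemma jacobian_ideal_sum: "(\<And>a. a \<in> A \<Longrightarrow> F a \<in> jacobian_ideal f) \<Longrightarrow> sum F A \<in> jacobian_ideal f"
  by (induction A rule: infinite_finite_induct) (auto intro: jacobian_ideal_add)

lemma jacobian_ideal_subspace: "csubspace (jacobian_ideal f)"
  unfolding csubspace_def by (auto intro: jacobian_ideal_add jacobian_ideal_mult)

lemma jacobian_ideal_bihom_rep:
  assumes f: "f \<in> bihom_part kl" and s: "s \<in> jacobian_ideal f" "s \<in> bihom_part uv"
  obtains b where "\<And>i. b i \<in> bihom_part (uv - partial_bidegree kl i)" "s = (\<Sum>i\<in>UNIV. b i * partial i f)"
proof -
  obtain a where a: "s = (\<Sum>i\<in>UNIV. a i * partial i f)"
    using s(1) jacobian_ideal_iff by auto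
  have "s = bicomp uv s" using s(2) bicomp_id by simp
  also have "\<dots> = (\<Sum>i\<in>UNIV. bicomp (uv - partial_bidegree kl i) (a i) * partial i f)"
    unfolding a bicomp_sum by (rule sum.cong[OF refl]) (rule bicomp_mult[OF partial_bihom[OF f]])
  finally show ?thesis by (rule that[rotated]) (rule bicomp_in)
qed

lemma jacobian_bicomp:
  assumes f: "f \<in> bihom_part kl" and s: "s \<in> jacobian_ideal f"
  shows "bicomp uv s \<in> jacobian_ideal f"
proof -
  obtain a where a: "s = (\<Sum>i\<in>UNIV. a i * partial i f)"
    using s(1) jacobian_ideal_iff by auto
  have "bicomp uv s = (\<Sum>i\<in>UNIV. bicomp (uv - partial_bidegree kl i) (a i) * partial i f)"
    unfolding a bicomp_sum by (rule sum.cong[OF refl]) (rule bicomp_mult[OF partial_bihom[OF f]])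
  then show ?thesis by (auto simp: jacobian_ideal_iff)
qed

lemma bihom_part_subset_of_mons:
  assumes W: "csubspace W" and "\<And>m. m \<in> Mon u v \<Longrightarrow> mon m \<in> W"
  shows "bihom_part (u, v) \<subseteq> W"
proof
  fix p assume p: "p \<in> bihom_part (u, v)"
  have "cst (lk p m) * mon m \<in> W" if "m \<in> Mon u v" for m
    by (rule csubspace_scale[OF W assms(2)[OF that]])
  then have "(\<Sum>m\<in>Mon u v. cst (lk p m) * mon m) \<in> W"
    by (rule csubspace_sum[OF W])
  then show "p \<in> W"
    using bihom_expand[OF p] by (simp add: mult_single)
qed

lemma functional_expand:
  assumes "\<And>p q. \<phi> (p + q) = \<phi> p + \<phi> q" "\<And>c p. \<phi> (cst c * p) = c * \<phi> p" "\<phi> 0 = (0::complex)"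
  shows "p \<in> bihom_part (u, v) \<Longrightarrow> \<phi> p = (\<Sum>m\<in>Mon u v. lk p m * \<phi> (mon m))"
proof -
  assume p: "p \<in> bihom_part (u, v)"
  have s: "\<phi> (sum F A) = (\<Sum>a\<in>A. \<phi> (F a))" for F and A :: "monom4 set"
    by (induction A rule: infinite_finite_induct) (simp_all add: assms)
  have "\<phi> (single m c) = c * \<phi> (mon m)" for m c
    using assms(2)[of c "mon m"] by (simp add: mult_single)
  then have "(\<Sum>m\<in>Mon u v. \<phi> (single m (lk p m))) = (\<Sum>m\<in>Mon u v. lk p m * \<phi> (mon m))"
    by (rule sum.cong[OF refl])
  then show "\<phi> p = (\<Sum>m\<in>Mon u v. lk p m * \<phi> (mon m))"
    using arg_cong[OF bihom_expand[OF p], of \<phi>] by (simp only: s)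
qed

text \<open>Write every monomial of bidegree (u,v) as a combination of the partial derivatives of
  \<open>f0\<close>, freeze the coefficients \<open>b\<close> and let \<open>f\<close> vary. The
  resulting elements \<open>R m f\<close> of J_f still span the piece as long as a square matrix,
  polynomial in \<open>f\<close>, stays invertible.\<close>

proposition jacobian_contains_open:
  assumes f0: "f0 \<in> bihom_part kl" "bihom_part (u, v) \<subseteq> jacobian_ideal f0"
  shows "\<exists>D. polyfun D \<and> D f0 \<noteq> 0 \<and>
    (\<forall>f\<in>bihom_part kl. D f \<noteq> 0 \<longrightarrow> bihom_part (u, v) \<subseteq> jacobian_ideal f)"
proof -
  have "\<exists>b. (\<forall>i. b i \<in> bihom_part ((u, v) - partial_bidegree kl i)) \<and>
    mon m = (\<Sum>i\<in>UNIV. b i * partial i f0)" if "m \<in> Mon u v" for m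
  proof -
    have m: "mon m \<in> bihom_part (u, v)"
      using that by (intro bihom_part_single) (simp add: Mon_def)
    have mJ: "mon m \<in> jacobian_ideal f0" using m f0(2) by blast
    obtain b where "\<And>i. b i \<in> bihom_part ((u, v) - partial_bidegree kl i)" "mon m = (\<Sum>i\<in>UNIV. b i * partial i f0)"
      by (rule jacobian_ideal_bihom_rep[OF f0(1) mJ m]) (rule that)
    then show ?thesis by (intro exI[of _ b] conjI allI)
  qed
  then have "\<forall>m\<in>Mon u v. \<exists>b. (\<forall>i. b i \<in> bihom_part ((u, v) - partial_bidegree kl i)) \<and>
    mon m = (\<Sum>i\<in>UNIV. b i * partial i f0)" by blast
  from bchoice[OF this] obtain b
    where "\<forall>m\<in>Mon u v. (\<forall>i. b m i \<in> bihom_part ((u, v) - partial_bidegree kl i)) \<and>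
      mon m = (\<Sum>i\<in>UNIV. b m i * partial i f0)" ..
  then have b: "\<And>m i. m \<in> Mon u v \<Longrightarrow> b m i \<in> bihom_part ((u, v) - partial_bidegree kl i)"
    "\<And>m. m \<in> Mon u v \<Longrightarrow> mon m = (\<Sum>i\<in>UNIV. b m i * partial i f0)"
    by blast+
  define R where "R = (\<lambda>m f. \<Sum>i\<in>UNIV. b m i * partial i f)"
  define M where "M = (\<lambda>m n f. lk (R m f) n)"
  have "polyfun (M m n)" for m n
    unfolding M_def R_def lookup_sum by (intro polyfun_sum polyfun_coeff_mult_partial)
  \<comment> \<open>At \<open>f0\<close> row \<open>m\<close> is the coefficient vector of
    \<open>mon m\<close> itself, so the matrix is the identity.\<close>
  moreover have "nonsing (Mon u v) (Mon u v) (\<lambda>m n. M m n f0)"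
  proof -
    have "M m n f0 = (if n = m then 1 else 0)" if "m \<in> Mon u v" for m n
      using b(2)[OF that] by (simp add: M_def R_def lookup_single flip: b(2)[OF that])
    then have "(\<Sum>n\<in>Mon u v. M m n f0 * x n) = (\<Sum>n\<in>Mon u v. if n = m then x n else 0)"
      if "m \<in> Mon u v" for m x
      using that by (intro sum.cong) auto
    then show ?thesis by (auto simp: nonsing_def)
  qed
  ultimately obtain D where D: "polyfun D" "D f0 \<noteq> 0"
    "\<And>f. D f \<noteq> 0 \<Longrightarrow> nonsing (Mon u v) (Mon u v) (\<lambda>m n. M m n f)"
    using nonsing_open[of "Mon u v" "Mon u v" M f0] by blast
  have "bihom_part (u, v) \<subseteq> jacobian_ideal f" if f: "f \<in> bihom_part kl" "D f \<noteq> 0" for f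
  proof (rule bihom_part_subset_of_mons[OF jacobian_ideal_subspace], rule ccontr)
    fix m assume m: "m \<in> Mon u v" "mon m \<notin> jacobian_ideal f"
    \<comment> \<open>The values of a functional that vanishes on J_f form a kernel vector of the
      matrix, hence vanish on the whole piece.\<close>
    obtain \<phi> where \<phi>: "\<And>p q. \<phi> (p + q) = \<phi> p + \<phi> q" "\<And>c p. \<phi> (cst c * p) = c * \<phi> p" "\<phi> 0 = (0::complex)"
      "\<And>p. p \<in> jacobian_ideal f \<Longrightarrow> \<phi> p = 0" "\<phi> (mon m) = 1"
      using separating_functional[OF jacobian_ideal_subspace m(2)] by metis
    have "(\<Sum>n\<in>Mon u v. M m n f * \<phi> (mon n)) = 0" if "m \<in> Mon u v" for m
    proof -
      have "R m f \<in> bihom_part (u, v)"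
        unfolding R_def by (intro bihom_part_sum bihom_part_mult_eq[OF b(1)[OF that] partial_bihom[OF f(1)]]) simp
      moreover have "R m f \<in> jacobian_ideal f"
        unfolding R_def by (intro jacobian_ideal_sum jacobian_ideal_partial)
      ultimately show ?thesis
        using functional_expand[OF \<phi>(1-3), of "R m f" u v] \<phi>(4) by (simp add: M_def)
    qed
    then have "\<forall>n\<in>Mon u v. \<phi> (mon n) = 0"
      using spec[OF D(3)[OF f(2), unfolded nonsing_def], of "\<lambda>n. \<phi> (mon n)"] by simp
    then have "\<phi> (mon m) = 0" using m(1) by simp
    then show False using \<phi>(5) by simp
  qed
  then show ?thesis using D by blast
qed

section \<open>Counting syzygies modulo the Euler relation\<close>

text \<open>Scalars are to stay in the form \<open>cst c\<close>, so that the rules for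
  \<open>cst\<close> apply also to integers and numerals.\<close>

declare single_of_int [simp del] single_of_nat [simp del] single_numeral [simp del]

text \<open>One scalar equation for each condition \<open>c\<close> and each monomial of its
  bidegree. Several conditions of different bidegrees are allowed, since the uses range over the
  four entries of a syzygy or over unlike constraints.\<close>

lemma bihom_underdetermined:
  fixes F :: "'t \<Rightarrow> 'c \<Rightarrow> S"
  assumes "finite I" "finite C"
    and F: "\<And>t c. t \<in> I \<Longrightarrow> c \<in> C \<Longrightarrow> F t c \<in> bihom_part (\<delta> c)"
    and card: "(\<Sum>c\<in>C. card (Mon (fst (\<delta> c)) (snd (\<delta> c)))) < card I"
  obtains x where "\<exists>t\<in>I. x t \<noteq> 0" "\<And>c. c \<in> C \<Longrightarrow> (\<Sum>t\<in>I. cst (x t) * F t c) = 0"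
proof -
  let ?M = "\<lambda>c. Mon (fst (\<delta> c)) (snd (\<delta> c))"
  have "card (Sigma C ?M) < card I"
    using card assms(2) by (simp add: card_SigmaI)
  then obtain x where x: "\<exists>t\<in>I. x t \<noteq> 0"
    "\<forall>p\<in>Sigma C ?M. (\<Sum>t\<in>I. lk (F t (fst p)) (snd p) * x t) = 0"
    using underdetermined[of "Sigma C ?M" I "\<lambda>p t. lk (F t (fst p)) (snd p)"] assms(1,2) by auto
  have "(\<Sum>t\<in>I. cst (x t) * F t c) = 0" if c: "c \<in> C" for c
  proof (rule poly_mapping_eqI)
    fix n
    show "lk (\<Sum>t\<in>I. cst (x t) * F t c) n = lk 0 n"
    proof (cases "n \<in> ?M c")
      case True
      then have "(\<Sum>t\<in>I. lk (F t c) n * x t) = 0"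
        using bspec[OF x(2), of "(c, n)"] c by simp
      then show ?thesis by (simp add: lookup_sum mult.commute[of "x _"])
    next
      case False
      then have "lk (F t c) n = 0" if "t \<in> I" for t
        using keys_bihom_subset[of "F t c" "fst (\<delta> c)" "snd (\<delta> c)"] F[OF that c]
        by (auto simp: in_keys_iff)
      then show ?thesis by (simp add: lookup_sum)
    qed
  qed
  with x(1) show ?thesis by (rule that)
qed

definition syz :: "S \<Rightarrow> (4 \<Rightarrow> S) \<Rightarrow> bool" where
  "syz f b \<longleftrightarrow> (\<Sum>i\<in>UNIV. b i * partial i f) = 0"

definition bisyz :: "int \<times> int \<Rightarrow> int \<times> int \<Rightarrow> (4 \<Rightarrow> S) \<Rightarrow> bool" where
  "bisyz kl uv b \<longleftrightarrow> (\<forall>i. b i \<in> bihom_part (uv - partial_bidegree kl i))"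

definition euler_vec :: "int \<times> int \<Rightarrow> 4 \<Rightarrow> S" where
  "euler_vec kl i = (if i \<in> {0, 1} then cst (of_int (snd kl)) * X i else - (cst (of_int (fst kl)) * X i))"

definition is_euler :: "int \<times> int \<Rightarrow> (4 \<Rightarrow> S) \<Rightarrow> bool" where
  "is_euler kl b \<longleftrightarrow> (\<exists>w. \<forall>i. b i = w * euler_vec kl i)"

lemma X_bihom: "X i \<in> bihom_part (if i \<in> {0, 1} then (1, 0) else (0, 1))"
proof -
  have "i \<in> {0,1,2,3}" using UNIV_4_from_0 by blast
  then show ?thesis
    by (auto simp: X_eq_xm intro!: bihom_part_single)
qed

lemma euler_vec_bihom: "euler_vec kl i \<in> bihom_part (kl - partial_bidegree kl i)"
  using X_bihom[of i] by (auto simp: euler_vec_def partial_bidegree_def intro!: bihom_part_cst_mult bihom_part_uminus)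

lemma euler_vec_syz:
  assumes "f \<in> bihom_part (k, l)"
  shows "syz f (euler_vec (k, l))"
proof -
  let ?k = "cst (of_int k) :: S" and ?l = "cst (of_int l) :: S"
  have "(\<Sum>i\<in>UNIV. euler_vec (k, l) i * partial i f)
    = ?l * (X 0 * partial 0 f + X 1 * partial 1 f) - ?k * (X 2 * partial 2 f + X 3 * partial 3 f)"
    by (simp add: sum_4_from_0 euler_vec_def algebra_simps)
  also have "\<dots> = 0"
    unfolding euler1[OF assms] euler2[OF assms] by (simp only: mult.left_commute diff_self)
  finally show ?thesis by (simp only: syz_def)
qed

lemma X_neq_0 [simp]: "X i \<noteq> 0"
  unfolding X_def by (metis lookup_single_eq lookup_zero one_neq_zero)

lemma cst_eq_0_iff [simp]: "cst c = (0 :: S) \<longleftrightarrow> c = 0"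
  by (metis lookup_single_eq lookup_zero single_zero)

text \<open>The Euler vector is primitive: its first two entries are nonzero multiples of the
  coprime x_0 and x_1. From x_1 b_0 = x_0 b_1 it follows that x_0 divides b_0, and the quotient is
  the multiplier sought.\<close>

lemma euler_torsion_free:
  assumes "l \<noteq> 0" "g \<noteq> 0" "\<And>i. g * b i = w * euler_vec (k, l) i"
  shows "is_euler (k, l) b"
proof -
  let ?l = "cst (of_int l) :: S"
  have l: "?l \<noteq> 0" "cst (1 / of_int l) * ?l = 1"
    using assms(1) by (simp_all add: mult_single)
  have g: "g * b 0 = w * (?l * X 0)" "g * b 1 = w * (?l * X 1)"
    using assms(3)[of 0] assms(3)[of 1] by (simp_all add: euler_vec_def)
  have "g * (X 1 * b 0) = X 1 * (g * b 0)" by (simp only: mult.left_commute)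
  also have "\<dots> = X 0 * (g * b 1)" unfolding g by (simp only: mult_ac)
  also have "\<dots> = g * (X 0 * b 1)" by (simp only: mult.left_commute)
  finally have "X 1 * b 0 = X 0 * b 1" using mult_left_cancel[OF assms(2)] by blast
  then have "X 0 dvd X 1 * b 0" by simp
  then have "X 0 dvd b 0"
    unfolding X_def by (rule mon_coprime_dvd) (auto simp: lookup_single when_def)
  then obtain q where q: "b 0 = X 0 * q" by (rule dvdE)
  define w' where "w' = cst (1 / of_int l) * q"
  have e0: "euler_vec (k, l) 0 = ?l * X 0" by (simp add: euler_vec_def)
  have "w' * (?l * X 0) = (cst (1 / of_int l) * ?l) * (X 0 * q)"
    unfolding w'_def by (simp only: mult_ac)
  then have b0: "b 0 = w' * (?l * X 0)" unfolding l q by simp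
  have nz: "?l * X 0 \<noteq> 0" using l(1) by simp
  have "(?l * X 0) * (g * w') = g * b 0" unfolding b0 by (simp only: mult_ac)
  also have "\<dots> = (?l * X 0) * w" unfolding g by (simp only: mult_ac)
  finally have gw: "g * w' = w" using mult_left_cancel[OF nz] by blast
  have "b i = w' * euler_vec (k, l) i" for i
  proof -
    have "g * b i = g * (w' * euler_vec (k, l) i)"
      unfolding assms(3) gw[symmetric] by (simp only: mult_ac)
    then show ?thesis using mult_left_cancel[OF assms(2)] by blast
  qed
  then show ?thesis unfolding is_euler_def by blast
qed

section \<open>Dimension count in bidegree (u, 3h)\<close>

locale odd_bidegree =
  fixes k l h u0 :: int and f :: S
  assumes k: "k \<ge> 1" and h: "h \<ge> 0" and l_def: "l = 2 * h + 1"
    and u0_def: "u0 = 2 * k + h * (3 * k - 2)"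
    and f: "f \<in> bihom_part (k, l)"
begin

lemma l_nonzero: "l \<noteq> 0"
  using h l_def by simp

lemma u0_ge: "u0 \<ge> 2 * k"
  using k h by (simp add: u0_def)

lemma partial_bidegree_kl: "partial_bidegree (k, l) i = (if i \<in> {0, 1} then (k - 1, l) else (k, l - 1))"
  by (simp add: partial_bidegree_def)

abbreviation num_unknowns :: "int \<Rightarrow> int" where
  "num_unknowns u \<equiv> 2 * ((u - k + 2) * h) + 2 * ((u - k + 1) * (h + 1))"

lemma card_unknowns:
  assumes "u \<ge> k"
  shows "int (\<Sum>i\<in>UNIV. card (Mon (fst ((u, 3 * h) - partial_bidegree (k, l) i))
    (snd ((u, 3 * h) - partial_bidegree (k, l) i)))) = num_unknowns u"
  unfolding sum_4_from_0 partial_bidegree_kl using assms h by (simp add: l_def card_Mon)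

text \<open>The summands are the dimension of the Euler multiples, that of the forms of bidegree
  (u,3h), and the excess. The value of \<open>u0\<close> is the one that makes this an
  identity.\<close>

lemma num_unknowns_eq: "num_unknowns u = (u - k + 1) * h + (u + 1) * (3 * h + 1) + (u - u0 + 1)"
  by (simp add: u0_def algebra_simps)

text \<open>Besides being a syzygy, the solution is required to have a first entry without monomials
  divisible by x_0. These are exactly as many conditions as there are independent Euler multiples,
  and no nonzero Euler multiple meets them; at u = u_0 one solution more than nothing is
  left.\<close>

lemma exists_non_euler:
  obtains b where "syz f b" "bisyz (k, l) (u0, 3 * h) b" "\<not> is_euler (k, l) b"
proof -
  define M where "M = (\<lambda>i. Mon (fst ((u0, 3 * h) - partial_bidegree (k, l) i))
    (snd ((u0, 3 * h) - partial_bidegree (k, l) i)))"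
  define I where "I = Sigma UNIV M"
  have finM: "finite (M i)" for i by (simp add: M_def)
  have finI: "finite I" by (simp add: I_def finM)
  \<comment> \<open>Condition \<open>True\<close> is the syzygy equation. Condition
    \<open>False\<close> reads off the x_0-divisible part of b_0, divided by x_0.\<close>
  define F :: "4 \<times> monom4 \<Rightarrow> bool \<Rightarrow> S" where "F = (\<lambda>(i, m) c. if c then mon m * partial i f
    else if i = 0 \<and> lk m 0 > 0 then mon (m - single 0 1) else 0)"
  define \<delta> where "\<delta> = (\<lambda>c. if c then (u0, 3 * h) else (u0 - k, h - 1))"
  have F_in: "F t c \<in> bihom_part (\<delta> c)" if t: "t \<in> I" for t c
  proof -
    obtain i m where [simp]: "t = (i, m)" by (cases t)
    have m: "bideg m = (u0, 3 * h) - partial_bidegree (k, l) i"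
      using t by (cases "partial_bidegree (k, l) i") (simp add: I_def M_def Mon_def)
    show ?thesis
    proof (cases c)
      case True
      have "mon m * partial i f \<in> bihom_part (u0, 3 * h)"
        by (rule bihom_part_mult_eq[OF bihom_part_single[OF m] partial_bihom[OF f]]) simp
      then show ?thesis using True by (simp add: F_def \<delta>_def)
    next
      case False
      have "bideg (m - single 0 1) = (u0 - k, h - 1)" if "i = 0" "lk m 0 > 0"
      proof -
        have "bideg m = (u0 - (k - 1), 3 * h - l)" using m that by (simp add: partial_bidegree_kl)
        then show ?thesis
          using that(2) l_def by (auto simp: bideg_def lookup_minus lookup_single when_def)
      qed
      then show ?thesis using False by (auto simp: F_def \<delta>_def intro: bihom_part_single)
    qed
  qed
  have "int (card I) = num_unknowns u0"
    unfolding I_def using card_unknowns[of u0] u0_ge k by (simp add: finM card_SigmaI M_def)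
  moreover have "int (\<Sum>c\<in>UNIV. card (Mon (fst (\<delta> c)) (snd (\<delta> c)))) = (u0 + 1) * (3 * h + 1) + (u0 - k + 1) * h"
    using u0_ge k h by (simp add: UNIV_bool \<delta>_def card_Mon)
  ultimately have less: "(\<Sum>c\<in>UNIV. card (Mon (fst (\<delta> c)) (snd (\<delta> c)))) < card I"
    using num_unknowns_eq[of u0] by linarith
  obtain x where x: "\<exists>t\<in>I. x t \<noteq> 0" "\<And>c. c \<in> UNIV \<Longrightarrow> (\<Sum>t\<in>I. cst (x t) * F t c) = 0"
    using bihom_underdetermined[of I UNIV F \<delta>, OF finI finite _ less] F_in by blast
  note x = x(1) x(2)[OF UNIV_I]
  define b where "b = (\<lambda>i. \<Sum>m\<in>M i. single m (x (i, m)))"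
  have b_in: "bisyz (k, l) (u0, 3 * h) b"
    unfolding bisyz_def
  proof
    fix i
    show "b i \<in> bihom_part ((u0, 3 * h) - partial_bidegree (k, l) i)"
      unfolding b_def M_def
      using sum_single_in_bihom[of _ "fst ((u0, 3 * h) - partial_bidegree (k, l) i)" "snd ((u0, 3 * h) - partial_bidegree (k, l) i)"]
      by (simp only: prod.collapse)
  qed
  have "(\<Sum>i\<in>UNIV. b i * partial i f) = (\<Sum>i\<in>UNIV. \<Sum>m\<in>M i. cst (x (i, m)) * F (i, m) True)"
    by (simp add: b_def F_def sum_distrib_right mult.assoc[symmetric] mult_single)
  also have "\<dots> = (\<Sum>t\<in>I. cst (x t) * F t True)"
    unfolding I_def by (subst sum.Sigma) (simp_all add: finM split_beta)
  finally have "syz f b" using x(2) by (simp add: syz_def)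
  moreover have "\<not> is_euler (k, l) b"
  proof
    assume "is_euler (k, l) b"
    then obtain w where w: "\<And>i. b i = w * euler_vec (k, l) i" unfolding is_euler_def by blast
    have lk_b: "lk (b i) n = (if n \<in> M i then x (i, n) else 0)" for i n
      by (simp add: b_def lookup_sum_single finM)
    have "lk (b 0) n = 0" for n
    proof (cases "lk n 0 > 0")
      case False
      \<comment> \<open>For an Euler multiple every monomial of b_0 contains x_0, and these are the
        ones made to vanish.\<close>
      have "X 0 dvd b 0" using w[of 0] by (simp add: euler_vec_def)
      then have "\<forall>n\<in>keys (b 0). 1 \<le> lk n 0" unfolding X_eq_xm xm_dvd_iff by blast
      then have "n \<notin> keys (b 0)" using False by fastforce
      then show ?thesis by (simp add: in_keys_iff)
    next
      case True
      define n' where "n' = n - single 0 1"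
      have *: "m - single 0 1 = n' \<longleftrightarrow> m = n" if "lk m 0 > 0" for m :: monom4
        using that True unfolding n'_def monom4_eq_iff
        by (auto simp: lookup_minus lookup_single when_def)
      have inner: "(\<Sum>m\<in>M i. lk (cst (x (i, m)) * F (i, m) False) n') = (if i = 0 then lk (b 0) n else 0)" for i
      proof (cases "i = 0")
        case i: True
        have "(\<Sum>m\<in>M i. lk (cst (x (i, m)) * F (i, m) False) n') = (\<Sum>m\<in>M 0. if m = n then x (0, n) else 0)"
          using True i * by (intro sum.cong) (auto simp: F_def lookup_single when_def)
        then show ?thesis using i by (simp add: lk_b finM)
      qed (simp add: F_def)
      have "0 = lk (\<Sum>t\<in>I. cst (x t) * F t False) n'" unfolding x(2) by simp
      also have "\<dots> = (\<Sum>i\<in>UNIV. \<Sum>m\<in>M i. lk (cst (x (i, m)) * F (i, m) False) n')"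
        unfolding I_def lookup_sum by (subst sum.Sigma) (simp_all add: finM split_beta)
      also have "\<dots> = lk (b 0) n" unfolding inner by (simp add: sum_4_from_0)
      finally show ?thesis by simp
    qed
    then have "b 0 = 0" by (intro poly_mapping_eqI) simp
    then have "w = 0" using w[of 0] l_nonzero by (simp add: euler_vec_def)
    then have "b i = 0" for i using w by simp
    then have "x (i, n) = 0" if "n \<in> M i" for i n using lk_b[of i n] that by simp
    then show False using x(1) by (auto simp: I_def)
  qed
  ultimately show ?thesis using that b_in by blast
qed

text \<open>The multiples of \<open>b\<close> by \<open>G\<close>, the multiples of the Euler relation and preimages of the monomials
  in $S_{(u_1,3h)}$ are linearly independent.\<close>

lemma multiples_bound:
  assumes u1: "u1 \<ge> u0" "bihom_part (u1, 3 * h) \<subseteq> jacobian_ideal f"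
    and b: "syz f b" "bisyz (k, l) uv b" "\<not> is_euler (k, l) b"
    and G: "finite G" "\<And>m. m \<in> G \<Longrightarrow> bideg m + uv = (u1, 3 * h)"
  shows "int (card G) \<le> u1 - u0 + 1"
proof (rule ccontr)
  assume large: "\<not> ?thesis"
  have "\<forall>m\<in>Mon u1 (3 * h). \<exists>s. bisyz (k, l) (u1, 3 * h) s \<and> mon m = (\<Sum>i\<in>UNIV. s i * partial i f)"
  proof
    fix m assume m: "m \<in> Mon u1 (3 * h)"
    have m': "mon m \<in> bihom_part (u1, 3 * h)"
      using m by (intro bihom_part_single) (simp add: Mon_def)
    have mJ: "mon m \<in> jacobian_ideal f" using m' u1(2) by blast
    obtain s where "\<And>i. s i \<in> bihom_part ((u1, 3 * h) - partial_bidegree (k, l) i)"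
      "mon m = (\<Sum>i\<in>UNIV. s i * partial i f)"
      by (rule jacobian_ideal_bihom_rep[OF f mJ m']) (rule that)
    then show "\<exists>s. bisyz (k, l) (u1, 3 * h) s \<and> mon m = (\<Sum>i\<in>UNIV. s i * partial i f)"
      unfolding bisyz_def by blast
  qed
  from bchoice[OF this] obtain s where s: "\<And>m. m \<in> Mon u1 (3 * h) \<Longrightarrow> bisyz (k, l) (u1, 3 * h) (s m)"
    "\<And>m. m \<in> Mon u1 (3 * h) \<Longrightarrow> mon m = (\<Sum>i\<in>UNIV. s m i * partial i f)" by blast
  let ?W = "Mon (u1 - k) (h - 1)" and ?T = "Mon u1 (3 * h)"
  define I where "I = G <+> (?W <+> ?T)"
  define F where "F = (\<lambda>t i. case t of Inl m \<Rightarrow> mon m * b i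
    | Inr (Inl m) \<Rightarrow> mon m * euler_vec (k, l) i | Inr (Inr m) \<Rightarrow> s m i)"
  define \<delta> where "\<delta> = (\<lambda>i. (u1, 3 * h) - partial_bidegree (k, l) i)"
  have F_in: "F t i \<in> bihom_part (\<delta> i)" if t: "t \<in> I" for t i
  proof -
    consider m where "t = Inl m" "m \<in> G" | m where "t = Inr (Inl m)" "m \<in> ?W" | m where "t = Inr (Inr m)" "m \<in> ?T"
      using t unfolding I_def by blast
    then show ?thesis
    proof cases
      case 1
      have "mon m * b i \<in> bihom_part (\<delta> i)"
        by (rule bihom_part_mult_eq[OF bihom_part_single[OF refl]])
          (use b(2) G(2)[OF 1(2)] in \<open>auto simp: bisyz_def \<delta>_def simp flip: G(2)[OF 1(2)]\<close>)
      then show ?thesis by (simp add: F_def 1)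
    next
      case 2
      have "mon m * euler_vec (k, l) i \<in> bihom_part (\<delta> i)"
        by (rule bihom_part_mult_eq[OF bihom_part_single[OF refl] euler_vec_bihom])
          (use 2(2) in \<open>simp add: Mon_def \<delta>_def l_def\<close>)
      then show ?thesis by (simp add: F_def 2)
    next
      case 3
      then show ?thesis using s(1)[OF 3(2)] by (simp add: F_def \<delta>_def bisyz_def)
    qed
  qed
  have finI: "finite I" using G(1) by (simp add: I_def)
  have "card I = card G + (card ?W + card ?T)"
    unfolding I_def by (simp add: card_Plus G(1))
  then have "int (card I) = int (card G) + (u1 - k + 1) * h + (u1 + 1) * (3 * h + 1)"
    using u1(1) u0_ge k h by (simp add: card_Mon)
  moreover have "int (\<Sum>i\<in>UNIV. card (Mon (fst (\<delta> i)) (snd (\<delta> i)))) = num_unknowns u1"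
    unfolding \<delta>_def by (rule card_unknowns) (use u1(1) u0_ge k in linarith)
  ultimately have less: "(\<Sum>i\<in>UNIV. card (Mon (fst (\<delta> i)) (snd (\<delta> i)))) < card I"
    using num_unknowns_eq[of u1] large by linarith
  obtain x where x: "\<exists>t\<in>I. x t \<noteq> 0" "\<And>i. i \<in> UNIV \<Longrightarrow> (\<Sum>t\<in>I. cst (x t) * F t i) = 0"
    using bihom_underdetermined[of I UNIV F \<delta>, OF finI finite _ less] F_in by blast
  note x = x(1) x(2)[OF UNIV_I]
  define g where "g = (\<Sum>m\<in>G. single m (x (Inl m)))"
  define w where "w = (\<Sum>m\<in>?W. single m (x (Inr (Inl m))))"
  define y where "y = (\<Sum>m\<in>?T. single m (x (Inr (Inr m))))"
  have rel: "g * b i + w * euler_vec (k, l) i + (\<Sum>m\<in>?T. cst (x (Inr (Inr m))) * s m i) = 0" for i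
  proof -
    have "(\<Sum>t\<in>I. cst (x t) * F t i) = (\<Sum>m\<in>G. cst (x (Inl m)) * F (Inl m) i)
      + ((\<Sum>m\<in>?W. cst (x (Inr (Inl m))) * F (Inr (Inl m)) i) + (\<Sum>m\<in>?T. cst (x (Inr (Inr m))) * F (Inr (Inr m)) i))"
      unfolding I_def by (simp add: sum.Plus G(1))
    also have "\<dots> = g * b i + w * euler_vec (k, l) i + (\<Sum>m\<in>?T. cst (x (Inr (Inr m))) * s m i)"
      by (simp add: F_def g_def w_def sum_distrib_right mult.assoc[symmetric] mult_single add.assoc)
    finally show ?thesis using x(2) by simp
  qed
  \<comment> \<open>Applying (f_0,...,f_3) to the relation kills \<open>b\<close> and the Euler
    vector and sends each \<open>s m\<close> back to \<open>mon m\<close>; so the third family drops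
    out.\<close>
  have "y = (\<Sum>m\<in>?T. cst (x (Inr (Inr m))) * (\<Sum>i\<in>UNIV. s m i * partial i f))"
    unfolding y_def
  proof (rule sum.cong[OF refl])
    fix m assume "m \<in> ?T"
    then show "single m (x (Inr (Inr m))) = cst (x (Inr (Inr m))) * (\<Sum>i\<in>UNIV. s m i * partial i f)"
      using mult_single[of 0 "x (Inr (Inr m))" m 1] s(2)[of m] by simp
  qed
  also have "\<dots> = (\<Sum>i\<in>UNIV. (\<Sum>m\<in>?T. cst (x (Inr (Inr m))) * s m i) * partial i f)"
    unfolding sum_distrib_left sum_distrib_right by (subst sum.swap) (simp only: mult.assoc)
  also have "\<dots> = (\<Sum>i\<in>UNIV. - (g * (b i * partial i f)) - w * (euler_vec (k, l) i * partial i f))"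
  proof (rule sum.cong[OF refl])
    fix i
    have E: "(\<Sum>m\<in>?T. cst (x (Inr (Inr m))) * s m i) = - (g * b i) - w * euler_vec (k, l) i"
      using rel[of i] by (simp add: eq_neg_iff_add_eq_0 algebra_simps)
    show "(\<Sum>m\<in>?T. cst (x (Inr (Inr m))) * s m i) * partial i f
        = - (g * (b i * partial i f)) - w * (euler_vec (k, l) i * partial i f)"
      unfolding E by (simp add: left_diff_distrib mult.assoc)
  qed
  also have "\<dots> = - (g * (\<Sum>i\<in>UNIV. b i * partial i f)) - w * (\<Sum>i\<in>UNIV. euler_vec (k, l) i * partial i f)"
    by (simp add: sum_subtractf sum_negf sum_distrib_left)
  also have "\<dots> = 0"
    using b(1) euler_vec_syz[OF f] by (simp add: syz_def)
  finally have "y = 0" .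
  have xT: "x (Inr (Inr m)) = 0" if "m \<in> ?T" for m
    using lookup_sum_single[of ?T "\<lambda>m. x (Inr (Inr m))" m] that \<open>y = 0\<close> by (simp add: y_def)
  have gb: "g * b i = (- w) * euler_vec (k, l) i" for i
  proof -
    have "(\<Sum>m\<in>?T. cst (x (Inr (Inr m))) * s m i) = 0" using xT by (intro sum.neutral) simp
    then show ?thesis using rel[of i] by (simp add: eq_neg_iff_add_eq_0)
  qed
  \<comment> \<open>What is left is a multiple of \<open>b\<close> equal to an Euler multiple; if
    \<open>g\<close> were nonzero, \<open>b\<close> itself would be one.\<close>
  have "g = 0"
    using euler_torsion_free[OF _ _ gb] b(3) h by (force simp: l_def)
  have xG: "x (Inl m) = 0" if "m \<in> G" for m
    using lookup_sum_single[of G "\<lambda>m. x (Inl m)" m] that \<open>g = 0\<close> G(1) by (simp add: g_def)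
  have "w = 0"
    using gb[of 0] \<open>g = 0\<close> l_nonzero by (simp add: euler_vec_def)
  have xW: "x (Inr (Inl m)) = 0" if "m \<in> ?W" for m
    using lookup_sum_single[of ?W "\<lambda>m. x (Inr (Inl m))" m] that \<open>w = 0\<close> by (simp add: w_def)
  show False using x(1) xT xG xW unfolding I_def by blast
qed

text \<open>A non-Euler syzygy of smaller bidegree has too many independent multiples in bidegree
  (u_1,3h): one for each monomial of bidegree (u_1-u, 3h-v), against the bound u_1 - u_0 +
  1.\<close>

lemma small_bidegree_euler:
  assumes u1: "u1 \<ge> u0" "bihom_part (u1, 3 * h) \<subseteq> jacobian_ideal f"
    and b: "syz f b" "bisyz (k, l) (u, v) b"
    and uv: "u \<le> u0" "v \<le> 3 * h" "(u, v) \<noteq> (u0, 3 * h)"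
  shows "is_euler (k, l) b"
proof (rule ccontr)
  assume "\<not> is_euler (k, l) b"
  then have "int (card (Mon (u1 - u) (3 * h - v))) \<le> u1 - u0 + 1"
    by (intro multiples_bound[OF u1 b]) (auto simp: Mon_def[symmetric], simp add: Mon_def)
  then have le: "(u1 - u + 1) * (3 * h - v + 1) \<le> u1 - u0 + 1"
    using u1(1) uv by (simp add: card_Mon)
  show False
  proof (cases "v = 3 * h")
    case True
    then show False using le uv by simp
  next
    case False
    \<comment> \<open>A drop in the second degree at least doubles the number of multipliers, which
      is too much even for u = u_0.\<close>
    then have "(u1 - u + 1) * 2 \<le> (u1 - u + 1) * (3 * h - v + 1)"
      using u1(1) uv by (intro mult_left_mono) auto
    from order.trans[OF this le] have "u1 + u0 + 1 \<le> 2 * u" by simp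
    then show False using u1(1) uv(1) by simp
  qed
qed

end

section \<open>A pencil of binary forms\<close>

lemma add_diff_zero:
  fixes x y :: complex
  assumes "x + y = 0" "x - y = 0"
  shows "x = 0 \<and> y = 0"
  using assms by (auto simp: add_eq_0_iff)

lemma bounded_convergent_subseq:
  fixes F :: "nat \<Rightarrow> nat \<Rightarrow> complex"
  assumes "\<And>n i. norm (F n i) \<le> 1"
  shows "\<exists>s L. strict_mono s \<and> (\<forall>i<N. (\<lambda>n. F (s n) i) \<longlonglongrightarrow> L i)"
proof (induction N)
  case 0
  show ?case by (intro exI[of _ id]) (auto simp: strict_mono_def)
next
  case (Suc N)
  then obtain s L where s: "strict_mono s" "\<forall>i<N. (\<lambda>n. F (s n) i) \<longlonglongrightarrow> L i" by blast
  have "bounded (range (\<lambda>n. F (s n) N))"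
    using assms by (auto simp: bounded_iff)
  then obtain x r where r: "strict_mono r" "((\<lambda>n. F (s n) N) \<circ> r) \<longlonglongrightarrow> x"
    using bounded_imp_convergent_subsequence by blast
  have "(\<lambda>n. F (s (r n)) i) \<longlonglongrightarrow> (if i = N then x else L i)" if "i < Suc N" for i
  proof (cases "i = N")
    case True
    then show ?thesis using r(2) by (simp add: o_def)
  next
    case False
    then have "(\<lambda>n. F (s n) i) \<longlonglongrightarrow> L i" using s(2) that by simp
    from LIMSEQ_subseq_LIMSEQ[OF this r(1)] show ?thesis using False by (simp add: o_def)
  qed
  then show ?case
    using strict_mono_o[OF s(1) r(1), unfolded o_def]
    by (intro exI[of _ "\<lambda>n. s (r n)"] exI[of _ "\<lambda>i. if i = N then x else L i"] conjI) simp_all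
qed

locale pencil =
  fixes h :: nat
  assumes h_pos: "h \<ge> 1"
begin

abbreviation l :: nat where "l \<equiv> 2 * h + 1"

text \<open>
  For $f = p\,x_2^l - p\,x_2^h x_3^{h+1} + n\,x_2^{h+1} x_3^h + q\,x_3^l$ and a functional with
  value \<open>\<xi> i\<close> at $x_2^i x_3^{3h-i}$, the numbers \<open>R2 p n \<xi> j\<close> and \<open>R3 p n q \<xi> j\<close> are its values at
  $x_2^j x_3^{h-j} f_2$ and $x_2^j x_3^{h-j} f_3$. Similarly \<open>KA\<close>, \<open>KB\<close> and \<open>KG\<close> are its values at
  $x_2^j x_3^{h-1-j}$ times $A = x_2^l - x_2^h x_3^{h+1}$, $B = x_2^{h+1} x_3^h + x_3^l$ and
  $G = x_2^{h+1} x_3^h$.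
\<close>

definition R2 :: "complex \<Rightarrow> complex \<Rightarrow> (nat \<Rightarrow> complex) \<Rightarrow> nat \<Rightarrow> complex" where
  "R2 p n \<xi> j = p * (of_nat l * \<xi> (2*h+j) - of_nat h * \<xi> (h-1+j)) + n * of_nat (h+1) * \<xi> (h+j)"

definition R3 :: "complex \<Rightarrow> complex \<Rightarrow> complex \<Rightarrow> (nat \<Rightarrow> complex) \<Rightarrow> nat \<Rightarrow> complex" where
  "R3 p n q \<xi> j = of_nat l * q * \<xi> j - of_nat (h+1) * p * \<xi> (h+j) + of_nat h * n * \<xi> (h+j+1)"

definition KA :: "(nat \<Rightarrow> complex) \<Rightarrow> nat \<Rightarrow> complex" where "KA \<xi> j = \<xi> (2*h+1+j) - \<xi> (h+j)"
definition KB :: "(nat \<Rightarrow> complex) \<Rightarrow> nat \<Rightarrow> complex" where "KB \<xi> j = \<xi> (h+1+j) + \<xi> j"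
definition KG :: "(nat \<Rightarrow> complex) \<Rightarrow> nat \<Rightarrow> complex" where "KG \<xi> j = \<xi> (h+1+j)"

lemma middle_suffices:
  assumes mid: "\<And>j. j \<le> h \<Longrightarrow> \<xi> (h+j) = 0"
    and lo: "\<And>j. j < h \<Longrightarrow> \<xi> j = 0" and hi: "\<And>j. 1 \<le> j \<Longrightarrow> j \<le> h \<Longrightarrow> \<xi> (2*h+j) = 0"
    and i: "i \<le> 3*h"
  shows "\<xi> i = (0::complex)"
proof -
  consider "i < h" | "h \<le> i" "i \<le> 2*h" | "2*h < i" by linarith
  then show ?thesis
  proof cases
    case 2
    then show ?thesis using mid[of "i - h"] by simp
  next
    case 3
    then show ?thesis using hi[of "i - 2*h"] i by simp
  qed (rule lo)
qed

text \<open>A point at which f_0 and f_1 generate A and B. The conditions \<open>KA\<close> and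
  \<open>KB\<close> express the outer values of \<xi> through the middle ones, at indices h to 2h.
  Then \<open>R2\<close> for positive index is a two-term recursion along the middle, while
  \<open>R2\<close> at 0 and \<open>R3\<close> at h link its two ends.\<close>

lemma pencil_functional_zero:
  assumes st: "s \<noteq> 0 \<or> t \<noteq> 0"
    and R2: "\<And>j. j \<le> h \<Longrightarrow> R2 s t \<xi> j = 0" and R3: "\<And>j. j \<le> h \<Longrightarrow> R3 s t t \<xi> j = 0"
    and A: "\<And>j. j < h \<Longrightarrow> KA \<xi> j = 0" and B: "\<And>j. j < h \<Longrightarrow> KB \<xi> j = 0"
    and i: "i \<le> 3*h"
  shows "\<xi> i = 0"
proof -
  have hi: "\<xi> (2*h+1+j) = \<xi> (h+j)" if "j < h" for j using A[OF that] by (simp add: KA_def)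
  have lo: "\<xi> j = - \<xi> (h+1+j)" if "j < h" for j using B[OF that] by (simp add: KB_def add_eq_0_iff add.commute)
  define a b where "a = s * \<xi> (2*h)" and "b = t * \<xi> h"
  have rec: "s * \<xi> (h+j) + t * \<xi> (h+j+1) = 0" if "j < h" for j
  proof -
    have "of_nat (h+1) * (s * \<xi> (h+j) + t * \<xi> (h+j+1)) = R2 s t \<xi> (Suc j)"
    proof -
      have "h - 1 + Suc j = h + j" "2 * h + Suc j = 2*h+1+j" using h_pos by auto
      then show ?thesis unfolding R2_def by (simp only: hi[OF that]) (simp add: algebra_simps)
    qed
    also have "\<dots> = 0" using R2[of "Suc j"] that by simp
    finally show ?thesis by (metis mult_eq_0_iff of_nat_eq_0_iff add_is_0 one_neq_zero)
  qed
  have e1: "of_nat (3*h+1) * a + of_nat (h+1) * b = 0"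
  proof -
    have "h + 1 + (h - 1) = 2 * h" using h_pos by simp
    then have lo1: "\<xi> (h-1) = - \<xi> (2*h)" using lo[of "h - 1"] h_pos by (simp add: mult_2)
    have "R2 s t \<xi> 0 = 0" using R2 by simp
    then show ?thesis unfolding R2_def add_0_right lo1 by (simp add: a_def b_def algebra_simps)
  qed
  have e2: "of_nat (3*h+1) * b - of_nat (h+1) * a = 0"
  proof -
    have ix: "h + h = 2 * h" by simp
    have hi0: "\<xi> (2*h+1) = \<xi> h" using hi[of 0] h_pos by simp
    have "R3 s t t \<xi> h = 0" using R3 by simp
    then show ?thesis unfolding R3_def ix hi0 by (simp add: a_def b_def algebra_simps)
  qed
  \<comment> \<open>The determinant of the two end equations is a sum of two positive
    squares.\<close>
  have "(of_nat (3*h+1) * of_nat (3*h+1) + of_nat (h+1) * of_nat (h+1)) * a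
    = of_nat (3*h+1) * (of_nat (3*h+1) * a + of_nat (h+1) * b) - of_nat (h+1) * (of_nat (3*h+1) * b - of_nat (h+1) * a)"
    by (simp only: ring_distribs mult_ac) simp
  then have "(of_nat (3*h+1) * of_nat (3*h+1) + of_nat (h+1) * of_nat (h+1)) * a = 0"
    by (simp only: e1 e2 mult_zero_right diff_zero)
  then have "of_nat ((3*h+1) * (3*h+1) + (h+1) * (h+1)) * a = 0"
    by (simp only: of_nat_add[of "(3*h+1) * (3*h+1)"] of_nat_mult[of "3*h+1"] of_nat_mult[of "h+1"])
  then have a0: "a = 0" by (metis mult_eq_0_iff of_nat_eq_0_iff add_is_0 one_neq_zero)
  then have b0: "b = 0" using e2 by (metis mult_eq_0_iff of_nat_eq_0_iff add_is_0 one_neq_zero diff_zero)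
  have mid: "\<xi> (h+j) = 0" if "j \<le> h" for j
  proof (cases "t = 0")
    case True
    then have "s \<noteq> 0" using st by simp
    then show ?thesis
      using True rec[of j] a0 that by (cases "j = h") (auto simp: a_def mult_2)
  next
    case False
    show ?thesis using that
    proof (induction j)
      case 0
      then show ?case using False b0 by (simp add: b_def)
    next
      case (Suc j)
      then show ?case using False rec[of j] by simp
    qed
  qed
  show ?thesis
  proof (rule middle_suffices[of \<xi> i, OF mid _ _ i])
    show "\<xi> j = 0" if "j < h" for j using lo[OF that] mid[of "1 + j"] that by simp
    show "\<xi> (2*h+j) = 0" if "1 \<le> j" "j \<le> h" for j using hi[of "j - 1"] mid[of "j - 1"] that by simp
  qed
qed

text \<open>A ramification point, where f is proportional to A + tB and one further direction
  (\<mu>,\<nu>) is all that is known. \<open>R3\<close> and \<open>R2\<close> express the lower and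
  upper values through the middle ones, and the direction gives a two-term recursion there, whatever
  its ratio. So the norms are monotone along the middle, the largest sits at an end, and
  \<open>E1\<close> or \<open>E2\<close> bounds it by strictly less than itself.\<close>

lemma all_directions_functional_zero:
  assumes t: "t = 1 \<or> t = -1" and \<mu>\<nu>: "\<mu> \<noteq> 0 \<or> \<nu> \<noteq> 0"
    and R2: "\<And>j. j \<le> h \<Longrightarrow> R2 1 t \<xi> j = 0" and R3: "\<And>j. j \<le> h \<Longrightarrow> R3 1 t t \<xi> j = 0"
    and D: "\<And>j. j < h \<Longrightarrow> \<mu> * KB \<xi> j + \<nu> * KG \<xi> j = 0"
    and i: "i \<le> 3*h"
  shows "\<xi> i = 0"
proof -
  have tt: "t * t = 1" and nt: "norm t = 1" using t by auto
  have lo: "of_nat l * \<xi> j = t * of_nat (h+1) * \<xi> (h+j) - of_nat h * \<xi> (h+j+1)" if "j \<le> h" for j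
  proof -
    have "t * R3 1 t t \<xi> j = (t * t) * (of_nat l * \<xi> j) - t * of_nat (h+1) * \<xi> (h+j) + (t * t) * (of_nat h * \<xi> (h+j+1))"
      by (simp add: R3_def algebra_simps)
    then show ?thesis using R3[OF that] unfolding tt by (simp add: algebra_simps)
  qed
  have hi: "of_nat l * \<xi> (2*h+j) = of_nat h * \<xi> (h-1+j) - t * of_nat (h+1) * \<xi> (h+j)" if "j \<le> h" for j
    using R2[OF that] by (simp add: R2_def algebra_simps eq_diff_eq)
  define \<delta>1 \<delta>2 where "\<delta>1 = \<mu> * t * of_nat (h+1)" and "\<delta>2 = \<mu> * of_nat (h+1) + of_nat l * \<nu>"
  have geo: "\<delta>1 * \<xi> (h+j) + \<delta>2 * \<xi> (h+j+1) = 0" if "j < h" for j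
  proof -
    have "of_nat l * (\<mu> * KB \<xi> j + \<nu> * KG \<xi> j)
      = \<mu> * (of_nat l * \<xi> (h+j+1) + of_nat l * \<xi> j) + of_nat l * \<nu> * \<xi> (h+j+1)"
      by (simp add: KB_def KG_def algebra_simps)
    also have "\<dots> = \<delta>1 * \<xi> (h+j) + \<delta>2 * \<xi> (h+j+1)"
      unfolding lo[OF less_imp_le[OF that]] by (simp add: \<delta>1_def \<delta>2_def algebra_simps)
    finally show ?thesis using D[OF that] by simp
  qed
  have \<delta>: "\<delta>1 \<noteq> 0 \<or> \<delta>2 \<noteq> 0"
  proof (cases "\<mu> = 0")
    case True
    then have "of_nat l * \<nu> \<noteq> 0" using \<mu>\<nu> by (metis mult_eq_0_iff of_nat_eq_0_iff add_is_0 one_neq_zero)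
    then show ?thesis using True by (simp add: \<delta>2_def)
  next
    case False
    then have "\<delta>1 \<noteq> 0" unfolding \<delta>1_def using tt
      by (metis mult_eq_0_iff of_nat_eq_0_iff add_is_0 one_neq_zero)
    then show ?thesis by simp
  qed
  let ?a = "of_nat (l*l + h*h) :: complex" and ?b = "of_nat (h*(h+1)) :: complex" and ?c = "of_nat (l*(h+1)) :: complex"
  have a_split: "?a * x = of_nat l * (of_nat l * x) + of_nat h * (of_nat h * x)" for x
    by (simp add: algebra_simps)
  have E1: "?a * \<xi> (2*h) = ?b * t * \<xi> (h+(h-1)) - ?c * t * \<xi> h"
  proof -
    have 1: "of_nat l * \<xi> (2*h) = of_nat h * \<xi> (h-1) - t * of_nat (h+1) * \<xi> h"
      using hi[of 0] by (simp only: add_0_right)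
    have ix: "h + (h - 1) + 1 = 2 * h" using h_pos by simp
    have 2: "of_nat l * \<xi> (h-1) = t * of_nat (h+1) * \<xi> (h+(h-1)) - of_nat h * \<xi> (2*h)"
      using lo[of "h-1"] unfolding ix by simp
    have "of_nat l * (of_nat l * \<xi> (2*h)) = of_nat h * (of_nat l * \<xi> (h-1)) - ?c * t * \<xi> h"
      unfolding 1 by (simp add: algebra_simps)
    then show ?thesis unfolding a_split 2 by (simp add: algebra_simps)
  qed
  have E2: "?a * \<xi> h = ?b * t * \<xi> (h+1) + ?c * t * \<xi> (2*h)"
  proof -
    have ix: "h + h = 2 * h" by simp
    have 1: "of_nat l * \<xi> h = t * of_nat (h+1) * \<xi> (2*h) - of_nat h * \<xi> (2*h+1)"
      using lo[of h] unfolding ix by simp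
    have ix2: "h - 1 + 1 = h" using h_pos by simp
    have 2: "of_nat l * \<xi> (2*h+1) = of_nat h * \<xi> h - t * of_nat (h+1) * \<xi> (h+1)"
      using hi[OF h_pos] unfolding ix2 .
    have "of_nat l * (of_nat l * \<xi> h) = ?c * t * \<xi> (2*h) - of_nat h * (of_nat l * \<xi> (2*h+1))"
      unfolding 1 by (simp add: algebra_simps)
    then show ?thesis unfolding a_split 2 by (simp add: algebra_simps)
  qed
  \<comment> \<open>The contraction: l*l + h*h = 5h^2 + 4h + 1 exceeds h(h+1) + l(h+1) = 3h^2 + 4h +
    1 because h \<ge> 1.\<close>
  have zero: "x = 0" if x: "?a * x = ?b * t * y + ?c * t * z" and le: "norm y \<le> norm x" "norm z \<le> norm x" for x y z
  proof (rule ccontr)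
    assume "x \<noteq> 0"
    have "real (l*l+h*h) * norm x = norm (?a * x)" by (simp only: norm_mult norm_of_nat)
    also have "\<dots> \<le> norm (?b * t * y) + norm (?c * t * z)" unfolding x by (rule norm_triangle_ineq)
    also have "\<dots> = real (h*(h+1)) * norm y + real (l*(h+1)) * norm z"
      by (simp only: norm_mult norm_of_nat nt mult_1_right)
    also have "\<dots> \<le> real (h*(h+1)) * norm x + real (l*(h+1)) * norm x"
      using le by (intro add_mono mult_left_mono) auto
    also have "\<dots> = real (h*(h+1) + l*(h+1)) * norm x" by (simp only: of_nat_add distrib_right)
    finally have "real (l*l+h*h) \<le> real (h*(h+1) + l*(h+1))"
      using \<open>x \<noteq> 0\<close> by (simp only: mult_le_cancel_right_pos zero_less_norm_iff not_False_eq_True)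
    then have "l*l+h*h \<le> h*(h+1) + l*(h+1)" by (simp only: of_nat_le_iff)
    then show False using h_pos by (simp add: algebra_simps)
  qed
  have mid: "\<forall>j\<le>h. \<xi> (h+j) = 0"
  \<comment> \<open>The larger coefficient decides at which end the norm is largest: at index h
    here, at 2h in the other case.\<close>
  proof (cases "norm \<delta>1 \<le> norm \<delta>2")
    case True
    then have d2: "\<delta>2 \<noteq> 0" using \<delta> by auto
    have step: "norm (\<xi> (h+j+1)) \<le> norm (\<xi> (h+j))" if "j < h" for j
    proof -
      have "\<delta>2 * \<xi> (h+j+1) = - (\<delta>1 * \<xi> (h+j))" using geo[OF that] by (simp add: eq_neg_iff_add_eq_0 add.commute)
      then have "norm \<delta>2 * norm (\<xi> (h+j+1)) = norm \<delta>1 * norm (\<xi> (h+j))" by (metis norm_mult norm_minus_cancel)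
      also have "\<dots> \<le> norm \<delta>2 * norm (\<xi> (h+j))" using True by (intro mult_right_mono) auto
      finally show ?thesis using d2 by simp
    qed
    have le: "norm (\<xi> (h+j)) \<le> norm (\<xi> h)" if "j \<le> h" for j
      using that
    proof (induction j)
      case (Suc j)
      then show ?case using step[of j] by simp
    qed simp
    have "\<xi> h = 0"
      by (rule zero[OF E2]) (use le[of 1] le[of h] h_pos in \<open>simp_all add: mult_2\<close>)
    then show ?thesis using le by simp
  next
    case False
    then have d1: "\<delta>1 \<noteq> 0" by auto
    have step: "norm (\<xi> (h+j)) \<le> norm (\<xi> (h+j+1))" if "j < h" for j
    proof -
      have "\<delta>1 * \<xi> (h+j) = - (\<delta>2 * \<xi> (h+j+1))" using geo[OF that] by (simp add: eq_neg_iff_add_eq_0)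
      then have "norm \<delta>1 * norm (\<xi> (h+j)) = norm \<delta>2 * norm (\<xi> (h+j+1))" by (metis norm_mult norm_minus_cancel)
      also have "\<dots> \<le> norm \<delta>1 * norm (\<xi> (h+j+1))" using False by (intro mult_right_mono) auto
      finally show ?thesis using d1 by simp
    qed
    have le: "norm (\<xi> (h+(h-j))) \<le> norm (\<xi> (2*h))" if "j \<le> h" for j
      using that
    proof (induction j)
      case (Suc j)
      then have "h + (h - Suc j) + 1 = h + (h - j)" by simp
      then show ?case using step[of "h - Suc j"] Suc by simp
    qed (simp add: mult_2)
    have "?a * \<xi> (2*h) = ?b * t * \<xi> (h+(h-1)) + ?c * t * (- \<xi> h)" using E1 by simp
    then have "\<xi> (2*h) = 0"
      by (rule zero) (use le[of 1] le[of h] h_pos in simp_all)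
    then have "\<xi> (h+(h-j)) = 0" if "j \<le> h" for j using le[OF that] by simp
    then show ?thesis by (metis diff_diff_cancel diff_le_self)
  qed
  have lnz: "of_nat l \<noteq> (0::complex)" by (metis of_nat_eq_0_iff add_is_0 one_neq_zero)
  show ?thesis
  proof (rule middle_suffices[of \<xi> i, OF _ _ _ i])
    show "\<xi> (h+j) = 0" if "j \<le> h" for j using mid that by blast
    show "\<xi> j = 0" if "j < h" for j
    proof -
      have "\<xi> (h+j) = 0" "\<xi> (h+(j+1)) = 0" using mid[rule_format, of j] mid[rule_format, of "j+1"] that by simp_all
      then have "of_nat l * \<xi> j = 0" using lo[of j] that by (simp add: add.assoc)
      then show ?thesis using lnz by (metis mult_eq_0_iff)
    qed
    show "\<xi> (2*h+j) = 0" if "1 \<le> j" "j \<le> h" for j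
    proof -
      have "\<xi> (h+j) = 0" "\<xi> (h+(j-1)) = 0" using mid[rule_format, of j] mid[rule_format, of "j-1"] that by simp_all
      moreover have "h - 1 + j = h + (j - 1)" using that h_pos by simp
      ultimately have "of_nat l * \<xi> (2*h+j) = 0" using hi[of j] that by simp
      then show ?thesis using lnz by (metis mult_eq_0_iff)
    qed
  qed
qed

text \<open>Values at $(v_0, v_1)$ of $r = x_0^{k-1} x_1 + x_0 x_1^{k-1}$ and of its two derivatives. The
  truncated exponent \<open>k-2\<close> only occurs with coefficient 0.\<close>

definition rr0 :: "nat \<Rightarrow> complex \<Rightarrow> complex \<Rightarrow> complex" where
  "rr0 k v0 v1 = of_nat (k-1) * v0 ^ (k-2) * v1 + v1 ^ (k-1)"
definition rr1 :: "nat \<Rightarrow> complex \<Rightarrow> complex \<Rightarrow> complex" where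
  "rr1 k v0 v1 = v0 ^ (k-1) + of_nat (k-1) * v0 * v1 ^ (k-2)"
definition rr :: "nat \<Rightarrow> complex \<Rightarrow> complex \<Rightarrow> complex" where
  "rr k v0 v1 = v0 ^ (k-1) * v1 + v0 * v1 ^ (k-1)"

text \<open>The functional \<xi> on forms of degree 3h in x_2, x_3 vanishes on all multiples of f_2,
  f_3, f_0, f_1, in this order, taken at the point (v0,v1). The underlying form is (x_0^k + x_1^k) A
  + (x_0^k - x_1^k) B + \<epsilon> r G.\<close>

definition fibre_relations :: "nat \<Rightarrow> complex \<Rightarrow> complex \<Rightarrow> complex \<Rightarrow> (nat \<Rightarrow> complex) \<Rightarrow> bool" where
  "fibre_relations k \<epsilon> v0 v1 \<xi> \<longleftrightarrow>
    (\<forall>j\<le>h. R2 (v0^k + v1^k) (v0^k - v1^k + \<epsilon> * rr k v0 v1) \<xi> j = 0) \<and>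
    (\<forall>j\<le>h. R3 (v0^k + v1^k) (v0^k - v1^k + \<epsilon> * rr k v0 v1) (v0^k - v1^k) \<xi> j = 0) \<and>
    (\<forall>j<h. of_nat k * v0^(k-1) * (KA \<xi> j + KB \<xi> j) + \<epsilon> * rr0 k v0 v1 * KG \<xi> j = 0) \<and>
    (\<forall>j<h. of_nat k * v1^(k-1) * (KA \<xi> j - KB \<xi> j) + \<epsilon> * rr1 k v0 v1 * KG \<xi> j = 0)"

text \<open>Each relation is homogeneous in the point and linear in \<xi>; this permits normalising
  both before passing to a limit.\<close>

lemma fibre_relations_scale:
  assumes k: "k \<ge> 1" and R: "fibre_relations k \<epsilon> v0 v1 \<xi>"
  shows "fibre_relations k \<epsilon> (c * v0) (c * v1) (\<lambda>j. d * \<xi> j)"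
proof -
  have "rr k (c * v0) (c * v1) = c^k * rr k v0 v1"
    using k by (cases k) (simp_all add: rr_def power_mult_distrib algebra_simps)
  moreover have "rr0 k (c * v0) (c * v1) = c^(k-1) * rr0 k v0 v1" "rr1 k (c * v0) (c * v1) = c^(k-1) * rr1 k v0 v1"
  proof -
    have "of_nat (k-1) * (c^(k-2) * x) * (c * y) = c^(k-1) * (of_nat (k-1) * x * y)" for x y
    proof (cases "k \<ge> 2")
      case True
      then have "c^(k-1) = c^(k-2) * c" by (metis Suc_diff_Suc numeral_2_eq_2 power_Suc2 Suc_1 lessI less_le_trans)
      then show ?thesis by simp
    qed (use k in auto)
    from this[of "v0^(k-2)" v1] this[of "v1^(k-2)" v0]
    show "rr0 k (c * v0) (c * v1) = c^(k-1) * rr0 k v0 v1" "rr1 k (c * v0) (c * v1) = c^(k-1) * rr1 k v0 v1"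
      by (simp_all add: rr0_def rr1_def power_mult_distrib algebra_simps)
  qed
  moreover have "R2 (a * p) (a * n) (\<lambda>j. d * \<xi> j) j = a * d * R2 p n \<xi> j" for a p n j
    by (simp add: R2_def algebra_simps)
  moreover have "R3 (a * p) (a * n) (a * q) (\<lambda>j. d * \<xi> j) j = a * d * R3 p n q \<xi> j" for a p n q j
    by (simp add: R3_def algebra_simps)
  moreover have "KA (\<lambda>j. d * \<xi> j) j = d * KA \<xi> j" "KB (\<lambda>j. d * \<xi> j) j = d * KB \<xi> j"
    "KG (\<lambda>j. d * \<xi> j) j = d * KG \<xi> j" for j
    by (simp_all add: KA_def KB_def KG_def algebra_simps)
  moreover have "a * (c^(k-1) * x) * (d * y + d * z) + \<epsilon> * (c^(k-1) * u) * (d * w) = c^(k-1) * d * (a * x * (y + z) + \<epsilon> * u * w)"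
    "a * (c^(k-1) * x) * (d * y - d * z) + \<epsilon> * (c^(k-1) * u) * (d * w) = c^(k-1) * d * (a * x * (y - z) + \<epsilon> * u * w)" for a x y z u w
    by (simp_all add: algebra_simps)
  moreover have "c^k * x + c^k * y = c^k * (x + y)" "c^k * x - c^k * y + \<epsilon> * (c^k * z) = c^k * (x - y + \<epsilon> * z)"
    "c^k * x - c^k * y = c^k * (x - y)" for x y z by (simp_all add: algebra_simps)
  ultimately show ?thesis
    using R unfolding fibre_relations_def power_mult_distrib by simp
qed

text \<open>Compactness: counterexamples for \<epsilon> = 1/(n+1) are normalised and a limit is
  taken. In the limit the perturbation disappears, and with it the relation of f_1 or f_0 at a
  ramification point. Therefore the coefficient pairs of these two relations are normalised
  separately, so that their limits stay nonzero there.\<close>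

lemma exists_good_parameter:
  assumes k: "k \<ge> 1"
  shows "\<exists>\<epsilon>. \<forall>v0 v1 \<xi>. (v0 \<noteq> 0 \<or> v1 \<noteq> 0) \<longrightarrow> fibre_relations k \<epsilon> v0 v1 \<xi> \<longrightarrow> (\<forall>i\<le>3*h. \<xi> i = 0)"
proof (rule ccontr)
  assume "\<not> ?thesis"
  then have "\<forall>n. \<exists>v0 v1 \<xi>. (v0 \<noteq> 0 \<or> v1 \<noteq> 0) \<and> fibre_relations k (1 / of_nat (Suc n)) v0 v1 \<xi> \<and> (\<exists>i\<le>3*h. \<xi> i \<noteq> 0)"
    by blast
  then obtain a0 a1 \<eta> where a: "\<And>n. a0 n \<noteq> 0 \<or> a1 n \<noteq> 0"
    "\<And>n. fibre_relations k (1 / of_nat (Suc n)) (a0 n) (a1 n) (\<eta> n)" "\<And>n. \<exists>i\<le>3*h. \<eta> n i \<noteq> 0"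
    by metis
  define e where "e = (\<lambda>n. 1 / of_nat (Suc n) :: complex)"
  define V where "V = (\<lambda>n. norm (a0 n) + norm (a1 n))"
  define T where "T = (\<lambda>n. \<Sum>i\<le>3*h. norm (\<eta> n i))"
  have V: "V n > 0" for n using a(1)[of n] by (auto simp: V_def add_pos_nonneg add_nonneg_pos)
  have T: "T n > 0" for n
  proof -
    obtain i where "i \<le> 3*h" "\<eta> n i \<noteq> 0" using a(3) by blast
    then show ?thesis unfolding T_def by (intro sum_pos2[of _ i]) auto
  qed
  define b0 b1 \<zeta> where "b0 = (\<lambda>n. of_real (1 / V n) * a0 n)" and "b1 = (\<lambda>n. of_real (1 / V n) * a1 n)"
    and "\<zeta> = (\<lambda>n i. of_real (1 / T n) * \<eta> n i)"
  have R: "fibre_relations k (e n) (b0 n) (b1 n) (\<zeta> n)" for n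
    unfolding b0_def b1_def \<zeta>_def e_def by (rule fibre_relations_scale[OF k a(2)])
  have bsum: "norm (b0 n) + norm (b1 n) = 1" for n
  proof -
    have "norm (b0 n) = norm (a0 n) / V n" "norm (b1 n) = norm (a1 n) / V n"
      using V[of n] by (simp_all add: b0_def b1_def norm_mult norm_divide)
    then have "norm (b0 n) + norm (b1 n) = V n / V n" by (simp only: V_def add_divide_distrib)
    then show ?thesis using V[of n] by simp
  qed
  have zsum: "(\<Sum>i\<le>3*h. norm (\<zeta> n i)) = 1" for n
  proof -
    have "norm (\<zeta> n i) = norm (\<eta> n i) / T n" for i
      using T[of n] by (simp add: \<zeta>_def norm_mult norm_divide)
    then have "(\<Sum>i\<le>3*h. norm (\<zeta> n i)) = T n / T n" by (simp only: T_def sum_divide_distrib)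
    then show ?thesis using T[of n] by simp
  qed
  define \<alpha>0 \<beta>0 \<alpha>1 \<beta>1 where "\<alpha>0 = (\<lambda>n. of_nat k * b0 n^(k-1))" and "\<beta>0 = (\<lambda>n. e n * rr0 k (b0 n) (b1 n))"
    and "\<alpha>1 = (\<lambda>n. of_nat k * b1 n^(k-1))" and "\<beta>1 = (\<lambda>n. e n * rr1 k (b0 n) (b1 n))"
  define N0 N1 where "N0 = (\<lambda>n. norm (\<alpha>0 n) + norm (\<beta>0 n))" and "N1 = (\<lambda>n. norm (\<alpha>1 n) + norm (\<beta>1 n))"
  \<comment> \<open>All bounded sequences are packed into one family, so that a single subsequence
    serves: 3h+1 values of the functional, two coordinates, and two normalised coefficient
    pairs.\<close>
  define F where "F = (\<lambda>n i. if i \<le> 3*h then \<zeta> n i else if i = 3*h+1 then b0 n else if i = 3*h+2 then b1 n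
    else if i = 3*h+3 then of_real (1 / N0 n) * \<alpha>0 n else if i = 3*h+4 then of_real (1 / N0 n) * \<beta>0 n
    else if i = 3*h+5 then of_real (1 / N1 n) * \<alpha>1 n else of_real (1 / N1 n) * \<beta>1 n)"
  have "norm (F n i) \<le> 1" for n i
  proof -
    have "norm (\<zeta> n i) \<le> 1" if "i \<le> 3*h"
      unfolding zsum[of n, symmetric] using that by (intro member_le_sum) auto
    moreover have "norm (b0 n) \<le> 1" "norm (b1 n) \<le> 1"
      using bsum[of n] norm_ge_zero[of "b0 n"] norm_ge_zero[of "b1 n"] by linarith+
    moreover have "norm (of_real (1 / (norm x + norm y)) * x) \<le> 1" "norm (of_real (1 / (norm x + norm y)) * y) \<le> 1" for x y :: complex
    proof -
      \<comment> \<open>Division by zero yields 0, so the bound survives where both coefficients of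
        a relation vanish.\<close>
      have *: "\<bar>1 / (a + b)\<bar> * a \<le> 1" if "a \<ge> 0" "b \<ge> 0" for a b :: real
        using that by (cases "a + b = 0") (auto simp: divide_le_eq_1 abs_of_nonneg)
      have "\<bar>1 / (norm x + norm y)\<bar> * norm x \<le> 1" "\<bar>1 / (norm x + norm y)\<bar> * norm y \<le> 1"
        using *[of "norm x" "norm y"] *[of "norm y" "norm x"] by (simp_all add: add.commute)
      then show "norm (of_real (1 / (norm x + norm y)) * x) \<le> 1" "norm (of_real (1 / (norm x + norm y)) * y) \<le> 1"
        by (simp_all only: norm_mult norm_of_real)
    qed
    ultimately show ?thesis by (simp add: F_def N0_def N1_def)
  qed
  from bounded_convergent_subseq[of F "3*h+7", OF this]
  obtain s L where s: "strict_mono s" and L: "\<And>i. i < 3*h+7 \<Longrightarrow> (\<lambda>n. F (s n) i) \<longlonglongrightarrow> L i" by blast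
  define v0 v1 where "v0 = L (3*h+1)" and "v1 = L (3*h+2)"
  have lim_b0: "(\<lambda>n. b0 (s n)) \<longlonglongrightarrow> v0" and lim_b1: "(\<lambda>n. b1 (s n)) \<longlonglongrightarrow> v1"
    using L[of "3*h+1"] L[of "3*h+2"] by (simp_all add: F_def v0_def v1_def)
  have lim_z: "(\<lambda>n. \<zeta> (s n) i) \<longlonglongrightarrow> L i" if "i \<le> 3*h" for i
    using L[of i] that by (simp add: F_def)
  have "(\<lambda>n. 1 / of_nat (Suc n) :: complex) \<longlonglongrightarrow> 0"
    using LIMSEQ_Suc[OF lim_1_over_n[where ?'a = complex]] by simp
  from LIMSEQ_subseq_LIMSEQ[OF this s] have lim_e: "(\<lambda>n. e (s n)) \<longlonglongrightarrow> 0" by (simp add: e_def o_def)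
  have "(\<lambda>n. norm (b0 (s n)) + norm (b1 (s n))) \<longlonglongrightarrow> norm v0 + norm v1"
    by (intro tendsto_intros lim_b0 lim_b1)
  then have vsum: "norm v0 + norm v1 = 1"
    unfolding bsum by (simp add: LIMSEQ_const_iff)
  have "(\<lambda>n. \<Sum>i\<le>3*h. norm (\<zeta> (s n) i)) \<longlonglongrightarrow> (\<Sum>i\<le>3*h. norm (L i))"
    by (intro tendsto_sum tendsto_norm lim_z) simp
  then have Lsum: "(\<Sum>i\<le>3*h. norm (L i)) = 1"
    unfolding zsum by (simp add: LIMSEQ_const_iff)
  let ?P = "v0^k + v1^k" and ?Q = "v0^k - v1^k"
  have lim0: "x = 0" if "(\<lambda>n. X n) \<longlonglongrightarrow> x" "\<And>n. X n = 0" for X and x :: complex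
    using that by (simp add: LIMSEQ_const_iff)
  have lim_rr: "(\<lambda>n. rr k (b0 (s n)) (b1 (s n))) \<longlonglongrightarrow> rr k v0 v1"
    "(\<lambda>n. rr0 k (b0 (s n)) (b1 (s n))) \<longlonglongrightarrow> rr0 k v0 v1"
    "(\<lambda>n. rr1 k (b0 (s n)) (b1 (s n))) \<longlonglongrightarrow> rr1 k v0 v1"
    unfolding rr_def rr0_def rr1_def by (intro tendsto_intros lim_b0 lim_b1)+
  have limP: "(\<lambda>n. b0 (s n)^k + b1 (s n)^k) \<longlonglongrightarrow> ?P" and limQ: "(\<lambda>n. b0 (s n)^k - b1 (s n)^k) \<longlonglongrightarrow> ?Q"
    by (intro tendsto_intros lim_b0 lim_b1)+
  have limN: "(\<lambda>n. b0 (s n)^k - b1 (s n)^k + e (s n) * rr k (b0 (s n)) (b1 (s n))) \<longlonglongrightarrow> ?Q"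
    using tendsto_add[OF limQ tendsto_mult[OF lim_e lim_rr(1)]] by simp
  have R2L: "R2 ?P ?Q L j = 0" if "j \<le> h" for j
  proof (rule lim0)
    show "(\<lambda>n. R2 (b0 (s n)^k + b1 (s n)^k) (b0 (s n)^k - b1 (s n)^k + e (s n) * rr k (b0 (s n)) (b1 (s n))) (\<zeta> (s n)) j) \<longlonglongrightarrow> R2 ?P ?Q L j"
      unfolding R2_def using that h_pos by (intro tendsto_intros limP limN lim_z) auto
    show "R2 (b0 (s n)^k + b1 (s n)^k) (b0 (s n)^k - b1 (s n)^k + e (s n) * rr k (b0 (s n)) (b1 (s n))) (\<zeta> (s n)) j = 0" for n
      using R[of "s n"] that by (simp add: fibre_relations_def)
  qed
  have R3L: "R3 ?P ?Q ?Q L j = 0" if "j \<le> h" for j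
  proof (rule lim0)
    show "(\<lambda>n. R3 (b0 (s n)^k + b1 (s n)^k) (b0 (s n)^k - b1 (s n)^k + e (s n) * rr k (b0 (s n)) (b1 (s n))) (b0 (s n)^k - b1 (s n)^k) (\<zeta> (s n)) j) \<longlonglongrightarrow> R3 ?P ?Q ?Q L j"
      unfolding R3_def using that h_pos by (intro tendsto_intros limP limN limQ lim_z) auto
    show "R3 (b0 (s n)^k + b1 (s n)^k) (b0 (s n)^k - b1 (s n)^k + e (s n) * rr k (b0 (s n)) (b1 (s n))) (b0 (s n)^k - b1 (s n)^k) (\<zeta> (s n)) j = 0" for n
      using R[of "s n"] that by (simp add: fibre_relations_def)
  qed
  have limK: "(\<lambda>n. KA (\<zeta> (s n)) j) \<longlonglongrightarrow> KA L j" "(\<lambda>n. KB (\<zeta> (s n)) j) \<longlonglongrightarrow> KB L j" "(\<lambda>n. KG (\<zeta> (s n)) j) \<longlonglongrightarrow> KG L j" if "j < h" for j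
    unfolding KA_def KB_def KG_def using that by (intro tendsto_intros lim_z; simp)+
  have rel0: "\<alpha>0 n * (KA (\<zeta> n) j + KB (\<zeta> n) j) + \<beta>0 n * KG (\<zeta> n) j = 0"
    and rel1: "\<alpha>1 n * (KA (\<zeta> n) j - KB (\<zeta> n) j) + \<beta>1 n * KG (\<zeta> n) j = 0" if "j < h" for n j
    using R[of n] that by (simp_all add: fibre_relations_def \<alpha>0_def \<beta>0_def \<alpha>1_def \<beta>1_def mult.assoc)
  have lim_beta: "(\<lambda>n. \<beta>0 (s n)) \<longlonglongrightarrow> 0" "(\<lambda>n. \<beta>1 (s n)) \<longlonglongrightarrow> 0"
    unfolding \<beta>0_def \<beta>1_def using tendsto_mult[OF lim_e lim_rr(2)] tendsto_mult[OF lim_e lim_rr(3)] by simp_all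
  have lim_alpha: "(\<lambda>n. \<alpha>0 (s n)) \<longlonglongrightarrow> of_nat k * v0^(k-1)" "(\<lambda>n. \<alpha>1 (s n)) \<longlonglongrightarrow> of_nat k * v1^(k-1)"
    unfolding \<alpha>0_def \<alpha>1_def by (intro tendsto_intros lim_b0 lim_b1)+
  have K0: "of_nat k * v0^(k-1) * (KA L j + KB L j) = 0" if "j < h" for j
  proof (rule lim0)
    show "(\<lambda>n. \<alpha>0 (s n) * (KA (\<zeta> (s n)) j + KB (\<zeta> (s n)) j) + \<beta>0 (s n) * KG (\<zeta> (s n)) j) \<longlonglongrightarrow> of_nat k * v0^(k-1) * (KA L j + KB L j)"
      using tendsto_add[OF tendsto_mult[OF lim_alpha(1) tendsto_add[OF limK(1)[OF that] limK(2)[OF that]]] tendsto_mult[OF lim_beta(1) limK(3)[OF that]]] by simp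
  qed (rule rel0[OF that])
  have K1: "of_nat k * v1^(k-1) * (KA L j - KB L j) = 0" if "j < h" for j
  proof (rule lim0)
    show "(\<lambda>n. \<alpha>1 (s n) * (KA (\<zeta> (s n)) j - KB (\<zeta> (s n)) j) + \<beta>1 (s n) * KG (\<zeta> (s n)) j) \<longlonglongrightarrow> of_nat k * v1^(k-1) * (KA L j - KB L j)"
      using tendsto_add[OF tendsto_mult[OF lim_alpha(2) tendsto_diff[OF limK(1)[OF that] limK(2)[OF that]]] tendsto_mult[OF lim_beta(2) limK(3)[OF that]]] by simp
  qed (rule rel1[OF that])
  have kz: "of_nat k \<noteq> (0::complex)" using k by simp
  text \<open>Near a ramification point of the pencil only the limit direction of the tangent is known.\<close>
  have direction: "\<exists>\<mu> \<nu>. (\<mu> \<noteq> 0 \<or> \<nu> \<noteq> 0) \<and> (\<forall>j<h. \<mu> * K j + \<nu> * KG L j = 0)"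
    if lims: "\<And>j. j < h \<Longrightarrow> (\<lambda>n. K' n j) \<longlonglongrightarrow> K j"
      "(\<lambda>n. of_real (1 / (norm (\<alpha> n) + norm (\<beta> n))) * \<alpha> n) \<longlonglongrightarrow> \<mu>"
      "(\<lambda>n. of_real (1 / (norm (\<alpha> n) + norm (\<beta> n))) * \<beta> n) \<longlonglongrightarrow> \<nu>"
      and rel: "\<And>n j. j < h \<Longrightarrow> \<alpha> n * K' n j + \<beta> n * KG (\<zeta> (s n)) j = 0"
      and nz: "\<forall>\<^sub>F n in sequentially. \<beta> n \<noteq> 0"
    for K' :: "nat \<Rightarrow> nat \<Rightarrow> complex" and K \<alpha> \<beta> \<mu> \<nu>
  proof (intro exI conjI allI impI)
    let ?N = "\<lambda>n. of_real (1 / (norm (\<alpha> n) + norm (\<beta> n))) :: complex"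
    have "(\<lambda>n. norm (?N n * \<alpha> n) + norm (?N n * \<beta> n)) \<longlonglongrightarrow> norm \<mu> + norm \<nu>"
      by (intro tendsto_intros lims)
    moreover have "\<forall>\<^sub>F n in sequentially. norm (?N n * \<alpha> n) + norm (?N n * \<beta> n) = 1"
      using nz
    proof eventually_elim
      case (elim n)
      then have "norm (\<alpha> n) + norm (\<beta> n) > 0" by (simp add: add_nonneg_pos)
      then show ?case
        by (simp only: norm_mult norm_of_real distrib_left[symmetric]) simp
    qed
    ultimately have "(\<lambda>n. 1 :: real) \<longlonglongrightarrow> norm \<mu> + norm \<nu>"
      by (rule Lim_transform_eventually)
    then have "norm \<mu> + norm \<nu> = 1" by (simp add: LIMSEQ_const_iff)
    then show "\<mu> \<noteq> 0 \<or> \<nu> \<noteq> 0" by auto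
    fix j assume j: "j < h"
    show "\<mu> * K j + \<nu> * KG L j = 0"
    proof (rule lim0)
      show "(\<lambda>n. (?N n * \<alpha> n) * K' n j + (?N n * \<beta> n) * KG (\<zeta> (s n)) j) \<longlonglongrightarrow> \<mu> * K j + \<nu> * KG L j"
        by (intro tendsto_intros lims limK j)
      show "(?N n * \<alpha> n) * K' n j + (?N n * \<beta> n) * KG (\<zeta> (s n)) j = 0" for n
        using arg_cong[OF rel[OF j, of n], of "\<lambda>x. ?N n * x"] by (simp only: distrib_left mult.assoc mult_zero_right)
    qed
  qed
  have dir0: "(\<lambda>n. of_real (1 / (norm (\<alpha>0 (s n)) + norm (\<beta>0 (s n)))) * \<alpha>0 (s n)) \<longlonglongrightarrow> L (3*h+3)"
    "(\<lambda>n. of_real (1 / (norm (\<alpha>0 (s n)) + norm (\<beta>0 (s n)))) * \<beta>0 (s n)) \<longlonglongrightarrow> L (3*h+4)"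
    using L[of "3*h+3"] L[of "3*h+4"] by (simp_all add: F_def N0_def)
  have dir1: "(\<lambda>n. of_real (1 / (norm (\<alpha>1 (s n)) + norm (\<beta>1 (s n)))) * \<alpha>1 (s n)) \<longlonglongrightarrow> L (3*h+5)"
    "(\<lambda>n. of_real (1 / (norm (\<alpha>1 (s n)) + norm (\<beta>1 (s n)))) * \<beta>1 (s n)) \<longlonglongrightarrow> L (3*h+6)"
    using L[of "3*h+5"] L[of "3*h+6"] by (simp_all add: F_def N1_def)
  have enz: "e n \<noteq> 0" for n unfolding e_def by (metis divide_eq_0_iff of_nat_eq_0_iff nat.distinct(1) one_neq_zero)
  have "L i = 0" if i: "i \<le> 3*h" for i
  proof -
    \<comment> \<open>For k = 1 nothing ramifies and the first case applies; for k \<ge> 2 the limit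
      point is ramified exactly if one coordinate is 0.\<close>
    consider "v0^(k-1) \<noteq> 0" "v1^(k-1) \<noteq> 0" | "v1 = 0" "v0 \<noteq> 0" "k \<ge> 2" | "v0 = 0" "v1 \<noteq> 0" "k \<ge> 2"
    proof -
      have "v0 \<noteq> 0 \<or> v1 \<noteq> 0" using vsum by auto
      moreover have "v^(k-1) \<noteq> 0" if "v \<noteq> 0 \<or> k = 1" for v :: complex using that by auto
      ultimately show ?thesis using that k by (metis One_nat_def Suc_leI le_neq_implies_less numeral_2_eq_2)
    qed
    then show ?thesis
    proof cases
      case 1
      have "KA L j = 0 \<and> KB L j = 0" if "j < h" for j
      proof -
        have "KA L j + KB L j = 0" "KA L j - KB L j = 0" using K0[OF that] K1[OF that] 1 kz by auto
        then show ?thesis by (rule add_diff_zero)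
      qed
      moreover have "?P \<noteq> 0 \<or> ?Q \<noteq> 0"
      proof (rule ccontr)
        assume "\<not> ?thesis"
        then have "?P = 0" "?Q = 0" by auto
        then have "v0^k = 0 \<and> v1^k = 0" by (rule add_diff_zero)
        then show False using vsum by simp
      qed
      ultimately show ?thesis using pencil_functional_zero[of ?P ?Q L i] R2L R3L i by blast
    next
      case 2
      have "rr1 k v0 v1 \<noteq> 0"
      proof (cases "k = 2")
        case True
        then show ?thesis using 2 by (simp add: rr1_def)
      next
        case False
        then have z: "v1^(k-2) = 0" using 2 by simp
        show ?thesis unfolding rr1_def z using 2 by simp
      qed
      then have "\<forall>\<^sub>F n in sequentially. \<beta>1 (s n) \<noteq> 0"
        using tendsto_imp_eventually_ne[OF lim_rr(3)] enz by (simp add: \<beta>1_def)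
      then obtain \<mu> \<nu> where \<mu>\<nu>: "\<mu> \<noteq> 0 \<or> \<nu> \<noteq> 0" "\<forall>j<h. \<mu> * (KA L j - KB L j) + \<nu> * KG L j = 0"
        using direction[of "\<lambda>n j. KA (\<zeta> (s n)) j - KB (\<zeta> (s n)) j" "\<lambda>j. KA L j - KB L j" "\<lambda>n. \<alpha>1 (s n)" "\<lambda>n. \<beta>1 (s n)",
          OF tendsto_diff[OF limK(1) limK(2)] dir1 rel1] by blast
      \<comment> \<open>The derivative that survives in the limit ties \<open>KA\<close> to
        \<open>KB\<close>, which leaves a direction relation in \<open>KB\<close> and
        \<open>KG\<close> alone.\<close>
      have AB: "KA L j = - KB L j" if "j < h" for j using K0[OF that] 2 kz by (simp add: eq_neg_iff_add_eq_0)
      have D: "(-2 * \<mu>) * KB L j + \<nu> * KG L j = 0" if "j < h" for j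
      proof -
        have "\<mu> * (KA L j - KB L j) + \<nu> * KG L j = 0" using \<mu>\<nu>(2) that by blast
        then show ?thesis unfolding AB[OF that] by (simp add: algebra_simps)
      qed
      have vk: "v0^k \<noteq> 0" "v1^k = 0" using 2 by auto
      \<comment> \<open>Here \<open>?P\<close> and \<open>?Q\<close> both equal v0^k, which cancels
        and leaves t = 1; at the other point \<open>?Q\<close> is minus \<open>?P\<close>, hence t =
        -1 there.\<close>
      have r2: "R2 1 1 L j = 0" and r3: "R3 1 1 1 L j = 0" if "j \<le> h" for j
      proof -
        have "v0^k * R2 1 1 L j = R2 ?P ?Q L j" "v0^k * R3 1 1 1 L j = R3 ?P ?Q ?Q L j"
          unfolding vk(2) R2_def R3_def by (simp_all add: algebra_simps)
        then show "R2 1 1 L j = 0" "R3 1 1 1 L j = 0" using R2L[OF that] R3L[OF that] vk(1) by auto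
      qed
      show ?thesis
        by (rule all_directions_functional_zero[of 1 "-2 * \<mu>" \<nu> L i]) (use \<mu>\<nu>(1) r2 r3 D i in auto)
    next
      case 3
      have "rr0 k v0 v1 \<noteq> 0"
      proof (cases "k = 2")
        case True
        then show ?thesis using 3 by (simp add: rr0_def)
      next
        case False
        then have z: "v0^(k-2) = 0" using 3 by simp
        show ?thesis unfolding rr0_def z using 3 by simp
      qed
      then have "\<forall>\<^sub>F n in sequentially. \<beta>0 (s n) \<noteq> 0"
        using tendsto_imp_eventually_ne[OF lim_rr(2)] enz by (simp add: \<beta>0_def)
      then obtain \<mu> \<nu> where \<mu>\<nu>: "\<mu> \<noteq> 0 \<or> \<nu> \<noteq> 0" "\<forall>j<h. \<mu> * (KA L j + KB L j) + \<nu> * KG L j = 0"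
        using direction[of "\<lambda>n j. KA (\<zeta> (s n)) j + KB (\<zeta> (s n)) j" "\<lambda>j. KA L j + KB L j" "\<lambda>n. \<alpha>0 (s n)" "\<lambda>n. \<beta>0 (s n)",
          OF tendsto_add[OF limK(1) limK(2)] dir0 rel0] by blast
      have AB: "KA L j = KB L j" if "j < h" for j using K1[OF that] 3 kz by simp
      have D: "(2 * \<mu>) * KB L j + \<nu> * KG L j = 0" if "j < h" for j
      proof -
        have "\<mu> * (KA L j + KB L j) + \<nu> * KG L j = 0" using \<mu>\<nu>(2) that by blast
        then show ?thesis unfolding AB[OF that] by (simp add: algebra_simps)
      qed
      have vk: "v1^k \<noteq> 0" "v0^k = 0" using 3 by auto
      have r2: "R2 1 (-1) L j = 0" and r3: "R3 1 (-1) (-1) L j = 0" if "j \<le> h" for j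
      proof -
        have "v1^k * R2 1 (-1) L j = R2 ?P ?Q L j" "v1^k * R3 1 (-1) (-1) L j = R3 ?P ?Q ?Q L j"
          unfolding vk(2) R2_def R3_def by (simp_all add: algebra_simps)
        then show "R2 1 (-1) L j = 0" "R3 1 (-1) (-1) L j = 0" using R2L[OF that] R3L[OF that] vk(1) by auto
      qed
      show ?thesis
        by (rule all_directions_functional_zero[of "-1" "2 * \<mu>" \<nu> L i]) (use \<mu>\<nu>(1) r2 r3 D i in auto)
    qed
  qed
  then show False using Lsum by simp
qed

end

section \<open>Existence of a good polynomial\<close>

lemma xm_in_bihom: "u = int (a + b) \<Longrightarrow> v = int (c + e) \<Longrightarrow> xm a b c e \<in> bihom_part (u, v)"
  by (intro bihom_part_single) simp

lemma partial_xm: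
  "partial 0 (xm a b c e) = cst (of_nat a) * xm (a - 1) b c e"
  "partial 1 (xm a b c e) = cst (of_nat b) * xm a (b - 1) c e"
  "partial 2 (xm a b c e) = cst (of_nat c) * xm a b (c - 1) e"
  "partial 3 (xm a b c e) = cst (of_nat e) * xm a b c (e - 1)"
proof -
  have "mk a b c e - single 0 1 = mk (a - 1) b c e"
    "mk a b c e - single 1 1 = mk a (b - 1) c e"
    "mk a b c e - single 2 1 = mk a b (c - 1) e"
    "mk a b c e - single 3 1 = mk a b c (e - 1)"
    by (simp_all add: monom4_eq_iff lookup_minus lookup_single when_def)
  then show "partial 0 (xm a b c e) = cst (of_nat a) * xm (a - 1) b c e"
    "partial 1 (xm a b c e) = cst (of_nat b) * xm a (b - 1) c e"
    "partial 2 (xm a b c e) = cst (of_nat c) * xm a b (c - 1) e"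
    "partial 3 (xm a b c e) = cst (of_nat e) * xm a b c (e - 1)"
    by (simp_all only: partial_single mult_single lookup_mk add_0_left mult_1_right)
qed

lemma Mon_cases:
  assumes "m \<in> Mon u v"
  obtains a b c e where "m = mk a b c e" "int (a + b) = u" "int (c + e) = v"
  using assms that[of "lk m 0" "lk m 1" "lk m 2" "lk m 3"] by (simp add: Mon_def bideg_def)

text \<open>The linear form in x_0, x_1 that vanishes at the point \<open>v\<close>.\<close>

definition lin :: "complex \<times> complex \<Rightarrow> S" where
  "lin v = cst (snd v) * X 0 - cst (fst v) * X 1"

lemma lin_in_bihom: "lin v \<in> bihom_part (1, 0)"
  unfolding lin_def X_eq_xm by (intro bihom_part_diff bihom_part_cst_mult xm_in_bihom) simp_all

text \<open>The sum is the homogenisation of \<open>p\<close> in degree \<open>n\<close>. A root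
  \<open>a\<close> splits off x_1 - a x_0, and each missing degree splits off x_0. The pair (0,0)
  has to be excluded because its linear form is 0.\<close>

lemma binary_form_factors:
  fixes p :: "complex poly"
  assumes "p \<noteq> 0" "degree p \<le> n"
  shows "\<exists>c vs. c \<noteq> 0 \<and> length vs = n \<and> (0, 0) \<notin> set vs \<and>
    (\<Sum>i\<le>n. cst (coeff p i) * (X 0 ^ (n - i) * X 1 ^ i)) = cst c * prod_list (map lin vs)"
  using assms
proof (induction n arbitrary: p)
  case 0
  then have "coeff p 0 \<noteq> 0" by (metis le_zero_eq leading_coeff_0_iff)
  then show ?case by (intro exI[of _ "coeff p 0"] exI[of _ "[]"]) simp
next
  case (Suc n)
  show ?case
  proof (cases "degree p \<le> n")
    case True
    then obtain c vs where c: "c \<noteq> 0" "length vs = n" "(0, 0) \<notin> set vs"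
      "(\<Sum>i\<le>n. cst (coeff p i) * (X 0 ^ (n - i) * X 1 ^ i)) = cst c * prod_list (map lin vs)"
      using Suc by blast
    have "(\<Sum>i\<le>Suc n. cst (coeff p i) * (X 0 ^ (Suc n - i) * X 1 ^ i))
      = (\<Sum>i\<le>n. cst (coeff p i) * (X 0 ^ (Suc n - i) * X 1 ^ i))"
      using True by (simp add: coeff_eq_0)
    also have "\<dots> = X 0 * (\<Sum>i\<le>n. cst (coeff p i) * (X 0 ^ (n - i) * X 1 ^ i))"
      unfolding sum_distrib_left by (rule sum.cong) (auto simp: Suc_diff_le mult_ac)
    also have "\<dots> = cst c * prod_list (map lin ((0, 1) # vs))"
      unfolding c(4) by (simp add: lin_def mult_ac)
    finally show ?thesis using c by (intro exI[of _ c] exI[of _ "(0, 1) # vs"]) simp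
  next
    case False
    then have deg: "degree p = Suc n" using Suc.prems(2) by simp
    then have "\<not> constant (poly p)" by (simp add: constant_degree)
    then obtain a where "poly p a = 0" using fundamental_theorem_of_algebra by blast
    then have "[:-a, 1:] dvd p" by (simp only: poly_eq_0_iff_dvd)
    then obtain q where q: "p = [:-a, 1:] * q" by (rule dvdE)
    have "q \<noteq> 0" using q Suc.prems(1) by auto
    then have "degree q = n" using deg q degree_mult_eq[of "[:-a, 1:]" q] by simp
    then obtain c vs where c: "c \<noteq> 0" "length vs = n" "(0, 0) \<notin> set vs"
      "(\<Sum>i\<le>n. cst (coeff q i) * (X 0 ^ (n - i) * X 1 ^ i)) = cst c * prod_list (map lin vs)"
      using Suc.IH[of q] \<open>q \<noteq> 0\<close> by auto
    let ?H = "\<Sum>i\<le>n. cst (coeff q i) * (X 0 ^ (n - i) * X 1 ^ i)"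
    have coeff_p: "coeff p i = (case i of 0 \<Rightarrow> 0 | Suc j \<Rightarrow> coeff q j) - a * coeff q i" for i
      unfolding q by (cases i) (simp_all add: mult_pCons_left)
    have "(\<Sum>i\<le>Suc n. cst (coeff p i) * (X 0 ^ (Suc n - i) * X 1 ^ i))
      = (\<Sum>i\<le>Suc n. cst (case i of 0 \<Rightarrow> 0 | Suc j \<Rightarrow> coeff q j) * (X 0 ^ (Suc n - i) * X 1 ^ i))
        - (\<Sum>i\<le>Suc n. cst (a * coeff q i) * (X 0 ^ (Suc n - i) * X 1 ^ i))"
      unfolding coeff_p by (simp only: single_diff left_diff_distrib sum_subtractf)
    also have "(\<Sum>i\<le>Suc n. cst (case i of 0 \<Rightarrow> 0 | Suc j \<Rightarrow> coeff q j) * (X 0 ^ (Suc n - i) * X 1 ^ i))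
      = X 1 * ?H"
      unfolding sum.atMost_Suc_shift sum_distrib_left by (simp add: mult_ac)
    also have "(\<Sum>i\<le>Suc n. cst (a * coeff q i) * (X 0 ^ (Suc n - i) * X 1 ^ i))
      = (\<Sum>i\<le>n. cst (a * coeff q i) * (X 0 ^ (Suc n - i) * X 1 ^ i))"
      using \<open>degree q = n\<close> by (simp add: coeff_eq_0)
    also have "\<dots> = cst a * X 0 * ?H"
      unfolding sum_distrib_left
    proof (rule sum.cong[OF refl])
      fix i assume "i \<in> {..n}"
      then have "Suc n - i = Suc (n - i)" by auto
      then show "cst (a * coeff q i) * (X 0 ^ (Suc n - i) * X 1 ^ i) = cst a * X 0 * (cst (coeff q i) * (X 0 ^ (n - i) * X 1 ^ i))"
        by (simp only: power_Suc cst_mult_eq_iff[symmetric] mult_ac)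
    qed
    also have "X 1 * ?H - cst a * X 0 * ?H = lin (-1, -a) * ?H"
      by (simp add: lin_def algebra_simps single_uminus)
    also have "\<dots> = cst c * prod_list (map lin ((-1, -a) # vs))"
      unfolding c(4) by (simp add: mult_ac)
    finally show ?thesis using c by (intro exI[of _ c] exI[of _ "(-1, -a) # vs"]) simp
  qed
qed

text \<open>The assumption \<open>fib\<close> says that J_f fills the piece of bidegree (u,v) on the
  fibre over \<open>w\<close>; equivalently, multiplication by \<open>lin w\<close> is onto in S/J_f
  there.\<close>

locale fibrewise =
  fixes k v :: int and kl :: "int \<times> int" and f :: S
  assumes f: "f \<in> bihom_part kl" and k: "k \<ge> 1" and v: "v \<ge> 0"
    and fib: "\<And>w u p. w \<noteq> (0, 0) \<Longrightarrow> u \<ge> k \<Longrightarrow> p \<in> bihom_part (u, v) \<Longrightarrow> \<exists>q. p - lin w * q \<in> jacobian_ideal f"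
begin

lemma fib_bihom:
  assumes "w \<noteq> (0, 0)" "u \<ge> k" "p \<in> bihom_part (u, v)"
  shows "\<exists>q\<in>bihom_part (u - 1, v). p - lin w * q \<in> jacobian_ideal f"
proof -
  obtain q where q: "p - lin w * q \<in> jacobian_ideal f" using fib[OF assms] by blast
  have "bicomp (u, v) (p - q * lin w) = p - bicomp ((u, v) - (1, 0)) q * lin w"
    by (simp only: bicomp_diff bicomp_id[OF assms(3)] bicomp_mult[OF lin_in_bihom])
  then have "p - lin w * bicomp (u - 1, v) q \<in> jacobian_ideal f"
    using jacobian_bicomp[OF f q, of "(u, v)"] by (simp add: mult.commute)
  then show ?thesis using bicomp_in by blast
qed

lemma fib_list:
  assumes "(0, 0) \<notin> set ws" "p \<in> bihom_part (k - 1 + int (length ws), v)"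
  shows "\<exists>q\<in>bihom_part (k - 1, v). p - prod_list (map lin ws) * q \<in> jacobian_ideal f"
  using assms
proof (induction ws arbitrary: p)
  case Nil
  then show ?case by (intro bexI[of _ p]) auto
next
  case (Cons w ws)
  obtain q where q: "q \<in> bihom_part (k - 1 + int (length (w # ws)) - 1, v)" "p - lin w * q \<in> jacobian_ideal f"
    using fib_bihom[OF _ _ Cons.prems(2), of w] Cons.prems(1) by auto
  have "k - 1 + int (length (w # ws)) - 1 = k - 1 + int (length ws)" by simp
  with q(1) have "q \<in> bihom_part (k - 1 + int (length ws), v)" by (simp only:)
  then obtain q' where q': "q' \<in> bihom_part (k - 1, v)" "q - prod_list (map lin ws) * q' \<in> jacobian_ideal f"
    using Cons.IH[of q] Cons.prems(1) by auto
  have "p - prod_list (map lin (w # ws)) * q' = (p - lin w * q) + lin w * (q - prod_list (map lin ws) * q')"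
    by (simp add: algebra_simps)
  also have "\<dots> \<in> jacobian_ideal f"
    by (intro jacobian_ideal_add q(2) jacobian_ideal_mult q'(2))
  finally show ?case using q'(1) by blast
qed

text \<open>Modulo $J_f$ the products of \<open>mon m\<close> with the monomials of degree \<open>n\<close> in $x_0, x_1$ lie in
  the image of $x_0^n S_{(k-1,v)}$. For $n = \dim S_{(k-1,v)}$ they are linearly dependent, and a dependency is a binary
  form, hence a product of linear forms.\<close>

lemma annihilating_form:
  assumes m: "m \<in> Mon (k - 1) v"
  shows "\<exists>ws. (0, 0) \<notin> set ws \<and> prod_list (map lin ws) * mon m \<in> jacobian_ideal f"
proof -
  define n where "n = card (Mon (k - 1) v)"
  let ?ws = "replicate n (0 :: complex, 1 :: complex)"
  have prod_ws: "prod_list (map lin ?ws) = X 0 ^ n"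
    by (induction n) (simp_all add: lin_def)
  have "\<exists>q\<in>bihom_part (k - 1, v). X 0 ^ (n - i) * X 1 ^ i * mon m - X 0 ^ n * q \<in> jacobian_ideal f" if "i \<le> n" for i
  proof -
    have "X 0 ^ (n - i) * X 1 ^ i * mon m \<in> bihom_part (k - 1 + int (length ?ws), v)"
      unfolding X_power mult_single using m that
      by (intro bihom_part_single) (simp add: Mon_def bideg_add, simp add: bideg_def lookup_single when_def)
    from fib_list[OF _ this] show ?thesis unfolding prod_ws by auto
  qed
  then have "\<forall>i\<in>{..n}. \<exists>q. q \<in> bihom_part (k - 1, v) \<and> X 0 ^ (n - i) * X 1 ^ i * mon m - X 0 ^ n * q \<in> jacobian_ideal f"
    by blast
  from bchoice[OF this] obtain q where q: "\<And>i. i \<le> n \<Longrightarrow> q i \<in> bihom_part (k - 1, v)"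
    "\<And>i. i \<le> n \<Longrightarrow> X 0 ^ (n - i) * X 1 ^ i * mon m - X 0 ^ n * q i \<in> jacobian_ideal f" by auto
  obtain x where x: "\<exists>i\<in>{..n}. x i \<noteq> 0" "\<And>c. c \<in> {()} \<Longrightarrow> (\<Sum>i\<in>{..n}. cst (x i) * q i) = 0"
    using bihom_underdetermined[of "{..n}" "{()}" "\<lambda>i _. q i" "\<lambda>_. (k - 1, v)"] q(1) by (auto simp: n_def)
  define p where "p = (\<Sum>i\<le>n. Polynomial.monom (x i) i)"
  have coeff_p: "coeff p i = (if i \<le> n then x i else 0)" for i
    by (simp add: p_def coeff_sum)
  have "p \<noteq> 0" using x(1) coeff_p by (metis atMost_iff coeff_0)
  have "degree p \<le> n" by (rule degree_le) (simp add: coeff_p)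
  obtain c ws where c: "c \<noteq> 0" "length ws = n" "(0, 0) \<notin> set ws"
    "(\<Sum>i\<le>n. cst (coeff p i) * (X 0 ^ (n - i) * X 1 ^ i)) = cst c * prod_list (map lin ws)"
    using binary_form_factors[OF \<open>p \<noteq> 0\<close> \<open>degree p \<le> n\<close>] by blast
  have "cst c * prod_list (map lin ws) * mon m = (\<Sum>i\<le>n. cst (x i) * (X 0 ^ (n - i) * X 1 ^ i * mon m))"
    unfolding c(4)[symmetric] sum_distrib_right by (rule sum.cong) (simp_all add: coeff_p mult.assoc)
  also have "\<dots> = (\<Sum>i\<le>n. cst (x i) * (X 0 ^ (n - i) * X 1 ^ i * mon m - X 0 ^ n * q i)) + X 0 ^ n * (\<Sum>i\<le>n. cst (x i) * q i)"
    by (simp add: right_diff_distrib sum_subtractf sum_distrib_left mult.left_commute)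
  also have "\<dots> \<in> jacobian_ideal f"
    unfolding x(2)[OF singletonI] by (auto intro!: jacobian_ideal_sum jacobian_ideal_mult q(2))
  finally have "cst (1/c) * (cst c * prod_list (map lin ws) * mon m) \<in> jacobian_ideal f"
    by (rule jacobian_ideal_mult)
  then show ?thesis using c by (auto simp: mult.assoc[symmetric] mult_single)
qed

proposition contains_large:
  shows "\<exists>U. \<forall>u\<ge>U. bihom_part (u, v) \<subseteq> jacobian_ideal f"
proof -
  have "\<forall>m\<in>Mon (k - 1) v. \<exists>ws. (0, 0) \<notin> set ws \<and> prod_list (map lin ws) * mon m \<in> jacobian_ideal f"
    using annihilating_form by blast
  from bchoice[OF this] obtain W where W: "\<And>m. m \<in> Mon (k - 1) v \<Longrightarrow> (0, 0) \<notin> set (W m)"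
    "\<And>m. m \<in> Mon (k - 1) v \<Longrightarrow> prod_list (map lin (W m)) * mon m \<in> jacobian_ideal f" by auto
  obtain ms where ms: "set ms = Mon (k - 1) v" using finite_list[OF finite_Mon] by blast
  \<comment> \<open>One annihilating form for each monomial; their product annihilates the whole
    piece of bidegree (k-1,v) modulo J_f.\<close>
  define ws where "ws = concat (map W ms)"
  have ws: "(0, 0) \<notin> set ws" using W(1) ms by (auto simp: ws_def)
  have dvd: "prod_list (map lin (W m)) dvd prod_list (map lin ws)" if "m \<in> Mon (k - 1) v" for m
  proof -
    have "m \<in> set ms" using that ms by simp
    then obtain xs ys where "ms = xs @ m # ys" by (auto simp: in_set_conv_decomp)
    then show ?thesis by (simp add: ws_def)
  qed
  have kill: "csubspace {q. prod_list (map lin ws) * q \<in> jacobian_ideal f}"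
    unfolding csubspace_def
    by (auto simp: distrib_left mult.left_commute[of _ "cst _"] intro: jacobian_ideal_add jacobian_ideal_mult)
  have "bihom_part (k - 1, v) \<subseteq> {q. prod_list (map lin ws) * q \<in> jacobian_ideal f}"
  proof (rule bihom_part_subset_of_mons[OF kill], rule CollectI)
    fix m assume m: "m \<in> Mon (k - 1) v"
    obtain r where "prod_list (map lin ws) = prod_list (map lin (W m)) * r" using dvd[OF m] by (rule dvdE)
    then have "prod_list (map lin ws) * mon m = r * (prod_list (map lin (W m)) * mon m)" by (simp only: mult_ac)
    then show "prod_list (map lin ws) * mon m \<in> jacobian_ideal f"
      by (simp only: jacobian_ideal_mult[OF W(2)[OF m]])
  qed
  then have base: "bihom_part (k - 1 + int (length ws), v) \<subseteq> jacobian_ideal f"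
  proof (intro subsetI)
    fix p assume "p \<in> bihom_part (k - 1 + int (length ws), v)"
    then obtain q where q: "q \<in> bihom_part (k - 1, v)" "p - prod_list (map lin ws) * q \<in> jacobian_ideal f"
      using fib_list[OF ws] by blast
    assume sub: "bihom_part (k - 1, v) \<subseteq> {q. prod_list (map lin ws) * q \<in> jacobian_ideal f}"
    have "prod_list (map lin ws) * q \<in> jacobian_ideal f" using sub q(1) by blast
    from jacobian_ideal_add[OF q(2) this] show "p \<in> jacobian_ideal f" by simp
  qed
  have "bihom_part (u, v) \<subseteq> jacobian_ideal f" if "u \<ge> k - 1 + int (length ws)" for u
    using that
  proof (induction u rule: int_ge_induct)
    case base
    show ?case by (rule \<open>bihom_part (k - 1 + int (length ws), v) \<subseteq> jacobian_ideal f\<close>)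
  next
    case (step u)
    show ?case
    proof (rule bihom_part_subset_of_mons[OF jacobian_ideal_subspace])
      fix m assume "m \<in> Mon (u + 1) v"
      then obtain a b c e where m: "m = mk a b c e" "int (a + b) = u + 1" "int (c + e) = v" by (rule Mon_cases)
      have "a > 0 \<or> b > 0" using m(2) step.hyps k by (cases a; cases b) auto
      then show "mon m \<in> jacobian_ideal f"
      proof
        assume "a > 0"
        then have "mon m = xm 1 0 0 0 * xm (a - 1) b c e" using m by (simp add: xm_mult)
        moreover have "xm (a - 1) b c e \<in> jacobian_ideal f"
          using step.IH m \<open>a > 0\<close> by (intro subsetD[OF step.IH] xm_in_bihom) auto
        ultimately show ?thesis by (simp only: jacobian_ideal_mult)
      next
        assume "b > 0"
        then have "mon m = xm 0 1 0 0 * xm a (b - 1) c e" using m by (simp add: xm_mult)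
        moreover have "xm a (b - 1) c e \<in> jacobian_ideal f"
          using step.IH m \<open>b > 0\<close> by (intro subsetD[OF step.IH] xm_in_bihom) auto
        ultimately show ?thesis by (simp only: jacobian_ideal_mult)
      qed
    qed
  qed
  then show ?thesis by blast
qed

end

text \<open>Modulo the form vanishing at \<open>w\<close> one has w_1 x_0 = w_0 x_1, so all
  monomials with the same part in x_2, x_3 are proportional to their values at \<open>w\<close>. The
  functional is evaluation at \<open>w\<close> followed by some \<xi>; the variable whose coordinate
  is nonzero serves as reference.\<close>

lemma linear_functional_on_fibre:
  assumes \<phi>: "\<And>p q. \<phi> (p + q) = \<phi> p + \<phi> q" "\<And>c p. \<phi> (cst c * p) = c * \<phi> p" "\<phi> 0 = (0::complex)"
    and w: "w0 \<noteq> 0 \<or> w1 \<noteq> 0" and kill: "\<And>q. \<phi> (lin (w0, w1) * q) = 0"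
  shows "\<exists>\<xi>. \<forall>a b c e. a + b = u \<longrightarrow> c + e = n \<longrightarrow> \<phi> (xm a b c e) = w0 ^ a * w1 ^ b * \<xi> c"
proof -
  have rel: "w1 * \<phi> (xm (a + 1) b c e) = w0 * \<phi> (xm a (b + 1) c e)" for a b c e
  proof -
    have "cst w1 * xm (a + 1) b c e = lin (w0, w1) * xm a b c e + cst w0 * xm a (b + 1) c e"
      by (simp add: lin_def X_eq_xm algebra_simps xm_mult)
    then have "\<phi> (cst w1 * xm (a + 1) b c e) = \<phi> (cst w0 * xm a (b + 1) c e)"
      unfolding \<phi>(1) by (simp only: \<phi>(1) kill add_0_left)
    then show ?thesis unfolding \<phi>(2) .
  qed
  show ?thesis
  proof (cases "w0 = 0")
    case False
    have pos: "w0 ^ b * \<phi> (xm a b c e) = w1 ^ b * \<phi> (xm (a + b) 0 c e)" for a b c e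
    proof (induction b arbitrary: a)
      case (Suc b)
      have "w0 ^ Suc b * \<phi> (xm a (Suc b) c e) = w0 ^ b * (w0 * \<phi> (xm a (b + 1) c e))" by (simp add: mult_ac)
      also have "\<dots> = w1 * (w0 ^ b * \<phi> (xm (a + 1) b c e))" unfolding rel[symmetric] by (simp only: mult_ac)
      also have "\<dots> = w1 * (w1 ^ b * \<phi> (xm (a + 1 + b) 0 c e))" unfolding Suc.IH ..
      finally show ?case by (simp add: mult_ac)
    qed simp
    have *: "\<phi> (xm a b c e) = w0 ^ a * w1 ^ b * (\<phi> (xm u 0 c (n - c)) / w0 ^ u)" if "a + b = u" "c + e = n" for a b c e
    proof -
      have "n - c = e" using that by simp
      then have "w0 ^ b * \<phi> (xm a b c e) = w1 ^ b * \<phi> (xm u 0 c (n - c))" using pos[of b a c e] that by simp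
      moreover have "w0 ^ u = w0 ^ a * w0 ^ b" using that by (simp add: power_add[symmetric])
      ultimately show ?thesis using False by (simp add: field_simps)
    qed
    show ?thesis
      by (rule exI[of _ "\<lambda>c. \<phi> (xm u 0 c (n - c)) / w0 ^ u"], intro allI impI, rule *)
  next
    case True
    then have w1: "w1 \<noteq> 0" using w by simp
    have z: "\<phi> (xm (a + 1) b c e) = 0" for a b c e using rel[of a b c e] True w1 by simp
    have *: "\<phi> (xm a b c e) = w0 ^ a * w1 ^ b * (\<phi> (xm 0 u c (n - c)) / w1 ^ u)" if "a + b = u" "c + e = n" for a b c e
    proof (cases a)
      case 0
      then show ?thesis using that w1 by auto
    next
      case (Suc a')
      then show ?thesis using z[of a'] True by simp
    qed
    show ?thesis
      by (rule exI[of _ "\<lambda>c. \<phi> (xm 0 u c (n - c)) / w1 ^ u"], intro allI impI, rule *)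
  qed
qed

context pencil begin

text \<open>$x_0^k (A + B) + x_1^k (A - B) + \epsilon\, r\, G$.\<close>

definition fstar :: "nat \<Rightarrow> complex \<Rightarrow> S" where
  "fstar k \<epsilon> = xm k 0 l 0 + xm 0 k l 0 - xm k 0 h (h+1) - xm 0 k h (h+1)
     + (xm k 0 (h+1) h - xm 0 k (h+1) h + cst \<epsilon> * (xm (k-1) 1 (h+1) h + xm 1 (k-1) (h+1) h))
     + (xm k 0 0 l - xm 0 k 0 l)"

lemma fstar_in: "k \<ge> 1 \<Longrightarrow> fstar k \<epsilon> \<in> bihom_part (int k, int l)"
  unfolding fstar_def
  by (intro bihom_part_add bihom_part_diff bihom_part_cst_mult xm_in_bihom) auto

text \<open>Bridge from the ideal to the pencil: evaluating \<phi> on monomial multiples of the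
  partial derivatives gives the relations up to a factor that is nonzero at
  \<open>w\<close>.\<close>

lemma functional_fibre_relations:
  assumes k: "k \<ge> 1"
    and \<phi>: "\<And>p q. \<phi> (p + q) = \<phi> p + \<phi> q" "\<And>c p. \<phi> (cst c * p) = c * \<phi> p" "\<phi> 0 = (0::complex)"
    and kill: "\<And>s i. \<phi> (s * partial i (fstar k \<epsilon>)) = 0"
    and \<xi>: "\<And>a b c e. a + b = u + k \<Longrightarrow> c + e = 3*h \<Longrightarrow> \<phi> (xm a b c e) = w0 ^ a * w1 ^ b * \<xi> c"
    and w: "w0 \<noteq> 0 \<or> w1 \<noteq> 0"
  shows "fibre_relations k \<epsilon> w0 w1 \<xi>"
proof -
  obtain k' where k': "k = Suc k'" using k by (cases k) auto
  have \<phi>m: "\<phi> (p - q) = \<phi> p - \<phi> q" for p q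
    using \<phi>(1)[of "p - q" q] by simp
  have \<phi>c: "\<phi> (xm a b c e * (cst x * p)) = x * \<phi> (xm a b c e * p)" for a b c e x p
    using \<phi>(2)[of x "xm a b c e * p"] by (simp only: mult.left_commute)
  \<comment> \<open>A power of x_0 or x_1, whichever does not vanish at \<open>w\<close>. The
    multipliers of f_0 and f_1 have degree one more, since these derivatives have degree k-1 in x_0,
    x_1 instead of k.\<close>
  obtain a b where ab: "a + b = u" "w0 ^ a * w1 ^ b \<noteq> 0"
    using that[of u 0] that[of 0 u] w by auto
  obtain a' b' where ab': "a' + b' = u + 1" "w0 ^ a' * w1 ^ b' \<noteq> 0"
    using that[of "u + 1" 0] that[of 0 "u + 1"] w by auto
  obtain g where g: "h = Suc g" using h_pos by (cases h) auto
  let ?p = "w0^k + w1^k" and ?q = "w0^k - w1^k" and ?n = "w0^k - w1^k + \<epsilon> * rr k w0 w1"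
  have \<phi>u: "\<phi> (- p) = - \<phi> p" for p
    using \<phi>m[of 0 p] \<phi>(3) by simp
  note expand = \<phi>u partial_add partial_diff partial_xm partial_cst_mult distrib_left right_diff_distrib \<phi>(1) \<phi>m \<phi>c xm_mult
  have "R2 ?p ?n \<xi> j = 0 \<and> R3 ?p ?n ?q \<xi> j = 0" if j: "j \<le> h" for j
  proof -
    obtain i where i: "j + i = h" using j le_Suc_ex by blast
    have "\<phi> (xm a b j i * partial 2 (fstar k \<epsilon>)) = w0 ^ a * w1 ^ b * R2 ?p ?n \<xi> j"
      unfolding fstar_def R2_def rr_def using ab(1) i
      by (simp add: expand g k' \<xi>) (simp add: power_add algebra_simps)
    moreover have "\<phi> (xm a b j i * partial 3 (fstar k \<epsilon>)) = w0 ^ a * w1 ^ b * R3 ?p ?n ?q \<xi> j"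
      unfolding fstar_def R3_def rr_def using ab(1) i
      by (simp add: expand g k' \<xi>) (simp add: power_add algebra_simps)
    ultimately show ?thesis using ab(2) unfolding kill by (metis mult_eq_0_iff)
  qed
  moreover have "of_nat k * w0^(k-1) * (KA \<xi> j + KB \<xi> j) + \<epsilon> * rr0 k w0 w1 * KG \<xi> j = 0 \<and>
    of_nat k * w1^(k-1) * (KA \<xi> j - KB \<xi> j) + \<epsilon> * rr1 k w0 w1 * KG \<xi> j = 0" if j: "j < h" for j
  proof -
    obtain i where i: "j + i = g" using j g le_Suc_ex[of j g] by auto
    \<comment> \<open>The case k = 1 is computed separately because the exponent k-2
      truncates.\<close>
    have "\<phi> (xm a' b' j i * partial 0 (fstar k \<epsilon>))
      = w0 ^ a' * w1 ^ b' * (of_nat k * w0^(k-1) * (KA \<xi> j + KB \<xi> j) + \<epsilon> * rr0 k w0 w1 * KG \<xi> j)"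
      unfolding fstar_def KA_def KB_def KG_def rr0_def using ab'(1) i
      by (cases k'; simp add: expand g k' \<xi>; simp add: power_add algebra_simps)
    moreover have "\<phi> (xm a' b' j i * partial 1 (fstar k \<epsilon>))
      = w0 ^ a' * w1 ^ b' * (of_nat k * w1^(k-1) * (KA \<xi> j - KB \<xi> j) + \<epsilon> * rr1 k w0 w1 * KG \<xi> j)"
      unfolding fstar_def KA_def KB_def KG_def rr1_def using ab'(1) i
      by (cases k'; simp add: expand g k' \<xi>; simp add: power_add algebra_simps)
    ultimately show ?thesis using ab'(2) unfolding kill by (metis mult_eq_0_iff)
  qed
  ultimately show ?thesis unfolding fibre_relations_def by blast
qed

text \<open>If some monomial lay outside J_f + \<open>lin w\<close> S, a functional vanishing on
  this subspace would solve the fibre relations at \<open>w\<close> without being zero.\<close>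

lemma exists_odd:
  assumes k: "k \<ge> 1"
  shows "\<exists>f\<in>bihom_part (int k, int l). \<exists>U. \<forall>u\<ge>U. bihom_part (u, int (3*h)) \<subseteq> jacobian_ideal f"
proof -
  obtain \<epsilon> where \<epsilon>: "\<And>v0 v1 \<xi> i. v0 \<noteq> 0 \<or> v1 \<noteq> 0 \<Longrightarrow> fibre_relations k \<epsilon> v0 v1 \<xi> \<Longrightarrow> i \<le> 3*h \<Longrightarrow> \<xi> i = 0"
    using exists_good_parameter[OF k] by blast
  have "fibrewise (int k) (int (3*h)) (int k, int l) (fstar k \<epsilon>)"
  proof
    show "fstar k \<epsilon> \<in> bihom_part (int k, int l)" by (rule fstar_in[OF k])
    show "1 \<le> int k" "0 \<le> int (3*h)" using k by auto
    fix w :: "complex \<times> complex" and u p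
    assume w: "w \<noteq> (0, 0)" and u: "int k \<le> u" and p: "p \<in> bihom_part (u, int (3*h))"
    let ?J = "jacobian_ideal (fstar k \<epsilon>)"
    let ?W = "{p. \<exists>q. p - lin w * q \<in> ?J}"
    have W: "csubspace ?W"
      unfolding csubspace_def
    proof (intro conjI ballI allI)
      show "0 \<in> ?W" by (auto intro: exI[of _ 0])
      fix p q assume "p \<in> ?W" "q \<in> ?W"
      then obtain p' q' where "p - lin w * p' \<in> ?J" "q - lin w * q' \<in> ?J" by blast
      from jacobian_ideal_add[OF this] have "p + q - lin w * (p' + q') \<in> ?J" by (simp add: algebra_simps)
      then show "p + q \<in> ?W" by blast
    next
      fix c p assume "p \<in> ?W"
      then obtain p' where "p - lin w * p' \<in> ?J" by blast
      from jacobian_ideal_mult[OF this, of "cst c"] have "cst c * p - lin w * (cst c * p') \<in> ?J"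
        by (simp add: right_diff_distrib mult.left_commute)
      then show "cst c * p \<in> ?W" by blast
    qed
    have "mon m \<in> ?W" if m: "m \<in> Mon u (int (3*h))" for m
    proof (rule ccontr)
      assume "mon m \<notin> ?W"
      then obtain \<phi> :: "S \<Rightarrow> complex" where \<phi>: "\<And>p q. \<phi> (p + q) = \<phi> p + \<phi> q" "\<And>c p. \<phi> (cst c * p) = c * \<phi> p" "\<phi> 0 = 0"
        "\<And>p. p \<in> ?W \<Longrightarrow> \<phi> p = 0" "\<phi> (mon m) = 1"
        using separating_functional[OF W] by blast
      have killJ: "\<phi> (s * partial i (fstar k \<epsilon>)) = 0" for s i
        by (rule \<phi>(4), rule CollectI, rule exI[of _ 0]) (simp add: jacobian_ideal_partial)
      have killL: "\<phi> (lin (fst w, snd w) * q) = 0" for q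
        by (rule \<phi>(4), rule CollectI, rule exI[of _ q]) simp
      have w': "fst w \<noteq> 0 \<or> snd w \<noteq> 0" using w by (auto simp: prod_eq_iff)
      \<comment> \<open>The degree left for multipliers of f_2 and f_3, nonnegative because u \<ge>
        k; hence the threshold k in \<open>fibrewise\<close>.\<close>
      define u' where "u' = nat u - k"
      have u': "u = int (u' + k)" using u by (simp add: u'_def)
      obtain \<xi> where \<xi>: "\<And>a b c e. a + b = u' + k \<Longrightarrow> c + e = 3*h \<Longrightarrow> \<phi> (xm a b c e) = fst w ^ a * snd w ^ b * \<xi> c"
        using linear_functional_on_fibre[OF \<phi>(1-3) w' killL, of "u' + k" "3*h"] by blast
      have fibre_relations: "fibre_relations k \<epsilon> (fst w) (snd w) \<xi>"
        by (rule functional_fibre_relations[OF k \<phi>(1-3) killJ \<xi> w'])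
      obtain a b c e where abce: "m = mk a b c e" "int (a + b) = u" "int (c + e) = int (3*h)"
        using m by (rule Mon_cases)
      then have "\<phi> (mon m) = fst w ^ a * snd w ^ b * \<xi> c" using \<xi>[of a b c e] u' by simp
      moreover have "\<xi> c = 0" using \<epsilon>[OF w' fibre_relations, of c] abce(3) by simp
      ultimately show False using \<phi>(5) by simp
    qed
    from bihom_part_subset_of_mons[OF W this] p show "\<exists>q. p - lin w * q \<in> ?J" by blast
  qed
  then interpret fibrewise "int k" "int (3*h)" "(int k, int l)" "fstar k \<epsilon>" .
  show ?thesis using contains_large fstar_in[OF assms] by blast
qed

end

lemma jacobian_xm_mono:
  assumes "xm a b c e \<in> jacobian_ideal f" "a \<le> a'" "b \<le> b'" "c \<le> c'" "e \<le> e'"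
  shows "xm a' b' c' e' \<in> jacobian_ideal f"
proof -
  have "xm a' b' c' e' = xm (a' - a) (b' - b) (c' - c) (e' - e) * xm a b c e"
    using assms by (simp add: xm_mult)
  then show ?thesis using jacobian_ideal_mult[OF assms(1)] by simp
qed

text \<open>The form x_0^k (x_2^l + x_3^l) + x_1^k (x_2^l - x_3^l). It serves for even l, where only
  reducedness is claimed, and for l = 1, that is h = 0, which the pencil leaves out.\<close>

lemma exists_fermat_type:
  fixes k l :: nat
  assumes kl: "k \<ge> 1" "l \<ge> 1"
  shows "\<exists>f\<in>bihom_part (int k, int l). bihom_part (2 * int k, 3 * int l) \<subseteq> jacobian_ideal f \<and>
    (l = 1 \<longrightarrow> bihom_part (2 * int k, 0) \<subseteq> jacobian_ideal f)"
proof -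
  define f where "f = (xm k 0 l 0 + xm 0 k l 0) + (xm k 0 0 l - xm 0 k 0 l)"
  let ?J = "jacobian_ideal f"
  have f: "f \<in> bihom_part (int k, int l)"
    unfolding f_def by (intro bihom_part_add bihom_part_diff xm_in_bihom) auto
  have scale: "p \<in> ?J" if "cst c * p \<in> ?J" "c \<noteq> 0" for c p
    using jacobian_ideal_mult[OF that(1), of "cst (1/c)"] that(2) by (simp add: mult.assoc[symmetric])
  have knz: "of_nat k \<noteq> (0::complex)" "of_nat l \<noteq> (0::complex)" using kl by auto
  have F0: "xm (k-1) 0 l 0 + xm (k-1) 0 0 l \<in> ?J"
    by (rule scale[OF _ knz(1)], use jacobian_ideal_partial[of 1 0 f] kl in
      \<open>simp add: f_def partial_add partial_diff partial_xm distrib_left\<close>)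
  have F1: "xm 0 (k-1) l 0 - xm 0 (k-1) 0 l \<in> ?J"
    by (rule scale[OF _ knz(1)], use jacobian_ideal_partial[of 1 1 f] kl in
      \<open>simp add: f_def partial_add partial_diff partial_xm right_diff_distrib\<close>)
  have F2: "xm k 0 (l-1) 0 + xm 0 k (l-1) 0 \<in> ?J"
    by (rule scale[OF _ knz(2)], use jacobian_ideal_partial[of 1 2 f] kl in
      \<open>simp add: f_def partial_add partial_diff partial_xm distrib_left\<close>)
  have F3: "xm k 0 0 (l-1) - xm 0 k 0 (l-1) \<in> ?J"
    by (rule scale[OF _ knz(2)], use jacobian_ideal_partial[of 1 3 f] kl in
      \<open>simp add: f_def partial_add partial_diff partial_xm right_diff_distrib\<close>)
  \<comment> \<open>Two derivatives brought to a common monomial factor are a sum and a difference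
    of the same two monomials, so both monomials lie in J_f.\<close>
  have pm: "p \<in> ?J \<and> q \<in> ?J" if "p + q \<in> ?J" "p - q \<in> ?J" for p q
  proof -
    have m1: "cst (-1) * r = - r" for r :: S by (simp add: single_uminus)
    have two: "cst 2 * r = r + r" for r :: S
      unfolding single_numeral by (rule mult_2)
    have "cst 2 * p \<in> ?J" "cst 2 * q \<in> ?J"
      using jacobian_ideal_add[OF that] jacobian_ideal_add[OF that(1) jacobian_ideal_mult[OF that(2), of "cst (-1)"]]
      unfolding two m1 by simp_all
    then show ?thesis using scale[of 2] by simp
  qed
  have i: "xm (k-1) (k-1) l 0 \<in> ?J \<and> xm (k-1) (k-1) 0 l \<in> ?J"
    using jacobian_ideal_mult[OF F0, of "xm 0 (k-1) 0 0"] jacobian_ideal_mult[OF F1, of "xm (k-1) 0 0 0"]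
    by (intro pm) (simp_all add: xm_mult distrib_left right_diff_distrib)
  have ii: "xm k 0 (l-1) (l-1) \<in> ?J \<and> xm 0 k (l-1) (l-1) \<in> ?J"
    using jacobian_ideal_mult[OF F2, of "xm 0 0 0 (l-1)"] jacobian_ideal_mult[OF F3, of "xm 0 0 (l-1) 0"]
    by (intro pm) (simp_all add: xm_mult distrib_left right_diff_distrib)
  have mid: "xm a b c e \<in> ?J" if "a + b = 2 * k" "l - 1 \<le> c" "l - 1 \<le> e" for a b c e
  proof (cases "a \<ge> k")
    case True
    then show ?thesis using jacobian_xm_mono[OF conjunct1[OF ii]] that by simp
  next
    case False
    then show ?thesis using jacobian_xm_mono[OF conjunct2[OF ii]] that by simp
  qed
  have sw: "p \<in> ?J" if "p + q \<in> ?J" "q \<in> ?J" for p q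
    using pm[of "p + q" 0] jacobian_ideal_add[OF that(1) jacobian_ideal_mult[OF that(2), of "cst (-1)"]]
    by (simp add: single_uminus)
  have sw': "p \<in> ?J" if "p - q \<in> ?J" "q \<in> ?J" for p q
    using jacobian_ideal_add[OF that] by simp
  have sw'': "q \<in> ?J" if "p - q \<in> ?J" "p \<in> ?J" for p q
    using sw[of "- q" p] that jacobian_ideal_mult[of "- q" f "-1"] by simp
  have "xm a b c e \<in> ?J" if ab: "a + b = 2 * k" and ce: "c + e = 3 * l" for a b c e
  proof -
    \<comment> \<open>If one of c, e is below l - 1, the other exceeds 2l. As a or b is at least k -
      1, \<open>F0\<close> or \<open>F1\<close> trades x_2^l for x_3^l up to sign, and the new
      monomial is covered by \<open>mid\<close>.\<close>
    consider "l - 1 \<le> c \<and> l - 1 \<le> e" | "k - 1 \<le> a" "k - 1 \<le> b" "l \<le> c \<or> l \<le> e"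
      | "k - 1 \<le> a" "e < l - 1" | "k - 1 \<le> a" "c < l - 1" | "k - 1 \<le> b" "e < l - 1" | "k - 1 \<le> b" "c < l - 1"
      using ab ce by linarith
    then show ?thesis
    proof cases
      case 1
      then show ?thesis using mid[OF ab] by blast
    next
      case 2
      then show ?thesis using jacobian_xm_mono[OF conjunct1[OF i], of a b c e] jacobian_xm_mono[OF conjunct2[OF i], of a b c e] by auto
    next
      case 3
      have "xm a b c e + xm a b (c - l) (e + l) \<in> ?J"
        using jacobian_ideal_mult[OF F0, of "xm (a - (k-1)) b (c - l) e"] 3 ce by (simp add: xm_mult distrib_left)
      then show ?thesis by (rule sw) (rule mid[OF ab], use 3 ce in auto)
    next
      case 4
      have "xm a b (c + l) (e - l) + xm a b c e \<in> ?J"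
        using jacobian_ideal_mult[OF F0, of "xm (a - (k-1)) b c (e - l)"] 4 ce by (simp add: xm_mult distrib_left)
      then have "xm a b c e + xm a b (c + l) (e - l) \<in> ?J" by (simp only: add.commute)
      then show ?thesis by (rule sw) (rule mid[OF ab], use 4 ce in auto)
    next
      case 5
      have "xm a b c e - xm a b (c - l) (e + l) \<in> ?J"
        using jacobian_ideal_mult[OF F1, of "xm a (b - (k-1)) (c - l) e"] 5 ce by (simp add: xm_mult right_diff_distrib)
      then show ?thesis by (rule sw') (rule mid[OF ab], use 5 ce in auto)
    next
      case 6
      have "xm a b (c + l) (e - l) - xm a b c e \<in> ?J"
        using jacobian_ideal_mult[OF F1, of "xm a (b - (k-1)) c (e - l)"] 6 ce by (simp add: xm_mult right_diff_distrib)
      then show ?thesis by (rule sw'') (rule mid[OF ab], use 6 ce in auto)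
    qed
  qed
  then have "bihom_part (2 * int k, 3 * int l) \<subseteq> ?J"
    by (intro bihom_part_subset_of_mons[OF jacobian_ideal_subspace]) (auto elim!: Mon_cases)
  moreover have "bihom_part (2 * int k, 0) \<subseteq> ?J" if "l = 1"
    using mid that by (intro bihom_part_subset_of_mons[OF jacobian_ideal_subspace]) (auto elim!: Mon_cases)
  ultimately show ?thesis using f by blast
qed

section \<open>Reducedness\<close>

type_synonym poly4 = "complex poly poly poly poly"

definition const4 :: "complex \<Rightarrow> poly4" where "const4 z = [:[:[:[:z:]:]:]:]"

definition var4 :: "4 \<Rightarrow> poly4" where
  "var4 i = (if i = 0 then [:[:[:[:0, 1:]:]:]:] else if i = 1 then [:[:[:0, 1:]:]:]
     else if i = 2 then [:[:0, 1:]:] else [:0, 1:])"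

interpretation to4: coeff_hom const4
  by unfold_locales (simp_all add: const4_def one_pCons)

abbreviation to4 :: "S \<Rightarrow> poly4" where "to4 \<equiv> to4.ins var4"

text \<open>Extends a ring homomorphism on coefficients by sending the variable to \<open>x\<close>.
  Four such extensions give the inverse of \<open>to4\<close>.\<close>

definition lift_poly :: "('a::comm_ring_1 \<Rightarrow> S) \<Rightarrow> S \<Rightarrow> 'a poly \<Rightarrow> S" where
  "lift_poly \<theta> x p = poly (map_poly \<theta> p) x"

definition ring_hom_S :: "('a::comm_ring_1 \<Rightarrow> S) \<Rightarrow> bool" where
  "ring_hom_S \<theta> \<longleftrightarrow> \<theta> 0 = 0 \<and> \<theta> 1 = 1 \<and> (\<forall>x y. \<theta> (x + y) = \<theta> x + \<theta> y) \<and> (\<forall>x y. \<theta> (x * y) = \<theta> x * \<theta> y)"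

lemma lift_poly_0: "lift_poly \<theta> x 0 = 0"
  by (simp add: lift_poly_def)

lemma lift_poly_pCons: "ring_hom_S \<theta> \<Longrightarrow> lift_poly \<theta> x (pCons a p) = \<theta> a + x * lift_poly \<theta> x p"
  by (simp add: lift_poly_def ring_hom_S_def map_poly_pCons)

lemma ring_hom_lift_poly:
  assumes \<theta>: "ring_hom_S \<theta>"
  shows "ring_hom_S (lift_poly \<theta> x)"
proof -
  note pC = lift_poly_pCons[OF \<theta>]
  have z: "\<theta> 0 = 0" "\<theta> 1 = 1" "\<And>a b. \<theta> (a + b) = \<theta> a + \<theta> b" "\<And>a b. \<theta> (a * b) = \<theta> a * \<theta> b"
    using \<theta> by (auto simp: ring_hom_S_def)
  have add: "lift_poly \<theta> x (p + q) = lift_poly \<theta> x p + lift_poly \<theta> x q" for p q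
    by (induction p q rule: poly_induct2) (simp_all add: lift_poly_0 pC z algebra_simps)
  have smult: "lift_poly \<theta> x (smult a p) = \<theta> a * lift_poly \<theta> x p" for a p
    by (induction p) (simp_all add: lift_poly_0 pC z algebra_simps)
  have mult: "lift_poly \<theta> x (p * q) = lift_poly \<theta> x p * lift_poly \<theta> x q" for p q
    by (induction p) (simp_all add: lift_poly_0 pC z add smult algebra_simps)
  show ?thesis using add mult by (simp add: ring_hom_S_def lift_poly_0 one_pCons pC z)
qed

definition from4 :: "poly4 \<Rightarrow> S" where
  "from4 = lift_poly (lift_poly (lift_poly (lift_poly cst (X 0)) (X 1)) (X 2)) (X 3)"

lemma ring_hom_cst: "ring_hom_S cst"
  by (simp add: ring_hom_S_def single_add mult_single)

lemmas ring_hom_levels =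
  ring_hom_lift_poly[OF ring_hom_cst, of "X 0"]
  ring_hom_lift_poly[OF ring_hom_lift_poly[OF ring_hom_cst, of "X 0"], of "X 1"]
  ring_hom_lift_poly[OF ring_hom_lift_poly[OF ring_hom_lift_poly[OF ring_hom_cst, of "X 0"], of "X 1"], of "X 2"]

lemma ring_hom_from4: "ring_hom_S from4"
  unfolding from4_def by (intro ring_hom_lift_poly ring_hom_cst)

lemma ring_homD:
  assumes "ring_hom_S \<theta>"
  shows "\<theta> 0 = 0" "\<theta> 1 = 1" "\<theta> (a + b) = \<theta> a + \<theta> b" "\<theta> (a * b) = \<theta> a * \<theta> b"
  using assms by (simp_all add: ring_hom_S_def)

lemma from4_const: "from4 (const4 z) = cst z"
  by (simp add: from4_def const4_def lift_poly_pCons ring_hom_levels ring_hom_cst lift_poly_0)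

lemma from4_var: "from4 (var4 i) = X i"
proof -
  have "i \<in> {0,1,2,3}" using UNIV_4_from_0 by blast
  then show ?thesis
    by (auto simp: from4_def var4_def lift_poly_pCons ring_hom_levels ring_hom_cst lift_poly_0
        ring_homD(1,2)[OF ring_hom_cst] ring_homD(1,2)[OF ring_hom_levels(1)]
        ring_homD(1,2)[OF ring_hom_levels(2)] ring_homD(1,2)[OF ring_hom_levels(3)])
qed

lemma mon_eval_X: "mon_eval X m = mon m"
proof -
  have "mon_eval X m = (\<Prod>i\<in>UNIV. X i ^ lk m i)" by (rule mon_eval_superset) auto
  also have "\<dots> = xm (lk m 0) (lk m 1) (lk m 2) (lk m 3)"
    unfolding UNIV_4_from_0 X_power mk_def by (simp add: mult_single add_ac)
  finally show ?thesis by simp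
qed

lemma from4_to4: "from4 (to4 p) = p"
proof (induction p rule: poly_mapping_single_induct)
  case zero
  then show ?case by (simp add: ring_homD(1)[OF ring_hom_from4])
next
  case (single m c)
  note h = ring_homD[OF ring_hom_from4]
  have pow: "from4 (q ^ n) = from4 q ^ n" for q n by (induction n) (simp_all add: h)
  have "from4 (\<Prod>i\<in>A. q i) = (\<Prod>i\<in>A. from4 (q i))" for q and A :: "4 set"
    by (induction A rule: infinite_finite_induct) (simp_all add: h)
  then have "from4 (mon_eval var4 m) = mon_eval X m"
    by (simp add: mon_eval_def pow from4_var)
  then show ?case by (simp add: h from4_const mon_eval_X mult_single)
next
  case (add p q)
  then show ?case by (simp add: to4.ins_add ring_homD[OF ring_hom_from4])
qed

lemma to4_inj: "to4 p = to4 q \<Longrightarrow> p = q"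
  by (metis from4_to4)

lemma to4_surj: "\<exists>p. q = to4 p"
proof -
  let ?R = "range to4"
  have add: "a \<in> ?R \<Longrightarrow> b \<in> ?R \<Longrightarrow> a + b \<in> ?R" and mult: "a \<in> ?R \<Longrightarrow> b \<in> ?R \<Longrightarrow> a * b \<in> ?R" for a b
    by (auto simp flip: to4.ins_add to4.ins_mult)
  have const: "[:[:[:[:z:]:]:]:] \<in> ?R" for z
    by (rule range_eqI[of _ _ "cst z"]) (simp add: const4_def)
  have zero: "0 \<in> ?R" using const[of 0] by simp
  have var: "var4 i \<in> ?R" for i
    by (rule range_eqI[of _ _ "X i"]) (simp add: X_def to4.\<kappa>_1)
  have l1: "[:[:[:p:]:]:] \<in> ?R" for p :: "complex poly"
  proof (induction p)
    case (pCons a p)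
    have "[:[:[:pCons a p:]:]:] = [:[:[:[:a:]:]:]:] + var4 0 * [:[:[:p:]:]:]"
      by (simp add: var4_def)
    then show ?case using add[OF const mult[OF var pCons.IH]] by simp
  qed (simp add: zero)
  have l2: "[:[:p:]:] \<in> ?R" for p :: "complex poly poly"
  proof (induction p)
    case (pCons a p)
    have "[:[:pCons a p:]:] = [:[:[:a:]:]:] + var4 1 * [:[:p:]:]"
      by (simp add: var4_def)
    then show ?case using add[OF l1 mult[OF var pCons.IH]] by simp
  qed (simp add: zero)
  have l3: "[:p:] \<in> ?R" for p :: "complex poly poly poly"
  proof (induction p)
    case (pCons a p)
    have "[:pCons a p:] = [:[:a:]:] + var4 2 * [:p:]"
      by (simp add: var4_def)
    then show ?case using add[OF l2 mult[OF var pCons.IH]] by simp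
  qed (simp add: zero)
  have "q \<in> ?R"
  proof (induction q)
    case (pCons a p)
    have "pCons a p = [:a:] + var4 3 * p"
      by (simp add: var4_def)
    then show ?case using add[OF l3 mult[OF var pCons.IH]] by simp
  qed (simp add: zero)
  then show ?thesis by blast
qed

section \<open>Squarefreeness and reducedness\<close>

lemma squarefree_dvd_power_imp_dvd:
  fixes a b :: "'a::factorial_semiring"
  assumes a: "squarefree a" and dvd: "a dvd b ^ n"
  shows "a dvd b"
proof (cases "b = 0")
  case False
  have a0: "a \<noteq> 0" using a by auto
  show ?thesis
  proof (rule multiplicity_le_imp_dvd[OF a0])
    fix p :: 'a assume p: "prime p"
    show "multiplicity p a \<le> multiplicity p b"
    proof (cases "p dvd a")
      case True
      then have "p dvd b" using dvd p by (meson dvd_trans prime_dvd_power)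
      then have "multiplicity p b \<ge> 1" using False p by (simp add: prime_multiplicity_gt_zero_iff Suc_le_eq prime_imp_prime_elem)
      moreover have "multiplicity p a \<le> 1" using a p squarefree_factorial_semiring''[OF a0] by blast
      ultimately show ?thesis by simp
    qed (simp add: not_dvd_imp_multiplicity_0)
  qed
qed simp

lemma squarefree_of_jacobian:
  assumes uv: "u \<ge> 0" "v \<ge> 0" "bihom_part (u, v) \<subseteq> jacobian_ideal f"
  shows "squarefree (to4 f)"
proof (rule squarefreeI)
  fix x assume "x\<^sup>2 dvd to4 f"
  then obtain y where y: "to4 f = x\<^sup>2 * y" by (rule dvdE)
  obtain b c where xy: "x = to4 b" "y = to4 c" using to4_surj by metis
  then have f: "f = b * (b * c)"
    using y by (intro to4_inj) (simp add: to4.ins_mult power2_eq_square mult.assoc)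
  have "b dvd partial i f" for i
    unfolding f partial_mult[of i b] partial_mult[of i b c] by (intro dvd_add dvd_triv_left dvd_mult)
  then have J: "b dvd s" if "s \<in> jacobian_ideal f" for s
    using that unfolding jacobian_ideal_iff by (auto intro!: dvd_sum dvd_mult)
  have "xm (nat u) 0 (nat v) 0 \<in> jacobian_ideal f" "xm 0 (nat u) 0 (nat v) \<in> jacobian_ideal f"
    using uv(1,2) by (auto intro!: subsetD[OF uv(3)] xm_in_bihom)
  then have "b dvd xm (nat u) 0 (nat v) 0" "b dvd xm 0 (nat u) 0 (nat v)"
    using J by blast+
  then have "b dvd 1"
  proof (rule unit_of_dvd_coprime_mons)
    have "\<forall>i. lk (mk (nat u) 0 (nat v) 0) i = 0 \<or> lk (mk 0 (nat u) 0 (nat v)) i = 0"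
      by (simp add: all_4)
    then show "lk (mk (nat u) 0 (nat v) 0) i = 0 \<or> lk (mk 0 (nat u) 0 (nat v)) i = 0" for i by (rule spec)
  qed
  then obtain e where "1 = b * e" by (rule dvdE)
  then have "1 = x * to4 e" unfolding xy by (metis to4.ins_1 to4.ins_mult)
  then show "x dvd 1" by (rule dvdI)
qed

proposition reduced_of_jacobian:
  assumes uv: "u \<ge> 0" "v \<ge> 0" "bihom_part (u, v) \<subseteq> jacobian_ideal f"
  shows "reduced_scheme f"
  unfolding reduced_scheme_def
proof (intro allI ballI impI)
  fix i :: 4 and e n :: nat and g
  assume "\<exists>p. f dvd X i ^ p * g ^ n"
  then obtain p where "f dvd X i ^ p * g ^ n" by blast
  \<comment> \<open>Padding both factors to exponent p + n produces a power of x_i g, to which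
    squarefreeness applies; the exponent 1 then works as \<open>q\<close>.\<close>
  then have "f dvd X i ^ p * g ^ n * (X i ^ n * g ^ p)" by (rule dvd_mult2)
  also have "X i ^ p * g ^ n * (X i ^ n * g ^ p) = (X i ^ 1 * g) ^ (p + n)"
    by (simp add: power_add power_mult_distrib mult_ac)
  finally obtain w where "(X i ^ 1 * g) ^ (p + n) = f * w" by (rule dvdE)
  then have "to4 (X i ^ 1 * g) ^ (p + n) = to4 f * to4 w" by (metis to4.ins_mult to4.ins_power)
  then have "to4 f dvd to4 (X i ^ 1 * g) ^ (p + n)" by (rule dvdI)
  then have "to4 f dvd to4 (X i ^ 1 * g)"
    by (rule squarefree_dvd_power_imp_dvd[OF squarefree_of_jacobian[OF uv]])
  then obtain y where y: "to4 (X i ^ 1 * g) = to4 f * y" by (rule dvdE)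
  obtain c where "y = to4 c" using to4_surj by metis
  then have "X i ^ 1 * g = f * c" using y by (intro to4_inj) (simp only: to4.ins_mult)
  then have "f dvd X i ^ 1 * g" by (rule dvdI)
  then show "\<exists>q. f dvd X i ^ q * g" by blast
qed

lemma nonzero_of_jacobian:
  assumes uv: "u \<ge> 0" "v \<ge> 0" "bihom_part (u, v) \<subseteq> jacobian_ideal f"
  shows "f \<noteq> 0"
  using squarefree_of_jacobian[OF uv] by auto

section \<open>Finite generation of graded submodules\<close>

lemma nat_seq_mono_subseq:
  fixes s :: "nat \<Rightarrow> nat"
  shows "\<exists>g :: nat \<Rightarrow> nat. strict_mono g \<and> mono (\<lambda>n. s (g n))"
proof -
  obtain f where f: "strict_mono f" "monoseq (\<lambda>n. s (f n))"
    using seq_monosub[of s] by (auto simp: o_def)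
  show ?thesis
  proof (cases "incseq (\<lambda>n. s (f n))")
    case True
    then show ?thesis using f(1) by blast
  next
    case False
    then have dec: "decseq (\<lambda>n. s (f n))" using f(2) by (simp add: monoseq_iff)
    \<comment> \<open>A decreasing sequence of naturals is constant from the place of its minimum
      on, hence increasing there.\<close>
    define N where "N = (ARG_MIN (\<lambda>n. s (f n)) n. True)"
    have N: "s (f N) \<le> s (f n)" for n
      unfolding N_def by (rule arg_min_nat_le) simp
    have "s (f (N + n)) = s (f N)" for n
      using N[of "N + n"] decseqD[OF dec, of N "N + n"] by simp
    then have "mono (\<lambda>n. s (f (N + n)))" by (simp add: mono_def)
    moreover have "strict_mono (\<lambda>n. f (N + n))"
      using f(1) by (simp add: strict_mono_def)
    ultimately show ?thesis by blast
  qed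
qed

definition mon_le :: "monom4 \<Rightarrow> monom4 \<Rightarrow> bool" where
  "mon_le m n \<longleftrightarrow> (\<forall>i. lk m i \<le> lk n i)"

text \<open>Subsequences are refined one coordinate at a time until all four exponents
  increase.\<close>

lemma mon_le_wqo:
  fixes s :: "nat \<Rightarrow> monom4"
  shows "\<exists>i j. i < j \<and> mon_le (s i) (s j)"
proof -
  have "\<exists>g :: nat \<Rightarrow> nat. strict_mono g \<and> (\<forall>i\<in>A. mono (\<lambda>n. lk (s (g n)) i))" if "finite A" for A
    using that
  proof (induction A rule: finite_induct)
    case empty
    show ?case by (intro exI[of _ id]) (simp add: strict_mono_def)
  next
    case (insert i A)
    then obtain g :: "nat \<Rightarrow> nat" where g: "strict_mono g" "\<forall>i\<in>A. mono (\<lambda>n. lk (s (g n)) i)" by blast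
    obtain g' :: "nat \<Rightarrow> nat" where g': "strict_mono g'" "mono (\<lambda>n. lk (s (g (g' n))) i)"
      using nat_seq_mono_subseq[of "\<lambda>n. lk (s (g n)) i"] by blast
    have "mono (\<lambda>n. lk (s (g (g' n))) i')" if "i' \<in> A" for i'
    proof -
      have "mono (\<lambda>n. lk (s (g n)) i')" using g(2) that by blast
      moreover have "mono g'" using g'(1) by (rule strict_mono_mono)
      ultimately show ?thesis unfolding mono_def by blast
    qed
    then show ?case using g' strict_mono_o[OF g(1) g'(1), unfolded o_def] by (intro exI[of _ "\<lambda>n. g (g' n)"]) auto
  qed
  from this[of UNIV] obtain g :: "nat \<Rightarrow> nat" where g: "strict_mono g" "\<And>i. mono (\<lambda>n. lk (s (g n)) i)" by auto
  have "mon_le (s (g 0)) (s (g 1))" unfolding mon_le_def using monoD[OF g(2), of 0 1] by simp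
  moreover have "g 0 < g 1" using g(1) by (simp add: strict_mono_def)
  ultimately show ?thesis by blast
qed

text \<open>Otherwise one could keep picking elements of \<open>L\<close> above none of the earlier
  ones, against \<open>mon_le_wqo\<close>.\<close>

lemma dickson: "\<exists>L0. finite L0 \<and> L0 \<subseteq> L \<and> (\<forall>m\<in>L. \<exists>m0\<in>L0. mon_le m0 m)"
proof (rule ccontr)
  assume none: "\<not> ?thesis"
  have ex: "\<exists>m. m \<in> L \<and> (\<forall>m0\<in>A. \<not> mon_le m0 m)" if "finite A" "A \<subseteq> L" for A
  proof (rule ccontr)
    assume "\<not> ?thesis"
    then have "\<forall>m\<in>L. \<exists>m0\<in>A. mon_le m0 m" by blast
    with that none show False by blast
  qed
  define pick where "pick = (\<lambda>A. SOME m. m \<in> L \<and> (\<forall>m0\<in>A. \<not> mon_le m0 m))"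
  have pick: "pick A \<in> L \<and> (\<forall>m0\<in>A. \<not> mon_le m0 (pick A))" if "finite A" "A \<subseteq> L" for A
    unfolding pick_def by (rule someI_ex[OF ex[OF that]])
  define A where "A = rec_nat {} (\<lambda>_ B. insert (pick B) B)"
  have A0: "A 0 = {}" and AS: "A (Suc n) = insert (pick (A n)) (A n)" for n by (simp_all add: A_def)
  have A: "finite (A n) \<and> A n \<subseteq> L" for n
    by (induction n) (auto simp: A0 AS dest: pick)
  have mem: "pick (A i) \<in> A j" if "i < j" for i j
    using that by (induction j) (auto simp: AS less_Suc_eq)
  obtain i j where "i < j" "mon_le (pick (A i)) (pick (A j))"
    using mon_le_wqo[of "\<lambda>n. pick (A n)"] by blast
  then show False using pick[of "A j"] A[of j] mem by blast
qed

text \<open>Division by elements whose leading monomials are the minimal ones. Only bihomogeneous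
  elements are reduced: each reduction stays inside the finite set \<open>Mon u v\<close>, so
  counting the monomials up to the leading one proves termination.\<close>

lemma bihom_ideal_finitely_generated:
  assumes add: "\<And>p q. p \<in> I \<Longrightarrow> q \<in> I \<Longrightarrow> p + q \<in> I" and mult: "\<And>s p. p \<in> I \<Longrightarrow> s * p \<in> I"
    and comp: "\<And>\<gamma> p. p \<in> I \<Longrightarrow> bicomp \<gamma> p \<in> I"
  shows "\<exists>G. finite G \<and> G \<subseteq> I \<and> (\<forall>p\<in>I. \<exists>c. p = (\<Sum>g\<in>G. c g * g))"
proof -
  let ?lead = "\<lambda>p :: S. Max (keys p)"
  define L where "L = {?lead p | p \<gamma>. p \<in> I \<and> p \<noteq> 0 \<and> p \<in> bihom_part \<gamma>}"
  obtain L0 where L0: "finite L0" "L0 \<subseteq> L" "\<And>m. m \<in> L \<Longrightarrow> \<exists>m0\<in>L0. mon_le m0 m"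
    using dickson[of L] by blast
  have "\<forall>m\<in>L0. \<exists>p. p \<in> I \<and> p \<noteq> 0 \<and> p \<in> bihom_part (bideg m) \<and> ?lead p = m"
  proof
    fix m assume "m \<in> L0"
    then obtain p \<gamma> where p: "p \<in> I" "p \<noteq> 0" "p \<in> bihom_part \<gamma>" "m = ?lead p" using L0(2) by (auto simp: L_def)
    have "m \<in> keys p" unfolding p(4) using p(2) by (intro Max_in) auto
    then have "bideg m = \<gamma>" using p(3) by (simp add: bihom_part_iff)
    then show "\<exists>p. p \<in> I \<and> p \<noteq> 0 \<and> p \<in> bihom_part (bideg m) \<and> ?lead p = m" using p by blast
  qed
  from bchoice[OF this] obtain P where P: "\<And>m. m \<in> L0 \<Longrightarrow> P m \<in> I \<and> P m \<noteq> 0 \<and> P m \<in> bihom_part (bideg m) \<and> ?lead (P m) = m"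
    by blast
  define G where "G = P ` L0"
  have G: "finite G" "G \<subseteq> I" using L0(1) P by (auto simp: G_def)
  define Sp where "Sp = {p. \<exists>c. p = (\<Sum>g\<in>G. c g * g)}"
  have Sp0: "0 \<in> Sp" unfolding Sp_def by (auto intro: exI[of _ "\<lambda>_. 0"])
  have Sp_add: "p + q \<in> Sp" if pq: "p \<in> Sp" "q \<in> Sp" for p q
  proof -
    obtain c e where "p = (\<Sum>g\<in>G. c g * g)" "q = (\<Sum>g\<in>G. e g * g)" using pq unfolding Sp_def by blast
    then have "p + q = (\<Sum>g\<in>G. (c g + e g) * g)" by (simp add: distrib_right sum.distrib)
    then show ?thesis unfolding Sp_def by (intro CollectI exI[of _ "\<lambda>g. c g + e g"])
  qed
  have Sp_gen: "s * g \<in> Sp" if "g \<in> G" for s g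
  proof -
    have "(\<Sum>g'\<in>G. (if g' = g then s else 0) * g') = (\<Sum>g'\<in>G. if g' = g then s * g else 0)"
      by (rule sum.cong) auto
    then have *: "s * g = (\<Sum>g'\<in>G. (if g' = g then s else 0) * g')" using that G(1) by simp
    show ?thesis unfolding Sp_def
      by (rule CollectI, rule exI[of _ "\<lambda>g'. if g' = g then s else 0"], rule *)
  qed
  have red: "p \<in> Sp" if "p \<in> I" "p \<in> bihom_part (u, v)" for p u v
    using that
  proof (induction "card {n \<in> Mon u v. n \<le> ?lead p}" arbitrary: p rule: less_induct)
    case less
    show ?case
    proof (cases "p = 0")
      case False
      define m where "m = ?lead p"
      have mk: "m \<in> keys p" unfolding m_def using False by (intro Max_in) auto
      have "m \<in> L" unfolding L_def m_def using less.prems False by blast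
      then obtain m0 where m0: "m0 \<in> L0" "mon_le m0 m" using L0(3) by blast
      define t where "t = single (m - m0) (lk p m / lk (P m0) m0)"
      have mm: "(m - m0) + m0 = m"
        using monom_add_diff[of m0 m] m0(2) by (simp add: mon_le_def add.commute)
      have P0: "lk (P m0) m0 \<noteq> 0"
      proof -
        have "m0 \<in> keys (P m0)"
          using P[OF m0(1)] Max_in[of "keys (P m0)"] by auto
        then show ?thesis by (simp add: in_keys_iff)
      qed
      define q where "q = p - t * P m0"
      have bm: "bideg m = (u, v)" using mk less.prems(2) by (simp add: bihom_part_iff)
      have "t * P m0 \<in> bihom_part (u, v)"
        unfolding t_def using P[OF m0(1)] bm mm bideg_add[of "m - m0" m0]
        by (intro bihom_part_mult_eq[of _ "bideg (m - m0)" _ "bideg m0"] bihom_part_single) auto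
      then have q_hom: "q \<in> bihom_part (u, v)" unfolding q_def using less.prems(2) by (intro bihom_part_diff)
      have tI: "t * P m0 \<in> I" using P[OF m0(1)] mult by blast
      have q_I: "q \<in> I"
        using add[OF less.prems(1) mult[OF tI, of "-1"]] by (simp add: q_def)
      have "lk (t * P m0) m = lk p m"
        using lookup_single_mult[of "m - m0" "lk p m / lk (P m0) m0" "P m0" m0] P0 by (simp add: t_def mm)
      then have qm: "lk q m = 0" by (simp add: q_def lookup_minus)
      have lt: "n < m" if n: "n \<in> keys q" for n
      proof -
        have "n \<le> m"
        proof (cases "n \<in> keys p")
          case True
          then show ?thesis unfolding m_def by (intro Max_ge) auto
        next
          case False
          then have "lk (t * P m0) n \<noteq> 0" using n by (simp add: q_def in_keys_iff lookup_minus)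
          then obtain n' where n': "n = (m - m0) + n'" unfolding t_def using lookup_single_mult_eq_0 by blast
          then have "lk (P m0) n' \<noteq> 0" using \<open>lk (t * P m0) n \<noteq> 0\<close> by (auto simp: t_def lookup_single_mult)
          then have "n' \<le> ?lead (P m0)" by (intro Max_ge) (auto simp: in_keys_iff)
          then have "n' \<le> m0" using P[OF m0(1)] by simp
          then have "(m - m0) + n' \<le> (m - m0) + m0" by (rule add_left_mono)
          then show ?thesis unfolding n' mm .
        qed
        moreover have "n \<noteq> m" using n qm by (auto simp: in_keys_iff)
        ultimately show ?thesis by simp
      qed
      have "q \<in> Sp"
      proof (cases "q = 0")
        case qz: False
        have "?lead q < m" using lt qz by (subst Max_less_iff) auto
        then have "{n \<in> Mon u v. n \<le> ?lead q} \<subset> {n \<in> Mon u v. n \<le> m}"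
        proof (intro psubsetI)
          show "{n \<in> Mon u v. n \<le> ?lead q} \<subseteq> {n \<in> Mon u v. n \<le> m}"
            using \<open>?lead q < m\<close> by auto
          have "m \<in> {n \<in> Mon u v. n \<le> m}" "m \<notin> {n \<in> Mon u v. n \<le> ?lead q}"
            using bm \<open>?lead q < m\<close> by (simp_all add: Mon_def not_le)
          then show "{n \<in> Mon u v. n \<le> ?lead q} \<noteq> {n \<in> Mon u v. n \<le> m}" by blast
        qed
        then have "card {n \<in> Mon u v. n \<le> ?lead q} < card {n \<in> Mon u v. n \<le> m}"
          by (intro psubset_card_mono) auto
        then show ?thesis using less.hyps[OF _ q_I q_hom] by (simp add: m_def)
      qed (simp add: Sp0)
      moreover have "p = q + t * P m0" by (simp add: q_def)
      moreover have "P m0 \<in> G" using m0(1) by (simp add: G_def)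
      ultimately show ?thesis using Sp_add[of q "t * P m0"] Sp_gen[of "P m0" t] by simp
    qed (simp add: Sp0)
  qed
  have "p \<in> Sp" if p: "p \<in> I" for p
  proof -
    have e: "(\<Sum>\<gamma>\<in>bideg ` keys p. bicomp \<gamma> p) = p"
      by (rule sum_bicomp) auto
    have "bicomp \<gamma> p \<in> Sp" for \<gamma>
      using red[OF comp[OF p, of \<gamma>], of "fst \<gamma>" "snd \<gamma>"] bicomp_in[of \<gamma> p] by simp
    then have sumSp: "(\<Sum>\<gamma>\<in>D. bicomp \<gamma> p) \<in> Sp" for D
      by (induction D rule: infinite_finite_induct) (simp_all add: Sp0 Sp_add)
    show ?thesis using sumSp[of "bideg ` keys p"] unfolding e .
  qed
  then show ?thesis using G unfolding Sp_def by blast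
qed

section \<open>Graded submodules of free modules and their minimal generators\<close>

interpretation VM: module "\<lambda>(p :: S) (v :: nat \<Rightarrow> S) j. p * v j"
  by unfold_locales (simp_all add: fun_eq_iff plus_fun_def distrib_left distrib_right mult.assoc)

text \<open>Vectors are sequences, and \<open>a j\<close> is the bidegree of the j-th basis vector;
  free modules of all ranks then share one type, the rank being a bound on the support.\<close>

definition vcomp :: "(nat \<Rightarrow> int \<times> int) \<Rightarrow> int \<times> int \<Rightarrow> (nat \<Rightarrow> S) \<Rightarrow> nat \<Rightarrow> S" where
  "vcomp a \<gamma> v = (\<lambda>j. bicomp (\<gamma> - a j) (v j))"

definition graded_submodule :: "nat \<Rightarrow> (nat \<Rightarrow> int \<times> int) \<Rightarrow> (nat \<Rightarrow> S) set \<Rightarrow> bool" where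
  "graded_submodule r a K \<longleftrightarrow> VM.subspace K \<and> (\<forall>v\<in>K. \<forall>j\<ge>r. v j = 0) \<and> (\<forall>v\<in>K. \<forall>\<gamma>. vcomp a \<gamma> v \<in> K)"

text \<open>Induction on the rank: the last coordinates form a bigraded ideal, and the vectors with
  last coordinate 0 a submodule of smaller rank.\<close>

lemma graded_submodule_finitely_generated:
  assumes "graded_submodule r a K"
  shows "\<exists>G. finite G \<and> G \<subseteq> K \<and> K \<subseteq> VM.span G"
  using assms
proof (induction r arbitrary: K)
  case 0
  have "v = 0" if "v \<in> K" for v
    using 0 that by (auto simp: graded_submodule_def fun_eq_iff)
  then show ?case by (intro exI[of _ "{}"]) (auto simp: VM.span_empty)
next
  case (Suc r)
  have sub: "VM.subspace K" and supp: "\<And>v j. v \<in> K \<Longrightarrow> j \<ge> Suc r \<Longrightarrow> v j = 0"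
    and gr: "\<And>v \<gamma>. v \<in> K \<Longrightarrow> vcomp a \<gamma> v \<in> K"
    using Suc.prems unfolding graded_submodule_def by blast+
  define K' where "K' = {v \<in> K. v r = 0}"
  have "graded_submodule r a K'"
    unfolding graded_submodule_def
  proof (intro conjI ballI allI impI)
    show "VM.subspace K'"
      using sub unfolding K'_def VM.subspace_def by (auto simp: plus_fun_def zero_fun_def)
    show "v j = 0" if "v \<in> K'" "j \<ge> r" for v j
      using that supp[of v j] by (cases "j = r") (auto simp: K'_def)
    show "vcomp a \<gamma> v \<in> K'" if "v \<in> K'" for v \<gamma>
      using that gr by (auto simp: K'_def vcomp_def)
  qed
  then obtain G' where G': "finite G'" "G' \<subseteq> K'" "K' \<subseteq> VM.span G'" using Suc.IH by blast
  define I where "I = (\<lambda>v. v r) ` K"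
  have "\<exists>G. finite G \<and> G \<subseteq> I \<and> (\<forall>p\<in>I. \<exists>c. p = (\<Sum>g\<in>G. c g * g))"
  proof (rule bihom_ideal_finitely_generated)
    fix p q assume "p \<in> I" "q \<in> I"
    then obtain v w where "v \<in> K" "w \<in> K" "p = v r" "q = w r" by (auto simp: I_def)
    then show "p + q \<in> I" using VM.subspace_add[OF sub, of v w]
      by (auto simp: I_def plus_fun_def intro!: image_eqI[of _ _ "v + w"])
  next
    fix s p assume "p \<in> I"
    then obtain v where "v \<in> K" "p = v r" by (auto simp: I_def)
    then show "s * p \<in> I" using VM.subspace_scale[OF sub, of v s]
      by (auto simp: I_def intro!: image_eqI[of _ _ "\<lambda>j. s * v j"])
  next
    fix \<gamma> p assume "p \<in> I"
    then obtain v where "v \<in> K" "p = v r" by (auto simp: I_def)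
    then show "bicomp \<gamma> p \<in> I" using gr[of v "\<gamma> + a r"]
      by (auto simp: I_def vcomp_def intro!: image_eqI[of _ _ "vcomp a (\<gamma> + a r) v"])
  qed
  then obtain G where G: "finite G" "G \<subseteq> I" "\<And>p. p \<in> I \<Longrightarrow> \<exists>c. p = (\<Sum>g\<in>G. c g * g)" by blast
  have "\<forall>g\<in>G. \<exists>v. v \<in> K \<and> v r = g" using G(2) by (auto simp: I_def)
  from bchoice[OF this] obtain V where V: "\<And>g. g \<in> G \<Longrightarrow> V g \<in> K \<and> V g r = g" by blast
  let ?H = "G' \<union> V ` G"
  have "v \<in> VM.span ?H" if v: "v \<in> K" for v
  proof -
    obtain c where c: "v r = (\<Sum>g\<in>G. c g * g)" using G(3)[of "v r"] v by (auto simp: I_def)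
    define w where "w = (\<Sum>g\<in>G. (\<lambda>j. c g * V g j))"
    have w_sp: "w \<in> VM.span ?H"
      unfolding w_def by (intro VM.span_sum VM.span_scale VM.span_base) auto
    have w_K: "w \<in> K" unfolding w_def
      by (rule VM.subspace_sum[OF sub]) (use V VM.subspace_scale[OF sub] in blast)
    have "w r = (\<Sum>g\<in>G. c g * V g r)" unfolding w_def by (induction G rule: infinite_finite_induct) (auto simp: plus_fun_def zero_fun_def)
    also have "\<dots> = v r" unfolding c using V by (intro sum.cong) auto
    finally have "w r = v r" .
    then have "v - w \<in> K'" using VM.subspace_diff[OF sub v w_K] by (simp add: K'_def fun_diff_def)
    then have "v - w \<in> VM.span ?H" using G'(3) VM.span_mono[of G' ?H] by blast
    from VM.span_add[OF this w_sp] show ?thesis by simp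
  qed
  moreover have "finite ?H" "?H \<subseteq> K" using G'(1,2) G(1) V by (auto simp: K'_def)
  ultimately show ?case by blast
qed

definition vhom :: "(nat \<Rightarrow> int \<times> int) \<Rightarrow> int \<times> int \<Rightarrow> (nat \<Rightarrow> S) \<Rightarrow> bool" where
  "vhom a \<gamma> v \<longleftrightarrow> (\<forall>j. v j \<in> bihom_part (\<gamma> - a j))"

lemma fun_sum_apply: "(\<Sum>i\<in>A. F i) j = (\<Sum>i\<in>A. F i j :: S)"
  by (induction A rule: infinite_finite_induct) (auto simp: plus_fun_def zero_fun_def)

text \<open>The homogeneous components of finitely many generators again generate, and a generating
  subset of least cardinality among them cannot be shrunk.\<close>

proposition minimal_homogeneous_generators:
  assumes K: "graded_submodule r a K"
  shows "\<exists>G. finite G \<and> (\<forall>g\<in>G. \<exists>\<gamma>. vhom a \<gamma> g) \<and> VM.span G = K \<and> (\<forall>H. H \<subset> G \<longrightarrow> VM.span H \<noteq> K)"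
proof -
  have sub: "VM.subspace K" and supp: "\<And>v j. v \<in> K \<Longrightarrow> j \<ge> r \<Longrightarrow> v j = 0"
    and gr: "\<And>v \<gamma>. v \<in> K \<Longrightarrow> vcomp a \<gamma> v \<in> K"
    using K unfolding graded_submodule_def by blast+
  obtain G where G: "finite G" "G \<subseteq> K" "K \<subseteq> VM.span G"
    using graded_submodule_finitely_generated[OF K] by blast
  define D where "D = (\<lambda>v :: nat \<Rightarrow> S. \<Union>j<r. (\<lambda>m. bideg m + a j) ` keys (v j))"
  have finD: "finite (D v)" for v by (simp add: D_def)
  have decomp: "v = (\<Sum>\<gamma>\<in>D v. vcomp a \<gamma> v)" if v: "v \<in> K" for v
  proof
    fix j
    show "v j = (\<Sum>\<gamma>\<in>D v. vcomp a \<gamma> v) j"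
    proof (cases "j < r")
      case True
      have inj: "inj_on (\<lambda>\<gamma>. \<gamma> - a j) (D v)" by (auto simp: inj_on_def)
      have "(\<Sum>\<gamma>\<in>(\<lambda>\<gamma>. \<gamma> - a j) ` D v. bicomp \<gamma> (v j)) = v j"
      proof (rule sum_bicomp)
        show "bideg ` keys (v j) \<subseteq> (\<lambda>\<gamma>. \<gamma> - a j) ` D v"
        proof
          fix \<gamma> assume "\<gamma> \<in> bideg ` keys (v j)"
          then have "\<gamma> + a j \<in> D v" using True by (auto simp: D_def)
          then show "\<gamma> \<in> (\<lambda>\<gamma>. \<gamma> - a j) ` D v" by (intro image_eqI[of _ _ "\<gamma> + a j"]) auto
        qed
      qed (simp add: finD)
      then show ?thesis by (simp add: fun_sum_apply vcomp_def sum.reindex[OF inj])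
    next
      case False
      then show ?thesis using supp[OF v, of j] by (simp add: fun_sum_apply vcomp_def)
    qed
  qed
  define G2 where "G2 = (\<Union>v\<in>G. (\<lambda>\<gamma>. vcomp a \<gamma> v) ` D v)"
  have G2: "finite G2" "G2 \<subseteq> K" using G gr by (auto simp: G2_def finD)
  have hom: "\<exists>\<gamma>. vhom a \<gamma> g" if "g \<in> G2" for g
  proof -
    obtain v \<gamma> where "g = vcomp a \<gamma> v" using \<open>g \<in> G2\<close> by (auto simp: G2_def)
    then have "vhom a \<gamma> g" by (simp add: vhom_def vcomp_def bicomp_in)
    then show ?thesis by blast
  qed
  have "v \<in> VM.span G2" if "v \<in> G" for v
  proof -
    have "(\<Sum>\<gamma>\<in>D v. vcomp a \<gamma> v) \<in> VM.span G2"
      using that by (intro VM.span_sum VM.span_base) (auto simp: G2_def)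
    then show ?thesis using decomp[of v] that G(2) by auto
  qed
  then have "VM.span G \<subseteq> VM.span G2" by (metis VM.span_minimal VM.subspace_span subsetI)
  then have span2: "VM.span G2 = K" using G(3) VM.span_minimal[OF G2(2) sub] by blast
  define Q where "Q = (\<lambda>H. H \<subseteq> G2 \<and> VM.span H = K)"
  have "\<exists>H. Q H \<and> (\<forall>H'. Q H' \<longrightarrow> card H \<le> card H')"
    using ex_has_least_nat[of Q G2 card] span2 by (auto simp: Q_def)
  then obtain H where H: "Q H" "\<And>H'. Q H' \<Longrightarrow> card H \<le> card H'" by blast
  have finH: "finite H" using H(1) G2(1) finite_subset by (auto simp: Q_def)
  have "VM.span H' \<noteq> K" if "H' \<subset> H" for H'
  proof
    assume "VM.span H' = K"
    then have "card H \<le> card H'" using H that by (auto simp: Q_def)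
    then show False using psubset_card_mono[OF finH that] by simp
  qed
  then show ?thesis using H(1) hom finH unfolding Q_def by blast
qed

section \<open>Kernels and resolutions\<close>

text \<open>The kernel of the map sending the l-th basis vector to \<open>g l\<close>, that is, the
  relations among the \<open>g l\<close>.\<close>

definition kernel :: "nat \<Rightarrow> (nat \<Rightarrow> nat \<Rightarrow> S) \<Rightarrow> (nat \<Rightarrow> S) set" where
  "kernel R g = {w. (\<forall>l\<ge>R. w l = 0) \<and> (\<forall>j. (\<Sum>l<R. w l * g l j) = 0)}"

lemma kernel_graded:
  assumes "\<And>l. l < R \<Longrightarrow> vhom a (b l) (g l)"
  shows "graded_submodule R b (kernel R g)"
  unfolding graded_submodule_def
proof (intro conjI ballI allI impI)
  show "VM.subspace (kernel R g)"
    unfolding VM.subspace_def kernel_def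
    by (auto simp: plus_fun_def zero_fun_def distrib_right sum.distrib mult.assoc simp flip: sum_distrib_left)
  show "v j = 0" if "v \<in> kernel R g" "R \<le> j" for v j using that by (simp add: kernel_def)
  show "vcomp b \<gamma> v \<in> kernel R g" if v: "v \<in> kernel R g" for v \<gamma>
  proof -
    have "(\<Sum>l<R. vcomp b \<gamma> v l * g l j) = bicomp (\<gamma> - a j) (\<Sum>l<R. v l * g l j)" for j
      unfolding bicomp_sum
    proof (rule sum.cong[OF refl])
      fix l assume "l \<in> {..<R}"
      then have "g l j \<in> bihom_part (b l - a j)" using assms[of l] by (simp add: vhom_def)
      from bicomp_mult[OF this, of "\<gamma> - a j" "v l"] show "vcomp b \<gamma> v l * g l j = bicomp (\<gamma> - a j) (v l * g l j)"
        by (simp add: vcomp_def)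
    qed
    then show ?thesis using v by (simp add: kernel_def vcomp_def)
  qed
qed

lemma in_span_image_iff:
  fixes R :: nat
  shows "v \<in> VM.span (g ` {..<R}) \<longleftrightarrow> (\<exists>w. \<forall>j. v j = (\<Sum>l<R. g l j * w l))"
proof
  assume "v \<in> VM.span (g ` {..<R})"
  then show "\<exists>w. \<forall>j. v j = (\<Sum>l<R. g l j * w l)"
  proof (induction rule: VM.span_induct_alt)
    case base
    show ?case by (rule exI[of _ "\<lambda>_. 0"]) simp
  next
    case (step c x y)
    obtain w where w: "\<And>j. y j = (\<Sum>l<R. g l j * w l)" using step(2) by blast
    obtain l0 where l0: "l0 < R" "x = g l0" using step(1) by blast
    have "c * x j + y j = (\<Sum>l<R. g l j * (w l + (if l = l0 then c else 0)))" for j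
    proof -
      have "(\<Sum>l<R. g l j * (if l = l0 then c else 0)) = (\<Sum>l<R. if l = l0 then c * x j else 0)"
        by (rule sum.cong) (auto simp: l0(2))
      also have "\<dots> = c * x j" using l0(1) by (subst sum.delta) auto
      finally have "(\<Sum>l<R. g l j * (if l = l0 then c else 0)) = c * x j" .
      then show ?thesis unfolding distrib_left sum.distrib w by simp
    qed
    then show ?case by (intro exI[of _ "\<lambda>l. w l + (if l = l0 then c else 0)"]) simp
  qed
next
  assume "\<exists>w. \<forall>j. v j = (\<Sum>l<R. g l j * w l)"
  then obtain w where w: "\<And>j. v j = (\<Sum>l<R. g l j * w l)" by blast
  have "v = (\<Sum>l<R. (\<lambda>j. w l * g l j))"
    by (rule ext) (simp add: fun_sum_apply w mult.commute)
  also have "\<dots> \<in> VM.span (g ` {..<R})"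
    by (intro VM.span_sum VM.span_scale VM.span_base) auto
  finally show "v \<in> VM.span (g ` {..<R})" .
qed

text \<open>Minimality of a stage in the form needed for the next differential: its columns are
  bihomogeneous relations, and their entries must have no constant term.\<close>

definition no_constants :: "nat \<Rightarrow> (nat \<Rightarrow> nat \<Rightarrow> S) \<Rightarrow> (nat \<Rightarrow> int \<times> int) \<Rightarrow> bool" where
  "no_constants R g b \<longleftrightarrow> (\<forall>w\<in>kernel R g. \<forall>\<gamma>. vhom b \<gamma> w \<longrightarrow> (\<forall>l<R. lk (w l) 0 = 0))"

lemma bihom_part_zero_degree:
  assumes "p \<in> bihom_part 0"
  shows "p = cst (lk p 0)"
proof (rule poly_mapping_eqI)
  fix m
  show "lk p m = lk (cst (lk p 0)) m"
  proof (cases "m = 0")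
    case False
    have "lk p m = 0"
    proof (rule ccontr)
      assume "lk p m \<noteq> 0"
      then have "bideg m = 0" by (rule bihom_partD[OF assms])
      then have "m = 0" by (simp add: bideg_def zero_prod_def monom4_eq_iff)
      then show False using False by simp
    qed
    then show ?thesis using False by (simp add: lookup_single_not_eq)
  qed simp
qed

lemma no_constants_of_irredundant:
  assumes irr: "\<And>l. l < R \<Longrightarrow> g l \<notin> VM.span (g ` ({..<R} - {l}))"
  shows "no_constants R g b"
  unfolding no_constants_def
proof (intro ballI allI impI, rule ccontr)
  fix w \<gamma> l
  assume w: "w \<in> kernel R g" and hom: "vhom b \<gamma> w" and l: "l < R" and nz: "lk (w l) 0 \<noteq> 0"
  have "w l \<in> bihom_part (\<gamma> - b l)" using hom by (simp add: vhom_def)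
  \<comment> \<open>A bihomogeneous entry with a constant term has bidegree 0 and so is an
    invertible scalar; the relation can be solved for \<open>g l\<close>.\<close>
  moreover from this nz have "\<gamma> - b l = 0" by (metis bideg_0 bihom_partD)
  ultimately have wl: "w l = cst (lk (w l) 0)" using bihom_part_zero_degree by simp
  let ?c = "cst (1 / lk (w l) 0) :: S"
  have c: "?c * w l = 1" by (subst wl) (simp add: nz)
  have "g l = (\<Sum>l'\<in>{..<R} - {l}. (\<lambda>j. (- ?c * w l') * g l' j))"
  proof (rule ext)
    fix j
    have "(\<Sum>l'<R. w l' * g l' j) = 0" using w by (simp add: kernel_def)
    then have "w l * g l j + (\<Sum>l'\<in>{..<R} - {l}. w l' * g l' j) = 0"
      using l by (subst (asm) sum.remove[of _ l]) auto
    then have "?c * (w l * g l j + (\<Sum>l'\<in>{..<R} - {l}. w l' * g l' j)) = 0" by simp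
    then have "(?c * w l) * g l j = - (?c * (\<Sum>l'\<in>{..<R} - {l}. w l' * g l' j))"
      by (simp only: distrib_left mult.assoc eq_neg_iff_add_eq_0)
    then show "g l j = (\<Sum>l'\<in>{..<R} - {l}. (\<lambda>j. (- ?c * w l') * g l' j)) j"
      unfolding c by (simp add: fun_sum_apply sum_distrib_left sum_negf mult.assoc)
  qed
  also have "\<dots> \<in> VM.span (g ` ({..<R} - {l}))"
    by (intro VM.span_sum VM.span_scale VM.span_base) auto
  finally show False using irr[OF l] by blast
qed

lemma next_stage:
  assumes hom: "\<And>l. l < R \<Longrightarrow> vhom a (b l) (g l)"
  shows "\<exists>R' g' b'. VM.span (g' ` {..<R'}) = kernel R g \<and> (\<forall>l<R'. vhom b (b' l) (g' l))
    \<and> no_constants R' g' b'"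
proof -
  from minimal_homogeneous_generators[OF kernel_graded[of R a b g, OF hom]]
  obtain G where G0: "finite G \<and> (\<forall>g\<in>G. \<exists>\<gamma>. vhom b \<gamma> g) \<and> VM.span G = kernel R g \<and>
    (\<forall>H. H \<subset> G \<longrightarrow> VM.span H \<noteq> kernel R g)" ..
  then have G: "finite G" "\<And>x. x \<in> G \<Longrightarrow> \<exists>\<gamma>. vhom b \<gamma> x" "VM.span G = kernel R g"
    "\<And>H. H \<subset> G \<Longrightarrow> VM.span H \<noteq> kernel R g"
    by simp_all
  obtain xs where xs: "set xs = G" "distinct xs" using finite_distinct_list[OF G(1)] by blast
  define g' where "g' = (\<lambda>l. xs ! l)"
  let ?R = "length xs"
  have img: "g' ` {..<?R} = G" using xs(1) by (auto simp: g'_def set_conv_nth)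
  have "\<forall>l\<in>{..<?R}. \<exists>\<gamma>. vhom b \<gamma> (g' l)" using G(2) img by blast
  from bchoice[OF this] obtain b' where b': "\<And>l. l < ?R \<Longrightarrow> vhom b (b' l) (g' l)" by auto
  have "g' l \<notin> VM.span (g' ` ({..<?R} - {l}))" if l: "l < ?R" for l
  proof
    assume in_span: "g' l \<in> VM.span (g' ` ({..<?R} - {l}))"
    let ?H = "g' ` ({..<?R} - {l})"
    have "G \<subseteq> VM.span ?H"
    proof
      fix x assume "x \<in> G"
      then obtain l' where "l' < ?R" "x = g' l'" using img by auto
      then show "x \<in> VM.span ?H" using in_span by (cases "l' = l") (auto intro: VM.span_base)
    qed
    then have "VM.span G \<subseteq> VM.span ?H" by (rule VM.span_minimal[OF _ VM.subspace_span])
    moreover have "?H \<subseteq> G" using img by blast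
    ultimately have "VM.span ?H = kernel R g" using VM.span_mono[of ?H G] G(3) by blast
    moreover have "g' l \<notin> ?H" using xs(2) l by (auto simp: g'_def nth_eq_iff_index_eq)
    then have "?H \<subset> G" using \<open>?H \<subseteq> G\<close> img l by blast
    ultimately show False using G(4) by blast
  qed
  then have "no_constants ?R g' b'" by (rule no_constants_of_irredundant)
  then show ?thesis using img G(3) b' by blast
qed

type_synonym stage = "nat \<times> (nat \<Rightarrow> nat \<Rightarrow> S) \<times> (nat \<Rightarrow> int \<times> int)"

text \<open>Dependent choice over stages of rank, generators and bidegrees. Irredundant generators
  at each stage supply the condition on constants for the following one.\<close>

lemma resolution_sequence:
  assumes hom: "\<And>l. l < R \<Longrightarrow> vhom a (b l) (g l)" and nc: "no_constants R g b"
  obtains rr :: "nat \<Rightarrow> nat" and gg bb where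
    "rr 0 = R" "gg 0 = g" "bb 0 = b"
    "\<And>n. VM.span (gg (Suc n) ` {..<rr (Suc n)}) = kernel (rr n) (gg n)"
    "\<And>n l. l < rr (Suc n) \<Longrightarrow> vhom (bb n) (bb (Suc n) l) (gg (Suc n) l)"
    "\<And>n. no_constants (rr n) (gg n) (bb n)"
proof -
  define P :: "nat \<Rightarrow> stage \<Rightarrow> bool" where
    "P = (\<lambda>n (R', g', b'). (n = 0 \<longrightarrow> R' = R \<and> g' = g \<and> b' = b) \<and>
      (\<exists>a'. \<forall>l<R'. vhom a' (b' l) (g' l)) \<and> no_constants R' g' b')"
  define Q :: "nat \<Rightarrow> stage \<Rightarrow> stage \<Rightarrow> bool" where
    "Q = (\<lambda>n (R', g', b') (R'', g'', b''). VM.span (g'' ` {..<R''}) = kernel R' g' \<and>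
      (\<forall>l<R''. vhom b' (b'' l) (g'' l)))"
  have "\<exists>F. \<forall>n. P n (F n) \<and> Q n (F n) (F (Suc n))"
  proof (rule dependent_nat_choice)
    show "\<exists>x. P 0 x" by (rule exI[of _ "(R, g, b)"]) (use hom nc in \<open>auto simp: P_def\<close>)
  next
    fix x n assume "P n x"
    obtain R' g' b' where x: "x = (R', g', b')" by (cases x)
    obtain a' where "\<And>l. l < R' \<Longrightarrow> vhom a' (b' l) (g' l)" using \<open>P n x\<close> by (auto simp: P_def x)
    from next_stage[of R' a' b' g', OF this] obtain R'' g'' b'' where
      "VM.span (g'' ` {..<R''}) = kernel R' g'" "\<forall>l<R''. vhom b' (b'' l) (g'' l)" "no_constants R'' g'' b''"
      by blast
    then show "\<exists>y. P (Suc n) y \<and> Q n x y"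
      by (intro exI[of _ "(R'', g'', b'')"]) (auto simp: P_def Q_def x)
  qed
  then obtain F where F: "\<And>n. P n (F n)" "\<And>n. Q n (F n) (F (Suc n))" by blast
  define rr gg bb where "rr = (\<lambda>n. fst (F n))" and "gg = (\<lambda>n. fst (snd (F n)))" and "bb = (\<lambda>n. snd (snd (F n)))"
  have Fn: "F n = (rr n, gg n, bb n)" for n by (simp add: rr_def gg_def bb_def)
  show ?thesis
  proof (rule that[of rr gg bb])
    show "rr 0 = R" "gg 0 = g" "bb 0 = b" using F(1)[of 0] by (auto simp: P_def Fn)
    show "VM.span (gg (Suc n) ` {..<rr (Suc n)}) = kernel (rr n) (gg n)" for n
      using F(2)[of n] by (simp add: Q_def Fn)
    show "vhom (bb n) (bb (Suc n) l) (gg (Suc n) l)" if "l < rr (Suc n)" for n l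
      using F(2)[of n] that by (simp add: Q_def Fn)
    show "no_constants (rr n) (gg n) (bb n)" for n using F(1)[of n] by (simp add: P_def Fn)
  qed
qed

section \<open>Quadruples indexed by \<open>4\<close> and by natural numbers\<close>

definition idx4 :: "4 \<Rightarrow> nat" where
  "idx4 i = (if i = 0 then 0 else if i = 1 then 1 else if i = 2 then 2 else 3)"

lemma lessThan_4: "{..<4} = {0, 1, 2, 3 :: nat}" by auto

lemma idx4: "idx4 i < 4" "of_nat (idx4 i) = i"
proof -
  have "i \<in> {0,1,2,3}" using UNIV_4_from_0 by blast
  then show "idx4 i < 4" "of_nat (idx4 i) = i" by (auto simp: idx4_def)
qed

lemma idx4_of_nat:
  assumes "j < 4"
  shows "idx4 (of_nat j) = j"
proof -
  have "j \<in> {0, 1, 2, 3}" using assms by auto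
  then show ?thesis by (auto simp: idx4_def)
qed

lemma sum_idx4: "(\<Sum>i\<in>UNIV. F (idx4 i) i) = (\<Sum>j<4. F j (of_nat j))"
  by (simp add: sum_4_from_0 lessThan_4 idx4_def add.assoc)

definition vec4 :: "(nat \<Rightarrow> S) \<Rightarrow> S ^ 4" where "vec4 v = (\<chi> i. v (idx4 i))"

lemma vec4_inj:
  assumes "\<And>j. j \<ge> 4 \<Longrightarrow> v j = 0" "\<And>j. j \<ge> 4 \<Longrightarrow> w j = 0" "vec4 v = vec4 w"
  shows "v = w"
proof
  fix j
  show "v j = w j"
  proof (cases "j < 4")
    case True
    then show ?thesis using assms(3) by (metis vec4_def vec_lambda_beta idx4_of_nat)
  qed (use assms in auto)
qed

interpretation vec4: module_hom "\<lambda>(p :: S) (v :: nat \<Rightarrow> S) j. p * v j" "(*s) :: S \<Rightarrow> S ^ 4 \<Rightarrow> S ^ 4" vec4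
  by unfold_locales (simp_all add: vec4_def vec_eq_iff plus_fun_def)

text \<open>The map given by the four derivatives, as a stage of a resolution: its target has rank
  one, so only the coordinate 0 is used.\<close>

definition jac_map :: "S \<Rightarrow> nat \<Rightarrow> nat \<Rightarrow> S" where
  "jac_map f l j = (if j = 0 then partial (of_nat l) f else 0)"

lemma kernel_jac_map:
  "w \<in> kernel 4 (jac_map f) \<longleftrightarrow> (\<forall>l\<ge>4. w l = 0) \<and> syz f (\<lambda>i. w (idx4 i))"
proof -
  have "(\<forall>j. (\<Sum>l<4. w l * jac_map f l j) = 0) \<longleftrightarrow> (\<Sum>l<4. w l * partial (of_nat l) f) = 0" (is "?L \<longleftrightarrow> ?R")
  proof
    assume ?L
    from spec[OF this, of 0] show ?R by (simp add: jac_map_def)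
  next
    assume R: ?R
    show ?L
    proof
      fix j show "(\<Sum>l<4. w l * jac_map f l j) = 0" using R by (cases "j = 0") (simp_all add: jac_map_def)
    qed
  qed
  then show ?thesis
    unfolding kernel_def syz_def sum_idx4[of "\<lambda>j i. w j * partial i f"] by simp
qed

lemma Syz_eq: "Syz f = vec4 ` kernel 4 (jac_map f)"
proof
  show "vec4 ` kernel 4 (jac_map f) \<subseteq> Syz f"
    by (auto simp: kernel_jac_map Syz_def syz_def vec4_def)
  show "Syz f \<subseteq> vec4 ` kernel 4 (jac_map f)"
  proof
    fix a assume a: "a \<in> Syz f"
    define w where "w = (\<lambda>j. if j < 4 then a $ of_nat j else 0)"
    have w: "w (idx4 i) = a $ i" for i using idx4[of i] by (simp add: w_def)
    then have "w \<in> kernel 4 (jac_map f)" using a by (simp add: kernel_jac_map w Syz_def syz_def) (simp add: w_def)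
    moreover have "a = vec4 w" by (simp add: vec4_def vec_eq_iff w)
    ultimately show "a \<in> vec4 ` kernel 4 (jac_map f)" by blast
  qed
qed

section \<open>The general polynomial\<close>

lemma lookup_0_of_X_dvd: "X i dvd p \<Longrightarrow> lk p 0 = 0"
proof (rule ccontr)
  assume *: "X i dvd p" "lk p 0 \<noteq> 0"
  then have "0 \<in> keys p" by (simp add: in_keys_iff)
  then have "lk (single i 1 :: monom4) i \<le> lk (0 :: monom4) i"
    using *(1) unfolding X_def mon_dvd_iff by blast
  then show False by simp
qed

lemma cst_mult_solve:
  fixes f :: S
  assumes "cst x * f = g" "x \<noteq> 0"
  shows "f = cst (1 / x) * g"
proof -
  have "cst (1 / x) * (cst x * f) = (cst (1 / x) * cst x) * f" by (simp only: mult.assoc)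
  also have "\<dots> = f" unfolding cst_mult_eq_iff using assms(2) by simp
  finally show ?thesis using assms(1) by simp
qed

lemma lin_not_unit: "\<not> lin v dvd 1"
proof
  assume "lin v dvd 1"
  then obtain e where "1 = lin v * e" by (rule dvdE)
  then have "bicomp 0 1 = bicomp (0 - (1, 0)) e * lin v"
    using bicomp_mult[OF lin_in_bihom, of 0 e v] by (simp add: mult.commute)
  moreover have "bicomp (0 - (1, 0)) e = 0"
    by (rule bihom_part_neg[OF _ bicomp_in]) (simp add: zero_prod_def)
  moreover have "bicomp 0 1 = 1"
    by (rule bicomp_id) (auto simp: bihom_part_iff)
  ultimately show False by simp
qed

lemma partial_lin: "partial 2 (lin v) = 0" "partial 3 (lin v) = 0"
  by (simp_all add: lin_def X_eq_xm partial_diff partial_cst_mult partial_xm)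

locale good_odd = odd_bidegree +
  fixes u1 :: int
  assumes u1: "u1 \<ge> u0" and contains: "bihom_part (u1, 3 * h) \<subseteq> jacobian_ideal f"
begin

definition pbn :: "nat \<Rightarrow> int \<times> int" where "pbn j = partial_bidegree (k, l) (of_nat j)"

lemma pbn_idx4 [simp]: "pbn (idx4 i) = partial_bidegree (k, l) i"
  by (simp add: pbn_def idx4)

lemma kernel_bisyz:
  assumes "w \<in> kernel 4 (jac_map f)" "vhom pbn \<gamma> w"
  shows "syz f (\<lambda>i. w (idx4 i))" "bisyz (k, l) \<gamma> (\<lambda>i. w (idx4 i))"
  using assms unfolding kernel_jac_map vhom_def bisyz_def by (auto simp flip: pbn_idx4)

text \<open>A linear relation between $f_0$ and $f_1$ would make \<open>f\<close> divisible by a linear form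
  in $x_0, x_1$.\<close>

lemma partials_01_independent:
  assumes h0: "h = 0" and rel: "cst c0 * partial 0 f + cst c1 * partial 1 f = 0"
  shows "c0 = 0 \<and> c1 = 0"
proof (rule ccontr)
  assume nz: "\<not> (c0 = 0 \<and> c1 = 0)"
  let ?L = "lin (- c0, - c1)"
  have rel': "cst c1 * partial 1 f = - (cst c0 * partial 0 f)"
    using rel by (simp add: eq_neg_iff_add_eq_0 add.commute)
  have L: "?L = cst c0 * X 1 - cst c1 * X 0"
    by (simp add: lin_def single_uminus)
  have k0: "of_int k \<noteq> (0 :: complex)" using k by simp
  have "\<exists>g. f = ?L * g"
  proof (cases "c0 = 0")
    case False
    have "cst (c0 * of_int k) * f = cst c0 * (cst (of_int k) * f)" by (simp add: mult.assoc[symmetric])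
    also have "\<dots> = X 0 * (cst c0 * partial 0 f) + cst c0 * X 1 * partial 1 f"
      unfolding euler1[OF f, symmetric] by (simp add: algebra_simps)
    also have "cst c0 * partial 0 f = - (cst c1 * partial 1 f)" using rel' by simp
    also have "X 0 * - (cst c1 * partial 1 f) + cst c0 * X 1 * partial 1 f = ?L * partial 1 f"
      unfolding L by (simp add: algebra_simps)
    finally have "f = cst (1 / (c0 * of_int k)) * (?L * partial 1 f)"
      by (rule cst_mult_solve) (use False k0 in simp)
    then have "f = ?L * (cst (1 / (c0 * of_int k)) * partial 1 f)" by (simp only: mult.left_commute)
    then show ?thesis by blast
  next
    case True
    then have c1: "c1 \<noteq> 0" using nz by simp
    have "cst (c1 * of_int k) * f = cst c1 * (cst (of_int k) * f)" by (simp add: mult.assoc[symmetric])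
    also have "\<dots> = cst c1 * X 0 * partial 0 f + X 1 * (cst c1 * partial 1 f)"
      unfolding euler1[OF f, symmetric] by (simp add: algebra_simps)
    also have "\<dots> = ?L * (- partial 0 f)"
      unfolding rel' L by (simp add: algebra_simps)
    finally have "f = cst (1 / (c1 * of_int k)) * (?L * (- partial 0 f))"
      by (rule cst_mult_solve) (use c1 k0 in simp)
    then have "f = ?L * (cst (1 / (c1 * of_int k)) * (- partial 0 f))" by (simp only: mult.left_commute)
    then show ?thesis by blast
  qed
  then obtain g where g: "f = ?L * g" ..
  have dvd: "?L dvd partial 2 f" "?L dvd partial 3 f"
    unfolding g partial_mult partial_lin by simp_all
  \<comment> \<open>In degree 0 in x_2, x_3 only f_2 and f_3 contribute, since f_0 and f_1 have
    degree l = 1 there; and these two inherit the divisor.\<close>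
  have dvdJ: "?L dvd s" if s: "s \<in> jacobian_ideal f" "s \<in> bihom_part (u1, 0)" for s
  proof -
    obtain b where b: "\<And>i. b i \<in> bihom_part ((u1, 0) - partial_bidegree (k, l) i)" "s = (\<Sum>i\<in>UNIV. b i * partial i f)"
      by (rule jacobian_ideal_bihom_rep[OF f s]) (rule that)
    have "b 0 = 0" "b 1 = 0"
      using bihom_part_neg[OF _ b(1)[of 0]] bihom_part_neg[OF _ b(1)[of 1]] unfolding partial_bidegree_kl by (simp_all add: l_def h0)
    then show ?thesis unfolding b(2) sum_4_from_0 using dvd by simp
  qed
  have "?L dvd xm (nat u1) 0 0 0" "?L dvd xm 0 (nat u1) 0 0"
    using contains h0 u1 u0_ge k by (auto intro!: dvdJ xm_in_bihom)
  then have "?L dvd 1"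
  proof (rule unit_of_dvd_coprime_mons)
    have "\<forall>i. lk (mk (nat u1) 0 0 0) i = 0 \<or> lk (mk 0 (nat u1) 0 0) i = 0" by (simp add: all_4)
    then show "lk (mk (nat u1) 0 0 0) i = 0 \<or> lk (mk 0 (nat u1) 0 0) i = 0" for i by (rule spec)
  qed
  then show False using lin_not_unit by blast
qed

text \<open>A relation with a constant term in entry i has the bidegree of f_i. This is small, so
  the relation is an Euler multiple, whose i-th entry is divisible by x_i.\<close>

lemma jacobian_no_constants: "no_constants 4 (jac_map f) pbn"
  unfolding no_constants_def
proof (intro ballI allI impI, rule ccontr)
  fix w \<gamma> and j :: nat
  assume w: "w \<in> kernel 4 (jac_map f)" "vhom pbn \<gamma> w" and j: "j < 4" and nz: "lk (w j) 0 \<noteq> 0"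
  define i where "i = (of_nat j :: 4)"
  have wj: "w j = w (idx4 i)" by (simp add: i_def idx4_of_nat j)
  have hom: "w (idx4 i') \<in> bihom_part (\<gamma> - partial_bidegree (k, l) i')" for i'
    using w(2) by (simp add: vhom_def flip: pbn_idx4)
  have "bideg 0 = \<gamma> - partial_bidegree (k, l) i"
    by (rule bihom_partD[OF hom]) (use nz wj in simp)
  then have \<gamma>: "\<gamma> = partial_bidegree (k, l) i" by simp
  have not_euler: "\<not> is_euler (k, l) (\<lambda>i. w (idx4 i))"
  proof
    assume "is_euler (k, l) (\<lambda>i. w (idx4 i))"
    then obtain p where "w (idx4 i) = p * euler_vec (k, l) i" unfolding is_euler_def by blast
    then have "X i dvd w (idx4 i)" by (simp add: euler_vec_def)
    then show False using lookup_0_of_X_dvd nz wj by simp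
  qed
  show False
  proof (cases "i \<in> {0, 1} \<and> h = 0")
    case False
    have "is_euler (k, l) (\<lambda>i. w (idx4 i))"
    proof (rule small_bidegree_euler[OF u1 contains kernel_bisyz(1)[OF w]])
      show "bisyz (k, l) (fst \<gamma>, snd \<gamma>) (\<lambda>i. w (idx4 i))" using kernel_bisyz(2)[OF w] by simp
      show "fst \<gamma> \<le> u0" using u0_ge k by (simp add: \<gamma> partial_bidegree_kl)
      show "snd \<gamma> \<le> 3 * h" using h False unfolding \<gamma> partial_bidegree_kl by (auto simp: l_def)
      show "(fst \<gamma>, snd \<gamma>) \<noteq> (u0, 3 * h)" using u0_ge k by (simp add: \<gamma> partial_bidegree_kl)
    qed
    then show False using not_euler by blast
  \<comment> \<open>For h = 0 the derivatives f_0, f_1 have degree 1 > 3h in x_2, x_3, outside the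
    range of the bound. By degree the relation then involves f_0 and f_1 only, with constant
    coefficients.\<close>
  next
    case True
    then have g: "\<gamma> = (k - 1, l)" by (simp add: \<gamma> partial_bidegree_kl)
    have "w (idx4 2) = 0" "w (idx4 3) = 0"
      using bihom_part_neg[OF _ hom[of 2]] bihom_part_neg[OF _ hom[of 3]] by (simp_all add: g partial_bidegree_kl)
    moreover have "w (idx4 0) = cst (lk (w (idx4 0)) 0)" "w (idx4 1) = cst (lk (w (idx4 1)) 0)"
      using hom[of 0] hom[of 1] by (auto simp: g partial_bidegree_kl zero_prod_def intro!: bihom_part_zero_degree)
    moreover have "(\<Sum>i\<in>UNIV. w (idx4 i) * partial i f) = 0"
      using kernel_bisyz(1)[OF w] by (simp add: syz_def)
    ultimately have "cst (lk (w (idx4 0)) 0) * partial 0 f + cst (lk (w (idx4 1)) 0) * partial 1 f = 0"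
      unfolding sum_4_from_0 by simp
    from partials_01_independent[OF _ this] True have "lk (w (idx4 0)) 0 = 0 \<and> lk (w (idx4 1)) 0 = 0" by simp
    then show False using True nz wj by auto
  qed
qed

text \<open>Otherwise every expansion of the non-Euler syzygy in bidegree (u_0,3h) consists of Euler
  multiples. The clause on a nonzero entry excludes the zero vector, which is homogeneous of every
  bidegree; it lets the degree of the basis vector in a resolution be read off.\<close>

lemma generators_contain:
  assumes G: "finite G" "\<And>g. g \<in> G \<Longrightarrow> \<exists>\<gamma>. vhom pbn \<gamma> g" "VM.span G = kernel 4 (jac_map f)"
  shows "\<exists>g\<in>G. vhom pbn (u0, 3 * h) g \<and> (\<exists>j. g j \<noteq> 0)"
proof (rule ccontr)
  assume none: "\<not> ?thesis"
  obtain b where b: "syz f b" "bisyz (k, l) (u0, 3 * h) b" "\<not> is_euler (k, l) b"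
    by (rule exists_non_euler)
  define t where "t = (\<lambda>j. if j < 4 then b (of_nat j) else 0)"
  have tb: "t (idx4 i) = b i" for i by (simp add: t_def idx4)
  have "t \<in> kernel 4 (jac_map f)" using b(1) by (simp add: kernel_jac_map tb) (simp add: t_def)
  then have "t \<in> VM.span G" using G(3) by simp
  then obtain c where c: "t = (\<Sum>g\<in>G. (\<lambda>j. c g * g j))"
    unfolding VM.span_finite[OF G(1)] by blast
  from bchoice[of G "\<lambda>g \<gamma>. vhom pbn \<gamma> g"] G(2) obtain \<gamma> where \<gamma>: "\<And>g. g \<in> G \<Longrightarrow> vhom pbn (\<gamma> g) g" by blast
  have "\<forall>g\<in>G. \<exists>w. \<forall>i. bicomp ((u0, 3 * h) - \<gamma> g) (c g) * g (idx4 i) = w * euler_vec (k, l) i"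
  proof
    fix g assume g: "g \<in> G"
    show "\<exists>w. \<forall>i. bicomp ((u0, 3 * h) - \<gamma> g) (c g) * g (idx4 i) = w * euler_vec (k, l) i"
    proof (cases "fst (\<gamma> g) \<le> u0 \<and> snd (\<gamma> g) \<le> 3 * h")
      case True
      have gK: "g \<in> kernel 4 (jac_map f)" using g G(3) VM.span_base by blast
      have "is_euler (k, l) (\<lambda>i. g (idx4 i))"
      proof (cases "\<gamma> g = (u0, 3 * h)")
        case True
        then have "g j = 0" for j using none \<gamma>[OF g] g by metis
        then show ?thesis by (auto simp: is_euler_def intro: exI[of _ 0])
      next
        case False
        show ?thesis
          by (rule small_bidegree_euler[OF u1 contains kernel_bisyz(1)[OF gK \<gamma>[OF g]], of "fst (\<gamma> g)" "snd (\<gamma> g)"])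
            (use True False kernel_bisyz(2)[OF gK \<gamma>[OF g]] in auto)
      qed
      then obtain w where "\<And>i. g (idx4 i) = w * euler_vec (k, l) i" by (auto simp: is_euler_def)
      then show ?thesis by (intro exI[of _ "bicomp ((u0, 3 * h) - \<gamma> g) (c g) * w"]) (simp add: mult.assoc)
    next
      case False
      \<comment> \<open>A generator whose bidegree exceeds (u_0,3h) in some coordinate could enter
        only with a coefficient of negative degree.\<close>
      then have "bicomp ((u0, 3 * h) - \<gamma> g) (c g) = 0"
        by (intro bihom_part_neg[OF _ bicomp_in]) auto
      then show ?thesis by (intro exI[of _ 0]) simp
    qed
  qed
  from bchoice[OF this] obtain w where w: "\<And>g i. g \<in> G \<Longrightarrow> bicomp ((u0, 3 * h) - \<gamma> g) (c g) * g (idx4 i) = w g * euler_vec (k, l) i"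
    by blast
  have "b i = (\<Sum>g\<in>G. w g) * euler_vec (k, l) i" for i
  proof -
    have "b i = bicomp ((u0, 3 * h) - partial_bidegree (k, l) i) (t (idx4 i))"
      using b(2) by (simp add: tb bicomp_id bisyz_def)
    also have "\<dots> = (\<Sum>g\<in>G. bicomp ((u0, 3 * h) - partial_bidegree (k, l) i) (c g * g (idx4 i)))"
      unfolding c fun_sum_apply bicomp_sum ..
    also have "\<dots> = (\<Sum>g\<in>G. w g * euler_vec (k, l) i)"
    proof (rule sum.cong[OF refl])
      fix g assume g: "g \<in> G"
      have "g (idx4 i) \<in> bihom_part (\<gamma> g - partial_bidegree (k, l) i)"
        using \<gamma>[OF g] by (simp add: vhom_def flip: pbn_idx4)
      from bicomp_mult[OF this] w[OF g] show "bicomp ((u0, 3 * h) - partial_bidegree (k, l) i) (c g * g (idx4 i)) = w g * euler_vec (k, l) i"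
        by simp
    qed
    finally show ?thesis by (simp add: sum_distrib_right)
  qed
  then show False using b(3) by (auto simp: is_euler_def)
qed

lemma jac_map_vhom: "vhom (\<lambda>_. 0) (pbn j) (jac_map f j)"
  using partial_bihom[OF f] by (simp add: vhom_def jac_map_def pbn_def)

proposition minimal_first_syzygy: "has_minimal_first_syzygy (k, l) f (u0, 3 * h)"
proof -
  let ?K = "kernel 4 (jac_map f)"
  from minimal_homogeneous_generators[OF kernel_graded[of 4 "\<lambda>_. 0" pbn "jac_map f", OF jac_map_vhom]]
  obtain G where G0: "finite G \<and> (\<forall>g\<in>G. \<exists>\<gamma>. vhom pbn \<gamma> g) \<and> VM.span G = ?K \<and> (\<forall>H. H \<subset> G \<longrightarrow> VM.span H \<noteq> ?K)" ..
  then have G: "finite G" "\<And>g. g \<in> G \<Longrightarrow> \<exists>\<gamma>. vhom pbn \<gamma> g" "VM.span G = ?K" "\<And>H. H \<subset> G \<Longrightarrow> VM.span H \<noteq> ?K"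
    by simp_all
  have hom: "vec4 g \<in> bihom_syz (k, l) \<gamma>" if "vhom pbn \<gamma> g" for g \<gamma>
    using that by (simp add: bihom_syz_def vec4_def vhom_def flip: pbn_idx4)
  have supp: "v j = 0" if "v \<in> ?K" "j \<ge> 4" for v j using that by (simp add: kernel_def)
  have "minimal_bihom_generators (k, l) f (vec4 ` G)"
    unfolding minimal_bihom_generators_def
  proof (intro conjI ballI allI impI)
    show "\<exists>uv. a \<in> bihom_syz (k, l) uv" if "a \<in> vec4 ` G" for a using that hom G(2) by blast
    show "S4.span (vec4 ` G) = Syz f" unfolding vec4.span_image G(3) Syz_eq ..
    fix H assume H: "H \<subset> vec4 ` G"
    \<comment> \<open>\<open>vec4\<close> is injective on sequences supported below 4, so a proper
      generating subset would pull back to one of \<open>G\<close>.\<close>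
    define G' where "G' = {g \<in> G. vec4 g \<in> H}"
    have img: "H = vec4 ` G'" using H by (auto simp: G'_def)
    have G': "G' \<subset> G" using H by (auto simp: G'_def)
    show "S4.span H \<noteq> Syz f"
    proof
      assume "S4.span H = Syz f"
      then have eq: "vec4 ` VM.span G' = vec4 ` ?K" unfolding img vec4.span_image Syz_eq .
      have sub: "VM.span G' \<subseteq> ?K" using VM.span_mono[of G' G] G' G(3) by blast
      have "?K \<subseteq> VM.span G'"
      proof
        fix v assume v: "v \<in> ?K"
        then obtain v' where v': "v' \<in> VM.span G'" "vec4 v = vec4 v'" using eq by blast
        then have "v = v'" using supp v sub by (intro vec4_inj) blast+
        then show "v \<in> VM.span G'" using v'(1) by simp
      qed
      then show False using G(4)[OF G'] sub by blast
    qed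
  qed
  moreover obtain g where "g \<in> G" "vhom pbn (u0, 3 * h) g" using generators_contain[OF G(1-3)] by blast
  ultimately show ?thesis unfolding has_minimal_first_syzygy_def using hom by blast
qed

proposition regularity_bound: "reg_quotient (jacobian_ideal f) \<ge> ereal (of_int (u0 + 3 * h - 2))"
proof -
  obtain rr gg bb where seq: "rr 0 = 4" "gg 0 = jac_map f" "bb 0 = pbn"
    "\<And>n. VM.span (gg (Suc n) ` {..<rr (Suc n)}) = kernel (rr n) (gg n)"
    "\<And>n l. l < rr (Suc n) \<Longrightarrow> vhom (bb n) (bb (Suc n) l) (gg (Suc n) l)"
    "\<And>n. no_constants (rr n) (gg n) (bb n)"
    by (rule resolution_sequence[of 4 "\<lambda>_. 0" pbn "jac_map f", OF jac_map_vhom jacobian_no_constants]) (rule that)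
  \<comment> \<open>Stage n is the map from F_(n+1) to F_n: stage 0 is the row of derivatives, and
    F_0 = S is put in front. The shifts are total degrees.\<close>
  define r where "r = (\<lambda>i. case i of 0 \<Rightarrow> 1 | Suc n \<Rightarrow> rr n)"
  define a where "a = (\<lambda>i j. case i of 0 \<Rightarrow> 0 | Suc n \<Rightarrow> fst (bb n j) + snd (bb n j))"
  define \<phi> where "\<phi> = (\<lambda>i j l. gg i l j)"
  have r: "r 0 = 1" "r (Suc n) = rr n" for n by (simp_all add: r_def)
  have gen_kernel: "gg (Suc n) l \<in> kernel (rr n) (gg n)" if "l < rr (Suc n)" for n l
    using VM.span_base[of "gg (Suc n) l" "gg (Suc n) ` {..<rr (Suc n)}"] seq(4)[of n] that by blast
  have supp: "gg i l j = 0" if "l < rr i" "j \<ge> r i" for i l j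
  proof (cases i)
    case 0
    then show ?thesis using that by (simp add: seq r jac_map_def)
  next
    case (Suc n)
    then show ?thesis using gen_kernel[of l n] that by (simp add: r kernel_def)
  qed
  have "minimal_graded_free_resolution (jacobian_ideal f) r a (\<lambda>_. 1) \<phi>"
    unfolding minimal_graded_free_resolution_def
  proof (intro conjI allI impI)
    show "1 \<in> hom_part (a 0 j)" for j by (simp add: hom_part_def a_def)
    show "\<phi> i j l \<in> hom_part (a (Suc i) l - a i j)" if "j < r i" "l < r (Suc i)" for i j l
    proof (cases i)
      case 0
      then have "\<phi> i j l \<in> bihom_part (pbn l)" using jac_map_vhom[of l] by (simp add: \<phi>_def seq vhom_def)
      from bihom_part_imp_hom_part[OF this] show ?thesis using 0 by (simp add: a_def seq)
    next
      case (Suc n)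
      then have "\<phi> i j l \<in> bihom_part (bb (Suc n) l - bb n j)" using seq(5)[of l n] that by (simp add: \<phi>_def vhom_def r)
      from bihom_part_imp_hom_part[OF this] show ?thesis using Suc by (simp add: a_def algebra_simps)
    qed
    show "\<exists>v. s - (\<Sum>j<r 0. 1 * v j) \<in> jacobian_ideal f" for s
      by (rule exI[of _ "\<lambda>_. s"]) (simp add: r)
    show "(\<Sum>j<r 0. 1 * v j) \<in> jacobian_ideal f \<longleftrightarrow> (\<exists>w. \<forall>j<r 0. v j = (\<Sum>l<r 1. \<phi> 0 j l * w l))" for v
    proof -
      have "(\<Sum>l<r 1. \<phi> 0 0 l * w l) = (\<Sum>i\<in>UNIV. w (idx4 i) * partial i f)" for w
        unfolding sum_idx4[of "\<lambda>j i. w j * partial i f"]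
        by (simp add: r_def seq \<phi>_def jac_map_def mult.commute)
      moreover have "(\<exists>b. s = (\<Sum>i\<in>UNIV. b i * partial i f)) \<longleftrightarrow> (\<exists>w. s = (\<Sum>i\<in>UNIV. w (idx4 i) * partial i f))" for s
      proof
        assume "\<exists>b. s = (\<Sum>i\<in>UNIV. b i * partial i f)"
        then obtain b where "s = (\<Sum>i\<in>UNIV. b i * partial i f)" ..
        then show "\<exists>w. s = (\<Sum>i\<in>UNIV. w (idx4 i) * partial i f)"
          by (intro exI[of _ "\<lambda>j. b (of_nat j)"]) (simp add: idx4)
      next
        assume "\<exists>w. s = (\<Sum>i\<in>UNIV. w (idx4 i) * partial i f)"
        then obtain w where "s = (\<Sum>i\<in>UNIV. w (idx4 i) * partial i f)" ..
        then show "\<exists>b. s = (\<Sum>i\<in>UNIV. b i * partial i f)"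
          by (rule exI[of _ "\<lambda>i. w (idx4 i)"])
      qed
      ultimately show ?thesis by (simp add: r jacobian_ideal_iff)
    qed
    show "(\<forall>j<r i. (\<Sum>l<r (Suc i). \<phi> i j l * v l) = 0) \<longleftrightarrow>
      (\<exists>w. \<forall>l<r (Suc i). v l = (\<Sum>p<r (Suc (Suc i)). \<phi> (Suc i) l p * w p))" for i v
    proof -
      \<comment> \<open>\<open>kernel\<close> demands zeros beyond the rank, whereas exactness of a
        resolution ignores those entries.\<close>
      define v' where "v' = (\<lambda>l. if l < rr i then v l else 0)"
      have sum_v': "(\<Sum>l<rr i. v' l * gg i l j) = (\<Sum>l<rr i. \<phi> i j l * v l)" for j
        by (rule sum.cong) (auto simp: v'_def \<phi>_def mult.commute)
      have "(\<Sum>l<rr i. v' l * gg i l j) = 0" if "j \<ge> r i" for j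
        using supp that by (intro sum.neutral) auto
      then have outside: "(\<Sum>l<r (Suc i). \<phi> i j l * v l) = 0" if "j \<ge> r i" for j
        using that unfolding sum_v' r by blast
      have "(\<forall>j<r i. (\<Sum>l<r (Suc i). \<phi> i j l * v l) = 0) \<longleftrightarrow> (\<forall>j. (\<Sum>l<r (Suc i). \<phi> i j l * v l) = 0)"
        using outside leI by blast
      also have "\<dots> \<longleftrightarrow> v' \<in> kernel (rr i) (gg i)"
        unfolding kernel_def mem_Collect_eq sum_v' r by (simp add: v'_def)
      also have "\<dots> \<longleftrightarrow> (\<exists>w. \<forall>l. v' l = (\<Sum>p<rr (Suc i). gg (Suc i) p l * w p))"
        unfolding seq(4)[symmetric] by (rule in_span_image_iff)
      also have "\<dots> \<longleftrightarrow> (\<exists>w. \<forall>l<r (Suc i). v l = (\<Sum>p<r (Suc (Suc i)). \<phi> (Suc i) l p * w p))"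
      proof -
        have "(\<forall>l. v' l = (\<Sum>p<rr (Suc i). gg (Suc i) p l * w p)) \<longleftrightarrow> (\<forall>l<rr i. v l = (\<Sum>p<rr (Suc i). gg (Suc i) p l * w p))" for w
        proof -
          have "(\<Sum>p<rr (Suc i). gg (Suc i) p l * w p) = 0" if "\<not> l < rr i" for l
            using supp[of _ "Suc i" l] that by (intro sum.neutral) (auto simp: r)
          then show ?thesis by (auto simp: v'_def)
        qed
        then show ?thesis by (simp add: r \<phi>_def)
      qed
      finally show ?thesis .
    qed
    show "lk (\<phi> i j l) 0 = 0" if "j < r i" "l < r (Suc i)" for i j l
    proof (cases i)
      case 0
      have "lk (partial (of_nat l) f) 0 = 0"
      proof (rule ccontr)
        assume "lk (partial (of_nat l) f) 0 \<noteq> 0"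
        from bihom_partD[OF partial_bihom[OF f] this] show False
          unfolding partial_bidegree_kl using k h by (auto simp: l_def zero_prod_def split: if_splits)
      qed
      then show ?thesis using 0 by (simp add: \<phi>_def seq jac_map_def)
    next
      case (Suc n)
      have l: "l < rr (Suc n)" and j: "j < rr n" using that Suc by (simp_all add: r)
      from bspec[OF seq(6)[unfolded no_constants_def] gen_kernel[OF l]] seq(5)[OF l] j
      have "lk (gg (Suc n) l j) 0 = 0" by blast
      then show ?thesis by (simp add: Suc \<phi>_def)
    qed
  qed
  moreover have "\<exists>g\<in>gg 1 ` {..<rr 1}. vhom pbn (u0, 3 * h) g \<and> (\<exists>j. g j \<noteq> 0)"
  proof (rule generators_contain)
    show "\<exists>\<gamma>. vhom pbn \<gamma> g" if g: "g \<in> gg 1 ` {..<rr 1}" for g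
    proof -
      obtain l where "l < rr 1" "g = gg 1 l" using g by blast
      then have "vhom pbn (bb 1 l) g" using seq(5)[of l 0] seq(3) by simp
      then show ?thesis by blast
    qed
    show "VM.span (gg 1 ` {..<rr 1}) = kernel 4 (jac_map f)"
      using seq(4)[of 0] seq(1,2) by simp
  qed simp
  then obtain l where l: "l < rr 1" "vhom pbn (u0, 3 * h) (gg 1 l)" "\<exists>j. gg 1 l j \<noteq> 0"
    by blast
  moreover have "bb 1 l = (u0, 3 * h)"
  proof -
    obtain j where j: "gg 1 l j \<noteq> 0" using l(3) by blast
    have "gg 1 l j \<in> bihom_part ((u0, 3 * h) - pbn j)" "gg 1 l j \<in> bihom_part (bb 1 l - pbn j)"
      using l(2) seq(5)[of l 0] l(1) by (simp_all add: vhom_def seq)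
    then have "(u0, 3 * h) - pbn j = bb 1 l - pbn j" using bihom_part_disjoint j by blast
    then show ?thesis by simp
  qed
  \<comment> \<open>Generators of the first syzygies are basis vectors of F_2, because S/J_f is
    resolved; hence the summand -2.\<close>
  ultimately have "ereal (of_int (u0 + 3 * h - 2)) \<in> {ereal (of_int (a i j - int i)) | r a \<epsilon> \<phi> i j.
     minimal_graded_free_resolution (jacobian_ideal f) r a \<epsilon> \<phi> \<and> j < r i}"
    by (intro CollectI exI[of _ r] exI[of _ a] exI[of _ "\<lambda>_. 1"] exI[of _ \<phi>] exI[of _ "2::nat"] exI[of _ l])
      (simp add: a_def r_def numeral_2_eq_2)
  then show ?thesis unfolding reg_quotient_def by (rule Sup_upper)
qed

end

section \<open>Numerical identities and the general polynomial\<close>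

lemma regularity_identity:
  fixes x y :: real
  shows "(3 * x + 1) / 2 * (x + 2 * y + 1) - (3 * x\<^sup>2 + 5) / 2 = 2 * x + y * (3 * x - 2) + 3 * y - 2"
proof -
  have "2 * ((3 * x + 1) / 2 * (x + 2 * y + 1) - (3 * x\<^sup>2 + 5) / 2) = (3 * x + 1) * (x + 2 * y + 1) - (3 * x\<^sup>2 + 5)"
    by (simp add: field_simps)
  also have "\<dots> = 2 * (2 * x + y * (3 * x - 2) + 3 * y - 2)"
    by (simp add: power2_eq_square algebra_simps)
  finally show ?thesis by (metis mult_cancel_left zero_neq_numeral)
qed

text \<open>The special bound is the general one at z = 3x + 1, with equality.\<close>

lemma regularity_identity':
  fixes x z :: real
  assumes "x = (z - 1) / 3"
  shows "1 / 3 * (z\<^sup>2 + z - 8) = (3 * x + 1) / 2 * z - (3 * x\<^sup>2 + 5) / 2"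
proof -
  have z: "z = 3 * x + 1" using assms by simp
  show ?thesis unfolding z by (simp add: power2_eq_square algebra_simps)
qed

text \<open>All conclusions are drawn from one containment of a graded piece in J_f; a single
  polynomial \<open>f0\<close> with this containment makes its open set nonempty.\<close>

lemma general_of_jacobian:
  assumes "f0 \<in> bihom_part kl" "bihom_part (u, v) \<subseteq> jacobian_ideal f0"
    and "\<And>f. f \<in> bihom_part kl \<Longrightarrow> bihom_part (u, v) \<subseteq> jacobian_ideal f \<Longrightarrow> Q f"
  shows "general_in (bihom_part kl) Q"
proof -
  obtain D where D: "polyfun D" "D f0 \<noteq> 0"
    "\<forall>f\<in>bihom_part kl. D f \<noteq> 0 \<longrightarrow> bihom_part (u, v) \<subseteq> jacobian_ideal f"
    using jacobian_contains_open[OF assms(1,2)] by blast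
  obtain P where P: "\<And>f. eval_poly (lk f) P = D f" using D(1) unfolding polyfun_def by blast
  let ?U = "{f \<in> bihom_part kl. \<exists>P\<in>{P}. eval_poly (lk f) P \<noteq> 0}"
  have "zariski_open_in (bihom_part kl) ?U" unfolding zariski_open_in_def by blast
  moreover have "f0 \<in> ?U" using assms(1) D(2) P by simp
  moreover have "\<forall>f\<in>?U. Q f" using D(3) P assms(3) by simp
  ultimately show ?thesis unfolding general_in_def by blast
qed

text \<open>For h = 0 the Fermat type form already works at u_1 = u_0 = 2k; for h \<ge> 1 the pencil
  gives all large u_1.\<close>

lemma exists_good_odd:
  fixes k h u0 :: int
  assumes k: "k \<ge> 1" and h: "h \<ge> 0" and u0: "u0 = 2 * k + h * (3 * k - 2)"
  shows "\<exists>f u1. f \<in> bihom_part (k, 2 * h + 1) \<and> u1 \<ge> u0 \<and> bihom_part (u1, 3 * h) \<subseteq> jacobian_ideal f"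
proof (cases "h = 0")
  case True
  have "1 \<le> nat k" using k by simp
  then obtain f where "f \<in> bihom_part (int (nat k), int 1)" "bihom_part (2 * int (nat k), 0) \<subseteq> jacobian_ideal f"
    using exists_fermat_type[of "nat k" 1] by blast
  then show ?thesis using True k u0 by (intro exI[of _ f] exI[of _ "2 * k"]) simp
next
  case False
  interpret pencil "nat h" by unfold_locales (use False h in simp)
  have "1 \<le> nat k" using k by simp
  then obtain f U where f: "f \<in> bihom_part (int (nat k), int l)"
    "\<And>u. u \<ge> U \<Longrightarrow> bihom_part (u, int (3 * nat h)) \<subseteq> jacobian_ideal f"
    using exists_odd[of "nat k"] by blast
  show ?thesis
    using f(1) f(2)[of "max U u0"] k h by (intro exI[of _ f] exI[of _ "max U u0"]) (simp add: add.commute)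
qed

theorem theorem4p1:
  fixes k d :: int
  assumes "k \<ge> 1" and "d - k \<ge> 1"
  shows "general_in (bihom_part (k, d - k)) (\<lambda>f.
     f \<noteq> 0 \<and> reduced_scheme f \<and>
     (odd (d - k) \<longrightarrow>
        has_minimal_first_syzygy (k, d - k) f
          (2 * k + (d - k - 1) div 2 * (3 * k - 2), (d - k - 1) div 2 * 3)) \<and>
     (odd (d - k) \<longrightarrow>
        reg_quotient (jacobian_ideal f)
          \<ge> ereal ((3 * real_of_int k + 1) / 2 * real_of_int d - (3 * (real_of_int k)\<^sup>2 + 5) / 2)) \<and>
     (real_of_int k = (real_of_int d - 1) / 3 \<longrightarrow>
        reg_quotient (jacobian_ideal f)
          \<ge> ereal (1 / 3 * ((real_of_int d)\<^sup>2 + real_of_int d - 8))))"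
  (is "general_in _ ?Q")
proof (cases "odd (d - k)")
  case True
  define h where "h = (d - k - 1) div 2"
  define u0 where "u0 = 2 * k + h * (3 * k - 2)"
  have l: "d - k = 2 * h + 1" using True by (auto simp: h_def elim!: oddE)
  have h: "h \<ge> 0" using assms(2) l by simp
  obtain f0 u1 where f0: "f0 \<in> bihom_part (k, d - k)" "u1 \<ge> u0" "bihom_part (u1, 3 * h) \<subseteq> jacobian_ideal f0"
    using exists_good_odd[OF assms(1) h u0_def] l by metis
  have d: "real_of_int d = real_of_int k + 2 * real_of_int h + 1"
  proof -
    have "d = k + 2 * h + 1" using l by simp
    then show ?thesis by simp
  qed
  have bound: "(3 * real_of_int k + 1) / 2 * real_of_int d - (3 * (real_of_int k)\<^sup>2 + 5) / 2 = of_int (u0 + 3 * h - 2)"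
    unfolding d u0_def by (simp only: regularity_identity of_int_add of_int_mult of_int_diff of_int_numeral)
  have bound': "1 / 3 * ((real_of_int d)\<^sup>2 + real_of_int d - 8)
      = (3 * real_of_int k + 1) / 2 * real_of_int d - (3 * (real_of_int k)\<^sup>2 + 5) / 2"
    if "real_of_int k = (real_of_int d - 1) / 3"
    by (rule regularity_identity'[OF that])
  show ?thesis
  proof (rule general_of_jacobian[OF f0(1,3)])
    fix f assume ff: "f \<in> bihom_part (k, d - k)" "bihom_part (u1, 3 * h) \<subseteq> jacobian_ideal f"
    interpret good_odd k "d - k" h u0 f u1
      by unfold_locales (use assms h l u0_def ff f0(2) in auto)
    have uv: "u1 \<ge> 0" "3 * h \<ge> 0" using u1 u0_ge assms(1) h by auto
    have deg: "(2 * k + (d - k - 1) div 2 * (3 * k - 2), (d - k - 1) div 2 * 3) = (u0, 3 * h)"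
      by (simp add: h_def u0_def)
    have reg1: "reg_quotient (jacobian_ideal f)
          \<ge> ereal ((3 * real_of_int k + 1) / 2 * real_of_int d - (3 * (real_of_int k)\<^sup>2 + 5) / 2)"
      unfolding bound by (rule regularity_bound)
    have reg2: "reg_quotient (jacobian_ideal f) \<ge> ereal (1 / 3 * ((real_of_int d)\<^sup>2 + real_of_int d - 8))"
      if "real_of_int k = (real_of_int d - 1) / 3"
      unfolding bound'[OF that] by (rule reg1)
    show "?Q f"
      unfolding deg using nonzero_of_jacobian[OF uv ff(2)] reduced_of_jacobian[OF uv ff(2)]
        minimal_first_syzygy reg1 reg2 by blast
  qed
next
  case False
  have "1 \<le> nat k" "1 \<le> nat (d - k)" using assms by auto
  from exists_fermat_type[OF this] obtain f0 where
    f0: "f0 \<in> bihom_part (k, d - k)" "bihom_part (2 * k, 3 * (d - k)) \<subseteq> jacobian_ideal f0"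
    using assms by auto
  \<comment> \<open>The value k = (d-1)/3 gives d - k = 2k + 1, which is odd, so the last claim does
    not arise for even d - k.\<close>
  have no: "real_of_int k \<noteq> (real_of_int d - 1) / 3"
  proof
    assume "real_of_int k = (real_of_int d - 1) / 3"
    then have "real_of_int d = real_of_int (3 * k + 1)" by simp
    then have "d = 3 * k + 1" by (simp only: of_int_eq_iff)
    then show False using False by simp
  qed
  show ?thesis
  proof (rule general_of_jacobian[OF f0])
    fix f assume f: "bihom_part (2 * k, 3 * (d - k)) \<subseteq> jacobian_ideal f"
    have uv: "2 * k \<ge> 0" "3 * (d - k) \<ge> 0" using assms by auto
    show "?Q f"
      using nonzero_of_jacobian[OF uv f] reduced_of_jacobian[OF uv f] False no by blast
  qed
qed

end
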